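(* Let $G(\lambda)$ be symmetric with $\mathcal S(\lambda)=\left[\begin{array}{c|c}P(\lambda)&B^T\\ \hline B&A-\lambda E\end{array}\right]$ the system matrix of a minimal symmetric realization $G(\lambda)=P(\lambda)+B^T(\lambda E-A)^{-1}B$. Let $0\le h\le m-1$ be even, and consider the GFPR $$\mathbb L(\lambda)=\mathbb L_{\mathcal S}(h,\mathbf t_{w_h},\mathbf t_{v_h},\mathcal X,\mathcal Y)=\left[\begin{array}{c|c}L_P(h,\mathbf t_{w_h},\mathbf t_{v_h},\mathcal X,\mathcal Y)&e_{m-\alpha}\otimes B^T\\ \hline e^T_{m-\alpha}\otimes B&A-\lambda E\end{array}\right]$$ associated with $\mathcal S(\lambda)$, where $\alpha=i_0(\mathbf t_{w_h},\mathbf w_h)$, $\mathcal X$ and $\mathcal Y$ are nonsingular matrix assignments and all the matrices in $\mathcal X$ and $\mathcal Y$ are symmetric. If $m$ is odd then $\mathbb L(\lambda)$ is a symmetric Rosenbrock strong linearization of $G(\lambda)$. If $m$ is even then $\mathbb L(\lambda)$ is a symmetric Rosenbrock strong linearization of $G(\lambda)$ when the leading coefficient $A_m$ of $P(\lambda)$ is nonsingular. Also the transfer function $\mathbb G(\lambda)=L(\lambda)+(e_{m-\alpha}\otimes B^T)(\lambda E-A)^{-1}(e^T_{m-\alpha}\otimes B)$ of $\mathbb L(\lambda)$ is symmetric, where $L(\lambda)=L_P(h,\mathbf t_{w_h},\mathbf t_{v_h},\mathcal X,\mathcal Y)$.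
   Context: Setting: a rational matrix $F(\lambda)$ (or pencil) is symmetric if $F(\lambda)^T=F(\lambda)$. $G(\lambda)\in\mathbb C(\lambda)^{n\times n}$, $P(\lambda)=\sum_{i=0}^m\lambda^iA_i$ symmetric with $A_i\in\mathbb C^{n\times n}$, $A_m\ne0$, $m\ge1$; the realization $G(\lambda)=P(\lambda)+B^T(\lambda E-A)^{-1}B$ is minimal ($r$ smallest possible), with $A,E\in\mathbb C^{r\times r}$ symmetric, $E$ nonsingular, $B\in\mathbb C^{r\times n}$. Below $C:=B^T$. $e_j$ is the $j$-th column of $I_m$. Elementary matrices: for $X\in\mathbb C^{n\times n}$, $M_0(X)=\mathrm{diag}(I_{(m-1)n},X)$, $M_{-m}(X)=\mathrm{diag}(X,I_{(m-1)n})$, and for $1\le i\le m-1$, $M_i(X)=\mathrm{diag}\big(I_{(m-i-1)n},\begin{bmatrix}X&I_n\\ I_n&0\end{bmatrix},I_{(i-1)n}\big)$, $M_{-i}(X)=\mathrm{diag}\big(I_{(m-i-1)n},\begin{bmatrix}0&I_n\\ I_n&X\end{bmatrix},I_{(i-1)n}\big)$. For $i\in\{-m,\dots,m-1\}$: $\mathbb M_i(X)=\mathrm{diag}(M_i(X),I_r)$; $M_i^P=M_i(-A_i)$ if $i\ge0$, $M_i^P=M_i(A_{-i})$ if $i<0$; $\mathbb M_i^P=\mathrm{diag}(M_i^P,I_r)$. Fiedler matrices: $\mathbb M_0^{\mathcal S}=\left[\begin{array}{c|c}M_0^P&-e_m\otimes C\\ \hline -e_m^T\otimes B&-A\end{array}\right]$,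 $\mathbb M_{-m}^{\mathcal S}=\mathrm{diag}(M_{-m}^P,-E)$, $\mathbb M_i^{\mathcal S}=\mathrm{diag}(M_i^P,I_r)$ and $\mathbb M_{-i}^{\mathcal S}=(\mathbb M_i^{\mathcal S})^{-1}$ for $1\le i\le m-1$. Index tuples: $(a:b)=(a,a+1,\dots,b)$ if $a\le b$, empty otherwise; tuples separated by commas are concatenated; $\mathbf t+k$ adds $k$ to each entry; $\mathrm{rev}$ reverses a tuple. A matrix assignment for $\mathbf t=(t_1,\dots,t_k)$ is a tuple $X=(X_1,\dots,X_k)$ of $n\times n$ matrices; it is nonsingular if the matrices at positions occupied by indices $0$ and $-m$ are nonsingular. $M_{\mathbf t}(X)=\prod_jM_{t_j}(X_j)$, $\mathbb M_{\mathbf t}(X)=\prod_j\mathbb M_{t_j}(X_j)$, and $M^P_{\mathbf t},\mathbb M^P_{\mathbf t},\mathbb M^{\mathcal S}_{\mathbf t}$ are the corresponding ordered products. For a tuple $\beta$ of nonnegative indices with $0\in\beta$, $i_0(\beta)$ is the largest $p\ge0$ such that $(p,\dots,1,0)$ is a subtuple of $\beta$ (obtained by deleting entries). Admissible tuples: an admissible tuple of $\{0:k\}$ with index $p$, $0\le p\le k$, $k-p$ even, is $\mathbf w=(k-1:k,\,k-3:k-2,\dots,p+1:p+2,\,0:p)$; it is simple if $p\in\{0,1\}$ ($p=0$ for $k$ even, $p=1$ for $k$ odd). Its symmetric complement is $\mathbf c_w=(k-1,k-3,\dots,p+3,p+1,(0:p)_{rev_c})$ if $p\ge1$, where $(0:p)_{rev_c}=(0:p-1,0:p-2,\dots,0:1,0)$;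 $\mathbf c_w=(k-1,k-3,\dots,1)$ if $p=0,k>0$; $\mathbf c_w=\emptyset$ if $k=0$. A tuple is in canonical form for $k\ge0$ if it is $(a_1:k-2,a_2:k-4,\dots,a_{\lfloor k/2\rfloor}:k-2\lfloor k/2\rfloor)$ with all $a_i\ge0$ (empty for $k=0,1$). The pencils: $\mathbf w_h$ and $\mathbf v_h+m$ are the simple admissible tuples of $\{0:h\}$ and $\{0:m-h-1\}$, $\mathbf c_{w_h}$ and $\mathbf c_{v_h}+m$ their symmetric complements, $\mathbf t_{w_h}$ and $\mathbf t_{v_h}+m$ are any tuples in canonical form for $h$ and $m-h-1$, and $\mathcal X,\mathcal Y$ are matrix assignments for $\mathbf t_{w_h},\mathbf t_{v_h}$. Then $L_P(h,\mathbf t_{w_h},\mathbf t_{v_h},\mathcal X,\mathcal Y)=M_{(\mathbf t_{v_h},\mathbf t_{w_h})}(\mathcal Y,\mathcal X)(\lambda M^P_{\mathbf v_h}-M^P_{\mathbf w_h})M^P_{(\mathbf c_{w_h},\mathbf c_{v_h})}M_{(\mathrm{rev}(\mathbf t_{w_h}),\mathrm{rev}(\mathbf t_{v_h}))}(\mathrm{rev}(\mathcal X),\mathrm{rev}(\mathcal Y))$ and $\mathbb L_{\mathcal S}(h,\mathbf t_{w_h},\mathbf t_{v_h},\mathcal X,\mathcal Y)=\mathbb M_{(\mathbf t_{v_h},\mathbf t_{w_h})}(\mathcal Y,\mathcal X)(\lambda\mathbb M^{\mathcal S}_{\mathbf v_h}-\mathbb M^{\mathcal S}_{\mathbf w_h})\mathbb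 M^P_{(\mathbf c_{w_h},\mathbf c_{v_h})}\mathbb M_{(\mathrm{rev}(\mathbf t_{w_h}),\mathrm{rev}(\mathbf t_{v_h}))}(\mathrm{rev}(\mathcal X),\mathrm{rev}(\mathcal Y))$. A matrix polynomial is unimodular if its determinant is a nonzero constant; a square rational matrix is biproper if its limit at $\infty$ exists and is nonsingular. Rosenbrock strong linearization of $G(\lambda)$: an $(mn+r)\times(mn+r)$ pencil $\left[\begin{array}{c|c}\mathcal X'-\lambda\mathcal Y'&\mathcal C\\ \hline\mathcal B&H-\lambda K\end{array}\right]$ with $K\in\mathbb C^{r\times r}$ nonsingular, irreducible ($[\mathcal B\ \ H-\lambda K]$ and $\begin{bmatrix}\mathcal C\\ H-\lambda K\end{bmatrix}$ have rank $r$ for all $\lambda\in\mathbb C$), such that (i) $\mathrm{diag}(U(\lambda),U_0)\,\mathbb L(\lambda)\,\mathrm{diag}(V(\lambda),V_0)=\mathrm{diag}(I_{(m-1)n},\mathcal S(\lambda))$ for some $mn\times mn$ unimodular $U,V$ and nonsingular $U_0,V_0\in\mathbb C^{r\times r}$; (ii) $\mathcal O_\ell(\lambda)\lambda^{-1}\mathbb G(\lambda)\mathcal O_r(\lambda)=\mathrm{diag}(I_{(m-1)n},\lambda^{-m}G(\lambda))$ for some $mn\times mn$ biproper $\mathcal O_\ell,\mathcal O_r$, where $\mathbb G(\lambda)=\mathcal X'-\lambda\mathcal Y'+\mathcal C(\lambda K-H)^{-1}\mathcal B$ is the transfer function. *)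

theory Defs
  imports
    "Jordan_Normal_Form.DL_Rank"
    "Jordan_Normal_Form.Gauss_Jordan_Elimination"
    "HOL-Computational_Algebra.Computational_Algebra"
    "HOL-Computational_Algebra.Field_as_Ring"
    "HOL-Library.Sublist"
begin

text \<open>
  Constant matrices have type \<^typ>\<open>complex mat\<close>, matrix polynomials \<^typ>\<open>complex poly mat\<close>, and
  rational matrices \<^typ>\<open>complex poly fract mat\<close>. Matrices may have dimension 0, so the state
  dimension \<open>r = 0\<close> is allowed. Throughout, \<open>n\<close> is the size of \<open>G\<close>, \<open>m\<close> the degree of \<open>P\<close>, and
  \<open>Ac i\<close> the coefficient of \<open>P\<close> at \<open>\<lambda>\<^sup>i\<close>, while \<open>A\<close>, \<open>E\<close>, \<open>B\<close>, \<open>C\<close> are the matrices of the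
  realization.
\<close>

section \<open>Matrices over constants, polynomials and rational functions\<close>

definition symmetric_mat :: "'a mat \<Rightarrow> bool" where
  "symmetric_mat M \<longleftrightarrow> transpose_mat M = M"

text \<open>Only meaningful for invertible \<open>M\<close>.\<close>
definition mat_inv :: "'a::field mat \<Rightarrow> 'a mat" where
  "mat_inv M = the (mat_inverse M)"

definition kron :: "'a::times mat \<Rightarrow> 'a mat \<Rightarrow> 'a mat" where
  "kron M N = mat (dim_row M * dim_row N) (dim_col M * dim_col N)
     (\<lambda>(i, j). M $$ (i div dim_row N, j div dim_col N) * N $$ (i mod dim_row N, j mod dim_col N))"

text \<open>The \<open>j\<close>-th column of \<open>I\<^sub>m\<close>, with \<open>j\<close> counted from 1, as an \<open>m \<times> 1\<close> matrix.\<close>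
definition e_col :: "nat \<Rightarrow> nat \<Rightarrow> 'a::zero_neq_one mat" where
  "e_col m j = mat_of_cols m [unit_vec m (j - 1)]"

definition mat_prod :: "nat \<Rightarrow> 'a::semiring_1 mat list \<Rightarrow> 'a mat" where
  "mat_prod N Ms = foldr (*) Ms (1\<^sub>m N)"

definition const_mat :: "complex mat \<Rightarrow> complex poly mat" where
  "const_mat M = map_mat (\<lambda>c. [:c:]) M"

text \<open>The pencil \<open>M - \<lambda> N\<close>.\<close>
definition pencil :: "complex mat \<Rightarrow> complex mat \<Rightarrow> complex poly mat" where
  "pencil M N = const_mat M - [:0, 1:] \<cdot>\<^sub>m const_mat N"

definition rat_mat :: "complex poly mat \<Rightarrow> complex poly fract mat" where
  "rat_mat M = map_mat to_fract M"

definition matpoly :: "nat \<Rightarrow> nat \<Rightarrow> (nat \<Rightarrow> complex mat) \<Rightarrow> complex poly mat" where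
  "matpoly n m Ac = mat n n (\<lambda>(i, j). \<Sum>k\<le>m. monom (Ac k $$ (i, j)) k)"

definition unimodular :: "nat \<Rightarrow> complex poly mat \<Rightarrow> bool" where
  "unimodular k U \<longleftrightarrow> U \<in> carrier_mat k k \<and> (\<exists>c. c \<noteq> 0 \<and> det U = [:c:])"

text \<open>Evaluation in lowest terms; at a pole the value is 0 by the convention \<open>x / 0 = 0\<close>.\<close>
definition rat_eval :: "complex poly fract \<Rightarrow> complex \<Rightarrow> complex" where
  "rat_eval f z = poly (fst (quot_of_fract f)) z / poly (snd (quot_of_fract f)) z"

definition biproper :: "nat \<Rightarrow> complex poly fract mat \<Rightarrow> bool" where
  "biproper k F \<longleftrightarrow> F \<in> carrier_mat k k \<and>
     (\<exists>M \<in> carrier_mat k k. invertible_mat M \<and>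
        (\<forall>i<k. \<forall>j<k. (rat_eval (F $$ (i, j)) \<longlongrightarrow> M $$ (i, j)) at_infinity))"

section \<open>Realizations and Rosenbrock strong linearizations\<close>

text \<open>The rational matrix \<open>L(\<lambda>) + C (\<lambda> K - H)\<^sup>-\<^sup>1 B\<close>.\<close>
definition transfer_function ::
  "complex poly mat \<Rightarrow> complex mat \<Rightarrow> complex mat \<Rightarrow> complex mat \<Rightarrow> complex mat
     \<Rightarrow> complex poly fract mat" where
  "transfer_function L C B H K =
     rat_mat L + rat_mat (const_mat C) *
       mat_inv (rat_mat ([:0, 1:] \<cdot>\<^sub>m const_mat K - const_mat H)) * rat_mat (const_mat B)"

definition realization ::
  "nat \<Rightarrow> nat \<Rightarrow> complex poly fract mat \<Rightarrow> complex poly mat \<Rightarrow> complex mat \<Rightarrow> complex mat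
     \<Rightarrow> complex mat \<Rightarrow> complex mat \<Rightarrow> bool" where
  "realization n r G P A E B C \<longleftrightarrow>
     P \<in> carrier_mat n n \<and> A \<in> carrier_mat r r \<and> E \<in> carrier_mat r r \<and> invertible_mat E \<and>
     B \<in> carrier_mat r n \<and> C \<in> carrier_mat n r \<and> G = transfer_function P C B A E"

definition minimal_realization ::
  "nat \<Rightarrow> nat \<Rightarrow> complex poly fract mat \<Rightarrow> complex poly mat \<Rightarrow> complex mat \<Rightarrow> complex mat
     \<Rightarrow> complex mat \<Rightarrow> complex mat \<Rightarrow> bool" where
  "minimal_realization n r G P A E B C \<longleftrightarrow>
     realization n r G P A E B C \<and>
     (\<forall>r' P' A' E' B' C'. realization n r' G P' A' E' B' C' \<longrightarrow> r \<le> r')"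

definition system_matrix ::
  "complex poly mat \<Rightarrow> complex mat \<Rightarrow> complex mat \<Rightarrow> complex mat \<Rightarrow> complex mat
     \<Rightarrow> complex poly mat" where
  "system_matrix P A E B C = four_block_mat P (const_mat C) (const_mat B) (pencil A E)"

definition rosenbrock_strong_linearization ::
  "nat \<Rightarrow> nat \<Rightarrow> nat \<Rightarrow> complex poly mat \<Rightarrow> complex poly fract mat \<Rightarrow> complex poly mat
     \<Rightarrow> bool" where
  "rosenbrock_strong_linearization n m r S G L \<longleftrightarrow>
     (\<exists>X Y C B H K.
        X \<in> carrier_mat (m * n) (m * n) \<and> Y \<in> carrier_mat (m * n) (m * n) \<and>
        C \<in> carrier_mat (m * n) r \<and> B \<in> carrier_mat r (m * n) \<and>
        H \<in> carrier_mat r r \<and> K \<in> carrier_mat r r \<and> invertible_mat K \<and>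
        L = four_block_mat (pencil X Y) (const_mat C) (const_mat B) (pencil H K) \<and>
        (\<forall>z. vec_space.rank r (mat_of_cols r (cols B @ cols (H - z \<cdot>\<^sub>m K))) = r) \<and>
        (\<forall>z. vec_space.rank (m * n + r) (C @\<^sub>r (H - z \<cdot>\<^sub>m K)) = r) \<and>
        (\<exists>U V U0 V0.
           unimodular (m * n) U \<and> unimodular (m * n) V \<and>
           U0 \<in> carrier_mat r r \<and> invertible_mat U0 \<and>
           V0 \<in> carrier_mat r r \<and> invertible_mat V0 \<and>
           diag_block_mat [U, const_mat U0] * L * diag_block_mat [V, const_mat V0]
             = diag_block_mat [1\<^sub>m ((m - 1) * n), S]) \<and>
        (\<exists>Ol Or.
           biproper (m * n) Ol \<and> biproper (m * n) Or \<and>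
           Ol * (inverse (to_fract [:0, 1:]) \<cdot>\<^sub>m transfer_function (pencil X Y) C B H K) * Or
             = diag_block_mat [1\<^sub>m ((m - 1) * n), inverse (to_fract [:0, 1:]) ^ m \<cdot>\<^sub>m G]))"

section \<open>Index tuples\<close>

text \<open>
  Index tuples are lists of integers; \<open>(a:b)\<close> is the library's \<open>[a..b]\<close>. The admissible tuple
  \<open>(k-1:k, k-3:k-2, \<dots>, p+1:p+2, 0:p)\<close> of \<open>{0:k}\<close> with index \<open>p\<close>:
\<close>
definition admissible_tuple :: "nat \<Rightarrow> nat \<Rightarrow> int list" where
  "admissible_tuple k p =
     concat (map (\<lambda>j. [int k - 1 - 2 * int j .. int k - 2 * int j]) [0..<(k - p) div 2])
       @ [0..int p]"

text \<open>
  \<open>(k-1, k-3, \<dots>, p+1, 0:p-1, 0:p-2, \<dots>, 0:1, 0)\<close>; the second part is empty for \<open>p = 0\<close>, and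
  the whole tuple is empty for \<open>k = 0\<close>.
\<close>
definition symmetric_complement :: "nat \<Rightarrow> nat \<Rightarrow> int list" where
  "symmetric_complement k p =
     map (\<lambda>j. int k - 1 - 2 * int j) [0..<(k - p) div 2]
       @ concat (map (\<lambda>q. [0..int p - 1 - int q]) [0..<p])"

text \<open>The simple admissible tuple has index 0 for even \<open>k\<close> and 1 for odd \<open>k\<close>.\<close>
definition simple_admissible :: "nat \<Rightarrow> int list" where
  "simple_admissible k = admissible_tuple k (k mod 2)"

definition simple_complement :: "nat \<Rightarrow> int list" where
  "simple_complement k = symmetric_complement k (k mod 2)"

definition canonical_form :: "nat \<Rightarrow> int list \<Rightarrow> bool" where
  "canonical_form k t \<longleftrightarrow>
     (\<exists>a :: nat \<Rightarrow> nat. t = concat (map (\<lambda>i. [int (a i) .. int k - 2 * int i]) [1..<k div 2 + 1]))"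

definition shift :: "int \<Rightarrow> int list \<Rightarrow> int list" where
  "shift k t = map (\<lambda>i. i + k) t"

definition w_tuple :: "nat \<Rightarrow> int list" where
  "w_tuple h = simple_admissible h"

definition v_tuple :: "nat \<Rightarrow> nat \<Rightarrow> int list" where
  "v_tuple m h = shift (- int m) (simple_admissible (m - h - 1))"

definition cw_tuple :: "nat \<Rightarrow> int list" where
  "cw_tuple h = simple_complement h"

definition cv_tuple :: "nat \<Rightarrow> nat \<Rightarrow> int list" where
  "cv_tuple m h = shift (- int m) (simple_complement (m - h - 1))"

definition i0 :: "int list \<Rightarrow> nat" where
  "i0 \<beta> = (GREATEST p. subseq (rev [0..int p]) \<beta>)"

definition matrix_assignment :: "nat \<Rightarrow> int list \<Rightarrow> complex mat list \<Rightarrow> bool" where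
  "matrix_assignment n t X \<longleftrightarrow> length X = length t \<and> set X \<subseteq> carrier_mat n n"

definition nonsingular_assignment :: "nat \<Rightarrow> int list \<Rightarrow> complex mat list \<Rightarrow> bool" where
  "nonsingular_assignment m t X \<longleftrightarrow>
     (\<forall>j < length t. t ! j = 0 \<or> t ! j = - int m \<longrightarrow> invertible_mat (X ! j))"

section \<open>Elementary and Fiedler matrices\<close>

text \<open>\<open>M\<^sub>i(X)\<close> for \<open>-m \<le> i \<le> m-1\<close>; other indices are never used.\<close>
definition elem_mat :: "nat \<Rightarrow> nat \<Rightarrow> int \<Rightarrow> complex mat \<Rightarrow> complex mat" where
  "elem_mat n m i X =
     (if i = 0 then diag_block_mat [1\<^sub>m ((m - 1) * n), X]
      else if i = - int m then diag_block_mat [X, 1\<^sub>m ((m - 1) * n)]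
      else if i > 0 then
        diag_block_mat [1\<^sub>m ((m - nat i - 1) * n),
          four_block_mat X (1\<^sub>m n) (1\<^sub>m n) (0\<^sub>m n n), 1\<^sub>m ((nat i - 1) * n)]
      else
        diag_block_mat [1\<^sub>m ((m - nat (- i) - 1) * n),
          four_block_mat (0\<^sub>m n n) (1\<^sub>m n) (1\<^sub>m n) X, 1\<^sub>m ((nat (- i) - 1) * n)])"

definition elem_mat_ext :: "nat \<Rightarrow> nat \<Rightarrow> nat \<Rightarrow> int \<Rightarrow> complex mat \<Rightarrow> complex mat" where
  "elem_mat_ext n m r i X = diag_block_mat [elem_mat n m i X, 1\<^sub>m r]"

definition fiedler_P :: "nat \<Rightarrow> nat \<Rightarrow> (nat \<Rightarrow> complex mat) \<Rightarrow> int \<Rightarrow> complex mat" where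
  "fiedler_P n m Ac i = elem_mat n m i (if i \<ge> 0 then - Ac (nat i) else Ac (nat (- i)))"

definition fiedler_P_ext ::
  "nat \<Rightarrow> nat \<Rightarrow> nat \<Rightarrow> (nat \<Rightarrow> complex mat) \<Rightarrow> int \<Rightarrow> complex mat" where
  "fiedler_P_ext n m r Ac i = diag_block_mat [fiedler_P n m Ac i, 1\<^sub>m r]"

definition fiedler_S ::
  "nat \<Rightarrow> nat \<Rightarrow> nat \<Rightarrow> (nat \<Rightarrow> complex mat) \<Rightarrow> complex mat \<Rightarrow> complex mat \<Rightarrow> complex mat
     \<Rightarrow> complex mat \<Rightarrow> int \<Rightarrow> complex mat" where
  "fiedler_S n m r Ac A E B C i =
     (if i = 0 then
        four_block_mat (fiedler_P n m Ac 0) (- kron (e_col m m) C)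
          (- kron (transpose_mat (e_col m m)) B) (- A)
      else if i = - int m then diag_block_mat [fiedler_P n m Ac (- int m), - E]
      else if i > 0 then diag_block_mat [fiedler_P n m Ac i, 1\<^sub>m r]
      else mat_inv (diag_block_mat [fiedler_P n m Ac (- i), 1\<^sub>m r]))"

definition elem_prod :: "nat \<Rightarrow> nat \<Rightarrow> int list \<Rightarrow> complex mat list \<Rightarrow> complex mat" where
  "elem_prod n m t X = mat_prod (m * n) (map2 (elem_mat n m) t X)"

definition elem_prod_ext :: "nat \<Rightarrow> nat \<Rightarrow> nat \<Rightarrow> int list \<Rightarrow> complex mat list \<Rightarrow> complex mat"
  where
  "elem_prod_ext n m r t X = mat_prod (m * n + r) (map2 (elem_mat_ext n m r) t X)"

definition fiedler_P_prod :: "nat \<Rightarrow> nat \<Rightarrow> (nat \<Rightarrow> complex mat) \<Rightarrow> int list \<Rightarrow> complex mat" where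
  "fiedler_P_prod n m Ac t = mat_prod (m * n) (map (fiedler_P n m Ac) t)"

definition fiedler_P_ext_prod ::
  "nat \<Rightarrow> nat \<Rightarrow> nat \<Rightarrow> (nat \<Rightarrow> complex mat) \<Rightarrow> int list \<Rightarrow> complex mat" where
  "fiedler_P_ext_prod n m r Ac t = mat_prod (m * n + r) (map (fiedler_P_ext n m r Ac) t)"

definition fiedler_S_prod ::
  "nat \<Rightarrow> nat \<Rightarrow> nat \<Rightarrow> (nat \<Rightarrow> complex mat) \<Rightarrow> complex mat \<Rightarrow> complex mat \<Rightarrow> complex mat
     \<Rightarrow> complex mat \<Rightarrow> int list \<Rightarrow> complex mat" where
  "fiedler_S_prod n m r Ac A E B C t =
     mat_prod (m * n + r) (map (fiedler_S n m r Ac A E B C) t)"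

section \<open>The pencils\<close>

definition L_P ::
  "nat \<Rightarrow> nat \<Rightarrow> (nat \<Rightarrow> complex mat) \<Rightarrow> nat \<Rightarrow> int list \<Rightarrow> int list
     \<Rightarrow> complex mat list \<Rightarrow> complex mat list \<Rightarrow> complex poly mat" where
  "L_P n m Ac h tw tv X Y =
     const_mat (elem_prod n m (tv @ tw) (Y @ X))
     * ([:0, 1:] \<cdot>\<^sub>m const_mat (fiedler_P_prod n m Ac (v_tuple m h))
          - const_mat (fiedler_P_prod n m Ac (w_tuple h)))
     * const_mat (fiedler_P_prod n m Ac (cw_tuple h @ cv_tuple m h))
     * const_mat (elem_prod n m (rev tw @ rev tv) (rev X @ rev Y))"

definition L_S ::
  "nat \<Rightarrow> nat \<Rightarrow> nat \<Rightarrow> (nat \<Rightarrow> complex mat) \<Rightarrow> complex mat \<Rightarrow> complex mat \<Rightarrow> complex mat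
     \<Rightarrow> complex mat \<Rightarrow> nat \<Rightarrow> int list \<Rightarrow> int list \<Rightarrow> complex mat list \<Rightarrow> complex mat list
     \<Rightarrow> complex poly mat" where
  "L_S n m r Ac A E B C h tw tv X Y =
     const_mat (elem_prod_ext n m r (tv @ tw) (Y @ X))
     * ([:0, 1:] \<cdot>\<^sub>m const_mat (fiedler_S_prod n m r Ac A E B C (v_tuple m h))
          - const_mat (fiedler_S_prod n m r Ac A E B C (w_tuple h)))
     * const_mat (fiedler_P_ext_prod n m r Ac (cw_tuple h @ cv_tuple m h))
     * const_mat (elem_prod_ext n m r (rev tw @ rev tv) (rev X @ rev Y))"

end

theory Submission
  imports Defs "Jordan_Normal_Form.Schur_Decomposition"
begin

text \<open>
  Write \<open>m = h + 1 + k\<close> with \<open>h = 2q\<close>. The proof reduces the whole family of pencils to a single one.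
  Factors whose indices are not adjacent commute, and the simple admissible tuples are arranged so that
  each product of Fiedler matrices in \<open>L_P\<close> can be sorted by the parity of the indices. After cancelling inverse factors
  this gives \<open>L_P = R1 (\<lambda> Tp Dn - Ep) R2\<close> with constant \<open>R1\<close>, \<open>R2\<close> (\<open>lead_trail_factor\<close>). Here \<open>Tp\<close> is the Fiedler matrix of
  \<open>- m\<close>, \<open>Dn\<close> is the product of those of \<open>- j\<close> for odd \<open>j < m\<close>, and \<open>Ep\<close> is the product of those of \<open>j\<close> for
  even \<open>j < m\<close>, ending with \<open>j = 0\<close>. Apart from the assigned matrices, the only factor of \<open>R1\<close> and \<open>R2\<close> that may be
  singular is \<open>Tp\<close>, whose nontrivial block is \<open>A_m\<close>, and it occurs only for even \<open>m\<close>. So \<open>R1\<close> and \<open>R2\<close> are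
  invertible under the hypotheses (\<open>R_invertible\<close>), and it remains to treat the pencil in the middle, which depends
  neither on \<open>h\<close> nor on the tuples.

  \<^bold>\<open>Finite behaviour.\<close> Elementary row and column operations split off the first block row and column of
  the middle pencil and replace the leading coefficient \<open>Q\<close> by \<open>\<lambda> Q + A_j\<close>; these are the steps of
  Horner's scheme, so after \<open>m - 1\<close> steps \<open>diag(I, P(\<lambda>))\<close> is left (\<open>gf_pencil_horner\<close>). All operations
  have entries in any subring that contains the coefficients and \<open>\<lambda>\<close>; over the polynomials they are unimodular.
  They fix the last block row and column, because index 1 is odd. Since \<open>R1\<close> and \<open>R2\<close> move the last
  block column to the block column of \<open>B\<^sup>T\<close>, the same operations, bordered by \<open>I_r\<close>, bring the
  whole pencil to \<open>diag(I, \<S>(\<lambda>))\<close> (\<open>unimodular_equivalence\<close>).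

  \<^bold>\<open>Behaviour at infinity.\<close> Reflection along the antidiagonal reverses the order of the blocks and of
  the products and exchanges the two kinds of factors. It turns \<open>\<lambda>\<inverse>\<close> times the middle pencil into a pencil
  of the same kind in \<open>\<lambda>\<inverse>\<close> for the reversed coefficients, and the finite result applies again, now over the
  ring of proper rational functions (\<open>gf_pencil_reversed_horner\<close>). The transfer function differs from the
  pencil only in the last diagonal block, so it is the pencil in which \<open>A_0\<close> is replaced by
  \<open>A_0 + B\<^sup>T (\<lambda> E - A)\<inverse> B\<close>, again a matrix of proper functions (\<open>biproper_equivalence\<close>).

  \<^bold>\<open>Position of the border.\<close> A factor \<open>M_{s+1}(X)\<close> moves a block column from position \<open>m - s\<close> to \<open>m - s - 1\<close>
  without changing its block, and all other factors that it meets fix it. Following the block through a product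
  computes the longest descending subtuple \<open>(p, \<dots>, 1, 0)\<close>, which is \<open>i0\<close> (\<open>i0_top_col\<close>, \<open>L_S_blocks\<close>).

  \<^bold>\<open>Irreducibility.\<close> A vector that violates the rank condition is an uncontrollable mode; deleting it
  gives a realization of smaller dimension (\<open>minimal_realization_controllable\<close>). By symmetry this covers
  both rank conditions.

  \<^bold>\<open>Symmetry.\<close> Within each parity the factors commute, so the coefficients have a palindromic arrangement of
  symmetric matrices (\<open>core_symmetric\<close>).
\<close>

section \<open>Block diagonal matrices and elementary factors\<close>

definition dsum :: "'a::zero mat \<Rightarrow> 'a mat \<Rightarrow> 'a mat" where
  "dsum M N = four_block_mat M (0\<^sub>m (dim_row M) (dim_col N)) (0\<^sub>m (dim_row N) (dim_col M)) N"

lemma diag_block_mat_two: "diag_block_mat [M, N] = dsum M N"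
  unfolding dsum_def diag_block_mat.simps(2)[of M] diag_block_mat_singleton Let_def ..

lemma dsum_dims [simp]: "dim_row (dsum M N) = dim_row M + dim_row N"
  "dim_col (dsum M N) = dim_col M + dim_col N"
  by (auto simp: dsum_def)

lemma dsum_carrier: "M \<in> carrier_mat a b \<Longrightarrow> N \<in> carrier_mat c d \<Longrightarrow> dsum M N \<in> carrier_mat (a + c) (b + d)"
  by (auto simp: dsum_def)

lemma dsum_index [simp]: "i < dim_row M + dim_row N \<Longrightarrow> j < dim_col M + dim_col N \<Longrightarrow>
  dsum M N $$ (i, j) =
    (if i < dim_row M then if j < dim_col M then M $$ (i, j) else 0
     else if j < dim_col M then 0 else N $$ (i - dim_row M, j - dim_col M))"
  by (auto simp: dsum_def)

lemma dsum_assoc: "dsum (dsum M N) Q = dsum M (dsum N Q)"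
  unfolding dsum_def by (rule assoc_four_block_mat[symmetric])

lemma dsum_one: "dsum (1\<^sub>m a) (1\<^sub>m b) = 1\<^sub>m (a + b)"
  by (rule eq_matI) auto

lemma dsum_empty [simp]: "dsum (1\<^sub>m 0) M = M" "dsum M (1\<^sub>m 0) = M"
  by (rule eq_matI; auto)+

lemma dsum_mult:
  fixes M :: "'a::comm_ring_1 mat"
  assumes "M \<in> carrier_mat a b" "M' \<in> carrier_mat b c" "N \<in> carrier_mat d e" "N' \<in> carrier_mat e f"
  shows "dsum M N * dsum M' N' = dsum (M * M') (N * N')"
proof -
  have d: "dim_row M = a" "dim_col M = b" "dim_row M' = b" "dim_col M' = c"
    "dim_row N = d" "dim_col N = e" "dim_row N' = e" "dim_col N' = f" using assms by auto
  show ?thesis unfolding dsum_def d index_mult_mat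
    using assms by (subst mult_four_block_mat[of _ a b _ e _ d _ _ c _ f]) (auto simp: d)
qed

lemma dsum_transpose: "transpose_mat (dsum M N) = dsum (transpose_mat M) (transpose_mat N)"
  by (rule eq_matI) auto

lemma dsum_map: "f 0 = 0 \<Longrightarrow> map_mat f (dsum M N) = dsum (map_mat f M) (map_mat f N)"
  by (rule eq_matI) auto

definition emb :: "nat \<Rightarrow> 'a::{zero,one} mat \<Rightarrow> nat \<Rightarrow> 'a mat" where
  "emb a Z b = dsum (1\<^sub>m a) (dsum Z (1\<^sub>m b))"

lemma diag_block_mat_emb: "diag_block_mat [1\<^sub>m a, Z, 1\<^sub>m b] = emb a Z b"
  unfolding emb_def dsum_def diag_block_mat.simps(2)[of "1\<^sub>m a"] diag_block_mat.simps(2)[of Z]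
    diag_block_mat_singleton Let_def ..

lemma emb_0 [simp]: "emb 0 Z b = dsum Z (1\<^sub>m b)" "emb a Z 0 = dsum (1\<^sub>m a) Z"
  by (auto simp: emb_def)

lemma emb_carrier: "Z \<in> carrier_mat d d \<Longrightarrow> a + d + b = N \<Longrightarrow> emb a Z b \<in> carrier_mat N N"
  by (auto simp: emb_def)

lemma emb_dims [simp]: "dim_row (emb a Z b) = a + dim_row Z + b" "dim_col (emb a Z b) = a + dim_col Z + b"
  by (auto simp: emb_def)

lemma emb_mult:
  fixes Z :: "'a::comm_ring_1 mat"
  assumes "Z \<in> carrier_mat d d" "Z' \<in> carrier_mat d d"
  shows "emb a Z b * emb a Z' b = emb a (Z * Z') b"
  unfolding emb_def using assms
  by (subst dsum_mult[of _ a a _ a _ "d + b" "d + b" _ "d + b"]; (subst dsum_mult[of _ d d _ d _ b b _ b])?;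
      auto simp: dsum_carrier)

lemma emb_one [simp]: "emb a (1\<^sub>m d) b = 1\<^sub>m (a + d + b)"
  by (simp add: emb_def dsum_one add.assoc)

lemma emb_dsum: "dsum (1\<^sub>m k) (emb a Z b) = emb (k + a) Z b"
  by (simp add: emb_def dsum_one flip: dsum_assoc)

lemma emb_transpose: "transpose_mat (emb a Z b) = emb a (transpose_mat Z) b"
  by (simp add: emb_def dsum_transpose)

lemma emb_map: "f 0 = 0 \<Longrightarrow> f 1 = 1 \<Longrightarrow> map_mat f (emb a Z b) = emb a (map_mat f Z) b"
  by (auto simp: emb_def dsum_map intro!: eq_matI)

lemma emb_index:
  assumes "Z \<in> carrier_mat d d" "i < a + d + b" "j < a + d + b"
  shows "emb a Z b $$ (i, j) =
    (if a \<le> i \<and> i < a + d \<and> a \<le> j \<and> j < a + d then Z $$ (i - a, j - a) else if i = j then 1 else 0)"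
  using assms by (auto simp: emb_def)

text \<open>
  The nontrivial blocks of the two elementary factors: \<open>swap2 n X 0\<close> is that of \<open>M_i(X)\<close> and \<open>swap2 n 0 X\<close> that of
  \<open>M_{-i}(X)\<close>. A \<open>cross\<close> places such a block on block positions \<open>c\<close> and \<open>c + 1\<close> of \<open>m\<close> (counted from 0), a \<open>spot\<close> places
  a single block on position \<open>c\<close>; the index \<open>\<plusminus> i\<close> sits at \<open>c = m - i - 1\<close>.
\<close>
definition swap2 :: "nat \<Rightarrow> 'a::{zero,one} mat \<Rightarrow> 'a mat \<Rightarrow> 'a mat" where
  "swap2 n X Y = four_block_mat X (1\<^sub>m n) (1\<^sub>m n) Y"

definition cross :: "nat \<Rightarrow> nat \<Rightarrow> nat \<Rightarrow> 'a::{zero,one} mat \<Rightarrow> 'a mat \<Rightarrow> 'a mat" where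
  "cross n m c X Y = emb (c * n) (swap2 n X Y) ((m - c - 2) * n)"

definition spot :: "nat \<Rightarrow> nat \<Rightarrow> nat \<Rightarrow> 'a::{zero,one} mat \<Rightarrow> 'a mat" where
  "spot n m c X = emb (c * n) X ((m - c - 1) * n)"

lemma swap2_carrier [simp]: "X \<in> carrier_mat n n \<Longrightarrow> Y \<in> carrier_mat n n \<Longrightarrow> swap2 n X Y \<in> carrier_mat (n + n) (n + n)"
  by (auto simp: swap2_def)

lemma swap2_mult:
  fixes X :: "'a::comm_ring_1 mat"
  assumes "X \<in> carrier_mat n n"
  shows "swap2 n X (0\<^sub>m n n) * swap2 n (0\<^sub>m n n) (- X) = 1\<^sub>m (n + n)"
    "swap2 n (0\<^sub>m n n) (- X) * swap2 n X (0\<^sub>m n n) = 1\<^sub>m (n + n)"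
  unfolding swap2_def using assms
  by (subst mult_four_block_mat[of _ n n _ n _ n _ _ n _ n];
      auto intro!: eq_matI)+

lemma cross_size: "c + 2 \<le> m \<Longrightarrow> c * n + (n + n) + (m - c - 2) * n = m * (n::nat)"
proof -
  assume "c + 2 \<le> m"
  then have "m = c + 2 + (m - c - 2)" by simp
  then show ?thesis by (metis add_mult_distrib mult_2)
qed

lemma spot_size: "c < m \<Longrightarrow> c * n + n + (m - c - 1) * n = m * (n::nat)"
proof -
  assume "c < m"
  then have "m = c + 1 + (m - c - 1)" by simp
  then show ?thesis by (metis add_mult_distrib mult_1)
qed

lemma cross_carrier: "c + 2 \<le> m \<Longrightarrow> X \<in> carrier_mat n n \<Longrightarrow> Y \<in> carrier_mat n n \<Longrightarrow>
   cross n m c X Y \<in> carrier_mat (m * n) (m * n)"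
  unfolding cross_def by (rule emb_carrier[of _ "n + n"]) (auto simp del: diff_diff_left intro: cross_size)

lemma spot_carrier: "c < m \<Longrightarrow> X \<in> carrier_mat n n \<Longrightarrow> spot n m c X \<in> carrier_mat (m * n) (m * n)"
  unfolding spot_def by (rule emb_carrier[of _ n]) (auto simp del: diff_diff_left One_nat_def intro: spot_size)

lemma cross_inverse:
  fixes X :: "'a::comm_ring_1 mat"
  assumes "c + 2 \<le> m" "X \<in> carrier_mat n n"
  shows "cross n m c X (0\<^sub>m n n) * cross n m c (0\<^sub>m n n) (- X) = 1\<^sub>m (m * n)"
    "cross n m c (0\<^sub>m n n) (- X) * cross n m c X (0\<^sub>m n n) = 1\<^sub>m (m * n)"
  unfolding cross_def using assms
  by (subst emb_mult[of _ "n + n"]; simp add: swap2_mult cross_size[of c m, symmetric] del: diff_diff_left)+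

lemma cross_transpose: "X \<in> carrier_mat n n \<Longrightarrow> Y \<in> carrier_mat n n \<Longrightarrow>
  transpose_mat (cross n m c X Y) = cross n m c (transpose_mat X) (transpose_mat Y)"
  unfolding cross_def swap2_def emb_transpose
  by (subst transpose_four_block_mat[of _ n n _ n _ n]) auto

lemma spot_transpose: "transpose_mat (spot n m c X) = spot n m c (transpose_mat X)"
  unfolding spot_def emb_transpose ..

lemma swap2_map:
  assumes "X \<in> carrier_mat n n" "Y \<in> carrier_mat n n" "f 0 = 0" "f 1 = 1"
  shows "map_mat f (swap2 n X Y) = swap2 n (map_mat f X) (map_mat f Y)"
  unfolding swap2_def using assms by (intro eq_matI) auto

lemma cross_map: "X \<in> carrier_mat n n \<Longrightarrow> Y \<in> carrier_mat n n \<Longrightarrow> f 0 = 0 \<Longrightarrow> f 1 = 1 \<Longrightarrow>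
  map_mat f (cross n m c X Y) = cross n m c (map_mat f X) (map_mat f Y)"
  unfolding cross_def by (simp add: emb_map swap2_map)

lemma spot_map: "f 0 = 0 \<Longrightarrow> f 1 = 1 \<Longrightarrow> map_mat f (spot n m c X) = spot n m c (map_mat f X)"
  unfolding spot_def by (simp add: emb_map)

lemma cross_shift: "c + 2 \<le> m \<Longrightarrow> cross n (Suc m) (Suc c) X Y = dsum (1\<^sub>m n) (cross n m c X Y)"
  unfolding cross_def emb_dsum by simp

lemma spot_shift: "c < m \<Longrightarrow> spot n (Suc m) (Suc c) X = dsum (1\<^sub>m n) (spot n m c X)"
  unfolding spot_def emb_dsum by simp

text \<open>
  \<open>M\<close> acts as the identity outside the rows and columns in \<open>S\<close>. Factors with disjoint supports
  commute, which is the source of all commutation relations below.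
\<close>
definition supported :: "nat set \<Rightarrow> 'a::{zero,one} mat \<Rightarrow> bool" where
  "supported S M \<longleftrightarrow> (\<forall>i < dim_row M. \<forall>j < dim_col M.
     i \<notin> S \<or> j \<notin> S \<longrightarrow> M $$ (i, j) = (if i = j then 1 else 0))"

lemma supported_mono: "supported S M \<Longrightarrow> S \<subseteq> S' \<Longrightarrow> supported S' M"
  unfolding supported_def by blast

lemma supported_emb: "Z \<in> carrier_mat d d \<Longrightarrow> {a..<a + d} \<subseteq> S \<Longrightarrow> supported S (emb a Z b)"
  unfolding supported_def by (auto simp: emb_index[of _ d])

lemma mat_mult_index_sum:
  fixes M :: "'a::comm_semiring_1 mat"
  assumes "M \<in> carrier_mat a b" "M' \<in> carrier_mat b c" "i < a" "j < c"
  shows "(M * M') $$ (i, j) = (\<Sum>k<b. M $$ (i, k) * M' $$ (k, j))"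
  using assms by (auto simp: scalar_prod_def intro!: sum.cong)

lemma supported_commute:
  fixes M :: "'a::comm_ring_1 mat"
  assumes M: "M \<in> carrier_mat N N" and M': "M' \<in> carrier_mat N N"
    and S: "supported S M" and S': "supported S' M'" and dj: "S \<inter> S' = {}"
  shows "M * M' = M' * M"
proof (rule eq_matI)
  fix i j assume "i < dim_row (M' * M)" "j < dim_col (M' * M)"
  then have ij: "i < N" "j < N" using M M' by auto
  have a: "M $$ (i, k) = (if i = k then 1 else 0)" if "i < N" "k < N" "i \<notin> S \<or> k \<notin> S" for i k
    using S that M unfolding supported_def by auto
  have b: "M' $$ (i, k) = (if i = k then 1 else 0)" if "i < N" "k < N" "i \<notin> S' \<or> k \<notin> S'" for i k
    using S' that M' unfolding supported_def by auto
  have *: "(M * M') $$ (i, j) = M $$ (i, j) + M' $$ (i, j) - (if i = j then 1 else 0)"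
    if M: "M \<in> carrier_mat N N" and M': "M' \<in> carrier_mat N N" and dj: "S \<inter> S' = {}"
      and a: "\<And>i k. i < N \<Longrightarrow> k < N \<Longrightarrow> i \<notin> S \<or> k \<notin> S \<Longrightarrow> M $$ (i, k) = (if i = k then 1 else 0)"
      and b: "\<And>i k. i < N \<Longrightarrow> k < N \<Longrightarrow> i \<notin> S' \<or> k \<notin> S' \<Longrightarrow> M' $$ (i, k) = (if i = k then 1 else 0)"
    for M M' :: "'a mat" and S S'
  proof (cases "i \<in> S")
    case True
    have "(M * M') $$ (i, j) = (\<Sum>k<N. M $$ (i, k) * M' $$ (k, j))"
      using mat_mult_index_sum[OF M M' ij] .
    also have "\<dots> = (\<Sum>k<N. if k = j then M $$ (i, j) + M' $$ (i, j) - (if i = j then 1 else 0) else 0)"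
    proof (rule sum.cong)
      fix k assume "k \<in> {..<N}" then have k: "k < N" by simp
      show "M $$ (i, k) * M' $$ (k, j) = (if k = j then M $$ (i, j) + M' $$ (i, j) - (if i = j then 1 else 0) else 0)"
      proof (cases "j \<in> S")
        case True
        then have "j \<notin> S'" using dj by auto
        then show ?thesis using b[OF k ij(2)] b[OF ij] k ij by simp
      next
        case False
        have i': "i \<notin> S'" using dj \<open>i \<in> S\<close> by auto
        have "i \<noteq> j" using False \<open>i \<in> S\<close> by auto
        then have z: "M' $$ (i, j) = 0" "M $$ (i, j) = 0" using i' False a[OF ij] b[OF ij] by auto
        show ?thesis
        proof (cases "k \<in> S'")
          case True
          then have "k \<notin> S" using dj by auto
          then show ?thesis using a[OF ij(1) k] z \<open>i \<noteq> j\<close> i' True by auto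
        qed (use b[OF k ij(2)] z \<open>i \<noteq> j\<close> in auto)
      qed
    qed simp
    finally show ?thesis using ij by simp
  next
    case False
    have "(M * M') $$ (i, j) = (\<Sum>k<N. if k = i then M' $$ (i, j) else 0)"
      unfolding mat_mult_index_sum[OF M M' ij]
      using False a ij by (intro sum.cong) auto
    then show ?thesis using ij a[of i j] False by simp
  qed
  show "(M * M') $$ (i, j) = (M' * M) $$ (i, j)"
    using *[OF M M' dj a b] *[OF M' M _ b a] dj by (subst (asm) (2) Int_commute) (simp only: add.commute)
qed (use M M' in auto)

section \<open>Products of matrices\<close>

lemma mat_prod_Nil [simp]: "mat_prod N [] = 1\<^sub>m N" by (simp add: mat_prod_def)
lemma mat_prod_Cons [simp]: "mat_prod N (M # Ms) = M * mat_prod N Ms" by (simp add: mat_prod_def)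

lemma mat_prod_carrier: "set Ms \<subseteq> carrier_mat N N \<Longrightarrow> mat_prod N Ms \<in> carrier_mat N N"
  by (induction Ms) auto

lemma mat_prod_append:
  fixes Ms :: "'a::comm_ring_1 mat list"
  shows "set Ms \<subseteq> carrier_mat N N \<Longrightarrow> set Ms' \<subseteq> carrier_mat N N \<Longrightarrow>
    mat_prod N (Ms @ Ms') = mat_prod N Ms * mat_prod N Ms'"
  by (induction Ms) (auto simp: mat_prod_carrier assoc_mult_mat[of _ N N _ N _ N] left_mult_one_mat[of _ N N])

lemma mat_prod_transpose:
  fixes Ms :: "'a::comm_ring_1 mat list"
  shows "set Ms \<subseteq> carrier_mat N N \<Longrightarrow>
    transpose_mat (mat_prod N Ms) = mat_prod N (rev (map transpose_mat Ms))"
proof (induction Ms)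
  case (Cons M Ms)
  then have "transpose_mat (mat_prod N (M # Ms)) = mat_prod N (rev (map transpose_mat Ms)) * transpose_mat M"
    by (auto simp: transpose_mult[of _ N N _ N] mat_prod_carrier)
  also have "\<dots> = mat_prod N (rev (map transpose_mat Ms) @ [transpose_mat M])"
    using Cons.prems by (subst mat_prod_append) (auto intro!: arg_cong[of _ _ "\<lambda>x. _ * x"] right_mult_one_mat[symmetric])
  finally show ?case by simp
qed simp

lemma mat_prod_commute1:
  fixes Ms :: "'a::comm_ring_1 mat list"
  assumes "set Ms \<subseteq> carrier_mat N N" "M \<in> carrier_mat N N" "\<And>M'. M' \<in> set Ms \<Longrightarrow> M * M' = M' * M"
  shows "M * mat_prod N Ms = mat_prod N Ms * M"
  using assms
proof (induction Ms)
  case (Cons M' Ms)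
  have c: "M' \<in> carrier_mat N N" "mat_prod N Ms \<in> carrier_mat N N" using Cons.prems by (auto simp: mat_prod_carrier)
  have "M * (M' * mat_prod N Ms) = (M * M') * mat_prod N Ms"
    using c Cons.prems(2) by (simp add: assoc_mult_mat[of _ N N _ N _ N])
  also have "\<dots> = M' * (M * mat_prod N Ms)"
    using c Cons.prems by (simp add: assoc_mult_mat[of _ N N _ N _ N])
  also have "\<dots> = M' * (mat_prod N Ms * M)" using Cons by auto
  finally show ?case using c Cons.prems(2) by (simp add: assoc_mult_mat[of _ N N _ N _ N])
qed auto

lemma mat_prod_swap:
  fixes Ms :: "'a::comm_ring_1 mat list"
  assumes "set Ms \<subseteq> carrier_mat N N" "set Ms' \<subseteq> carrier_mat N N"
    "\<And>M M'. M \<in> set Ms \<Longrightarrow> M' \<in> set Ms' \<Longrightarrow> M * M' = M' * M"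
  shows "mat_prod N Ms * mat_prod N Ms' = mat_prod N Ms' * mat_prod N Ms"
  using assms
proof (induction Ms)
  case (Cons M Ms)
  have c: "M \<in> carrier_mat N N" "mat_prod N Ms \<in> carrier_mat N N" "mat_prod N Ms' \<in> carrier_mat N N"
    using Cons.prems by (auto simp: mat_prod_carrier)
  have "mat_prod N Ms * mat_prod N Ms' = mat_prod N Ms' * mat_prod N Ms"
    using Cons.prems by (intro Cons.IH) auto
  then have "M * mat_prod N Ms * mat_prod N Ms' = M * (mat_prod N Ms' * mat_prod N Ms)"
    using c by (simp add: assoc_mult_mat[of _ N N _ N _ N])
  also have "\<dots> = (M * mat_prod N Ms') * mat_prod N Ms"
    using c by (simp add: assoc_mult_mat[of _ N N _ N _ N])
  also have "M * mat_prod N Ms' = mat_prod N Ms' * M"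
    using Cons.prems c by (intro mat_prod_commute1) auto
  finally show ?case using c by (simp add: assoc_mult_mat[of _ N N _ N _ N])
qed (auto simp: mat_prod_carrier left_mult_one_mat[of _ N N] right_mult_one_mat[of _ N N])

lemma mat_prod_rev:
  fixes Ms :: "'a::comm_ring_1 mat list"
  assumes "set Ms \<subseteq> carrier_mat N N"
    "\<And>M M'. M \<in> set Ms \<Longrightarrow> M' \<in> set Ms \<Longrightarrow> M * M' = M' * M"
  shows "mat_prod N (rev Ms) = mat_prod N Ms"
  using assms
proof (induction Ms)
  case (Cons M Ms)
  have "mat_prod N (rev Ms @ [M]) = mat_prod N (rev Ms) * M"
    using Cons.prems by (subst mat_prod_append) (auto intro!: arg_cong[of _ _ "\<lambda>x. _ * x"] right_mult_one_mat)
  also have "\<dots> = mat_prod N Ms * M" using Cons by auto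
  also have "\<dots> = M * mat_prod N Ms" using Cons.prems by (intro mat_prod_commute1[symmetric]) auto
  finally show ?case by simp
qed simp

lemma mat_prod_dsum:
  fixes Ms :: "'a::comm_ring_1 mat list"
  assumes "set Ms \<subseteq> carrier_mat N N"
  shows "mat_prod (k + N) (map (dsum (1\<^sub>m k)) Ms) = dsum (1\<^sub>m k) (mat_prod N Ms)"
    "mat_prod (N + k) (map (\<lambda>M. dsum M (1\<^sub>m k)) Ms) = dsum (mat_prod N Ms) (1\<^sub>m k)"
  using assms
  by (induction Ms) (auto simp: dsum_one mat_prod_carrier dsum_mult[of _ k k _ k _ N N _ N] dsum_mult[of _ N N _ N _ k k _ k])

text \<open>
  A product of pairs is sorted into a product of first and a product of second components; only the moves of
  a second component past the first components of later pairs are needed.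
\<close>
lemma mat_prod_pairs:
  fixes f g :: "'b \<Rightarrow> 'a::comm_ring_1 mat"
  assumes "\<And>j. j \<in> set js \<Longrightarrow> f j \<in> carrier_mat N N" "\<And>j. j \<in> set js \<Longrightarrow> g j \<in> carrier_mat N N"
    "sorted_wrt (\<lambda>j j'. g j * f j' = f j' * g j) js"
  shows "mat_prod N (concat (map (\<lambda>j. [f j, g j]) js)) = mat_prod N (map f js) * mat_prod N (map g js)"
  using assms
proof (induction js)
  case (Cons j js)
  let ?F = "mat_prod N (map f js)" and ?G = "mat_prod N (map g js)"
  have c: "f j \<in> carrier_mat N N" "g j \<in> carrier_mat N N" "?F \<in> carrier_mat N N" "?G \<in> carrier_mat N N"
    using Cons.prems by (auto intro!: mat_prod_carrier)
  have comm: "g j * ?F = ?F * g j" using Cons.prems by (intro mat_prod_commute1) auto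
  have "g j * (?F * ?G) = ?F * g j * ?G"
    unfolding comm[symmetric] by (rule assoc_mult_mat[OF c(2-4), symmetric])
  also have "\<dots> = ?F * (g j * ?G)" by (rule assoc_mult_mat[OF c(3,2,4)])
  finally have "f j * (g j * (?F * ?G)) = f j * (?F * (g j * ?G))" by (rule arg_cong)
  also have "\<dots> = f j * ?F * (g j * ?G)"
    using c by (intro assoc_mult_mat[symmetric, of _ N N _ N _ N]) auto
  finally have step: "f j * (g j * (?F * ?G)) = f j * ?F * (g j * ?G)" .
  have ih: "mat_prod N (concat (map (\<lambda>j. [f j, g j]) js)) = ?F * ?G"
    using Cons.prems by (intro Cons.IH) auto
  show ?case
    unfolding list.map concat.simps append_Cons append_Nil mat_prod_Cons ih by (rule step)
qed simp

text \<open>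
  The block \<open>C\<close> placed at row \<open>a\<close> of an otherwise zero matrix with \<open>N\<close> rows: \<open>e_j \<otimes> C\<close> in terms of a row offset,
  which is easier to follow through products than a Kronecker product.
\<close>
definition plc :: "nat \<Rightarrow> nat \<Rightarrow> 'a::zero mat \<Rightarrow> 'a mat" where
  "plc N a C = mat N (dim_col C) (\<lambda>(i, j). if a \<le> i \<and> i < a + dim_row C then C $$ (i - a, j) else 0)"

lemma plc_carrier [simp]: "C \<in> carrier_mat d r \<Longrightarrow> plc N a C \<in> carrier_mat N r"
  by (auto simp: plc_def)

lemma plc_mult:
  fixes M :: "'a::comm_ring_1 mat"
  assumes M: "M \<in> carrier_mat N N" and C: "C \<in> carrier_mat d r" and a: "a + d \<le> N"
    and M1: "\<And>i t. i < N \<Longrightarrow> t < d \<Longrightarrow> M $$ (i, a + t) = (if i = a' + t then 1 else 0)"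
  shows "M * plc N a C = plc N a' C"
proof (rule eq_matI)
  fix i j assume "i < dim_row (plc N a' C)" "j < dim_col (plc N a' C)"
  then have ij: "i < N" "j < r" using C by (auto simp: plc_def)
  have "(M * plc N a C) $$ (i, j) = (\<Sum>k<N. M $$ (i, k) * plc N a C $$ (k, j))"
    using M C ij by (intro mat_mult_index_sum[of _ N N _ r]) auto
  also have "\<dots> = (\<Sum>k<N. if k = a + (i - a') \<and> a' \<le> i \<and> i < a' + d then C $$ (i - a', j) else 0)"
  proof (rule sum.cong)
    fix k assume "k \<in> {..<N}"
    then have k: "k < N" by simp
    show "M $$ (i, k) * plc N a C $$ (k, j) =
      (if k = a + (i - a') \<and> a' \<le> i \<and> i < a' + d then C $$ (i - a', j) else 0)"
    proof (cases "a \<le> k \<and> k < a + d")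
      case True
      then have "M $$ (i, k) = (if i = a' + (k - a) then 1 else 0)"
        using M1[OF ij(1), of "k - a"] by (auto simp: less_diff_conv2)
      then show ?thesis using True C k ij by (auto simp: plc_def)
    next
      case False
      then show ?thesis using C k ij by (auto simp: plc_def)
    qed
  qed simp
  also have "\<dots> = plc N a' C $$ (i, j)"
    using ij C a by (auto simp: plc_def)
  finally show "(M * plc N a C) $$ (i, j) = plc N a' C $$ (i, j)" .
qed (use M C in \<open>auto simp: plc_def\<close>)

lemma plc_dsum:
  fixes M :: "'a::comm_ring_1 mat"
  assumes M: "M \<in> carrier_mat N N" and C: "C \<in> carrier_mat d r"
    and M1: "M * plc N a C = plc N a' C"
  shows "dsum (1\<^sub>m k) M * plc (k + N) (k + a) C = plc (k + N) (k + a') C"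
proof -
  have s: "plc (k + N) (k + b) C = four_block_mat (0\<^sub>m k r) (0\<^sub>m k 0) (plc N b C) (0\<^sub>m N 0)" for b
    using C by (intro eq_matI) (auto simp: plc_def)
  have pc: "plc N a C \<in> carrier_mat N r" "plc N a' C \<in> carrier_mat N r" using C by auto
  have "dsum (1\<^sub>m k) M * plc (k + N) (k + a) C
     = four_block_mat (1\<^sub>m k * 0\<^sub>m k r + 0\<^sub>m k N * plc N a C) (1\<^sub>m k * 0\<^sub>m k 0 + 0\<^sub>m k N * 0\<^sub>m N 0)
         (0\<^sub>m N k * 0\<^sub>m k r + M * plc N a C) (0\<^sub>m N k * 0\<^sub>m k 0 + M * 0\<^sub>m N 0)"
    unfolding s dsum_def using M C by (subst mult_four_block_mat) auto
  also have "\<dots> = four_block_mat (0\<^sub>m k r) (0\<^sub>m k 0) (plc N a' C) (0\<^sub>m N 0)"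
    unfolding M1 using M pc by (intro cong_four_block_mat) (auto simp: left_add_zero_mat[of _ N r])
  finally show ?thesis unfolding s .
qed

section \<open>Matrices over a subring\<close>

text \<open>
  The transformations needed at finite points have polynomial entries, those needed at infinity proper rational entries.
  They are given by the same formulas, so they are constructed once for matrices over an arbitrary
  subring \<open>K\<close> of the ring of entries. A \<open>kunit\<close> is a matrix that is invertible over \<open>K\<close>: a unimodular matrix
  for polynomials, a biproper matrix for proper functions.
\<close>
locale unital_subring =
  fixes K :: "'a::comm_ring_1 set"
  assumes K_one: "1 \<in> K" and K_diff: "\<And>x y. x \<in> K \<Longrightarrow> y \<in> K \<Longrightarrow> x - y \<in> K"
    and K_mult: "\<And>x y. x \<in> K \<Longrightarrow> y \<in> K \<Longrightarrow> x * y \<in> K"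
begin

lemma K_zero: "0 \<in> K" using K_diff[OF K_one K_one] by simp
lemma K_uminus: "x \<in> K \<Longrightarrow> - x \<in> K" using K_diff[OF K_zero] by simp
lemma K_add: "x \<in> K \<Longrightarrow> y \<in> K \<Longrightarrow> x + y \<in> K" using K_diff[of x "- y"] K_uminus by simp
lemma K_sum: "(\<And>i. i \<in> I \<Longrightarrow> f i \<in> K) \<Longrightarrow> sum f I \<in> K"
  by (induction I rule: infinite_finite_induct) (auto simp: K_zero K_add)
lemma K_prod: "(\<And>i. i \<in> I \<Longrightarrow> f i \<in> K) \<Longrightarrow> prod f I \<in> K"
  by (induction I rule: infinite_finite_induct) (auto simp: K_one K_mult)
lemma K_power: "x \<in> K \<Longrightarrow> x ^ k \<in> K"
  by (induction k) (auto simp: K_one K_mult)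

definition over :: "'a mat \<Rightarrow> bool" where
  "over M \<longleftrightarrow> (\<forall>i < dim_row M. \<forall>j < dim_col M. M $$ (i, j) \<in> K)"

lemma over_mult: "M \<in> carrier_mat a b \<Longrightarrow> M' \<in> carrier_mat b c \<Longrightarrow> over M \<Longrightarrow> over M' \<Longrightarrow> over (M * M')"
  unfolding over_def by (auto simp: scalar_prod_def intro!: K_sum K_mult)
lemma over_one [simp]: "over (1\<^sub>m N)" and over_zero [simp]: "over (0\<^sub>m a b)"
  unfolding over_def by (auto simp: K_one K_zero)
lemma over_uminus: "over M \<Longrightarrow> over (- M)"
  unfolding over_def by (auto intro!: K_uminus)
lemma over_add: "M \<in> carrier_mat a b \<Longrightarrow> M' \<in> carrier_mat a b \<Longrightarrow> over M \<Longrightarrow> over M' \<Longrightarrow> over (M + M')"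
  unfolding over_def by (auto intro!: K_add)
lemma over_minus: "M \<in> carrier_mat a b \<Longrightarrow> M' \<in> carrier_mat a b \<Longrightarrow> over M \<Longrightarrow> over M' \<Longrightarrow> over (M - M')"
  unfolding over_def by (auto intro!: K_diff)
lemma over_smult: "x \<in> K \<Longrightarrow> over M \<Longrightarrow> over (x \<cdot>\<^sub>m M)"
  unfolding over_def by (auto intro!: K_mult)
lemma over_four_block:
  assumes "M1 \<in> carrier_mat a b" "M2 \<in> carrier_mat a d" "M3 \<in> carrier_mat c b" "M4 \<in> carrier_mat c d"
    "over M1" "over M2" "over M3" "over M4"
  shows "over (four_block_mat M1 M2 M3 M4)"
  using assms unfolding over_def by auto
lemma over_dsum: "over M \<Longrightarrow> over N \<Longrightarrow> over (dsum M N)"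
  unfolding over_def by (auto simp: K_zero)
lemma over_emb: "over Z \<Longrightarrow> over (emb a Z b)"
  unfolding emb_def by (intro over_dsum) auto
lemma over_cross: "X \<in> carrier_mat n n \<Longrightarrow> Y \<in> carrier_mat n n \<Longrightarrow> over X \<Longrightarrow> over Y \<Longrightarrow> over (cross n m c X Y)"
  unfolding cross_def swap2_def by (intro over_emb over_four_block[of _ n n _ n _ n]) auto
lemma over_spot: "over X \<Longrightarrow> over (spot n m c X)"
  unfolding spot_def by (intro over_emb)
lemma over_transpose: "over M \<Longrightarrow> over (transpose_mat M)"
  unfolding over_def by auto
lemma over_mat_prod: "set Ms \<subseteq> carrier_mat N N \<Longrightarrow> (\<And>M. M \<in> set Ms \<Longrightarrow> over M) \<Longrightarrow> over (mat_prod N Ms)"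
  by (induction Ms) (auto intro!: over_mult[of _ N N] mat_prod_carrier)

definition kunit :: "nat \<Rightarrow> 'a mat \<Rightarrow> bool" where
  "kunit N U \<longleftrightarrow> U \<in> carrier_mat N N \<and> over U \<and>
     (\<exists>U' \<in> carrier_mat N N. over U' \<and> U * U' = 1\<^sub>m N \<and> U' * U = 1\<^sub>m N)"

lemma kunit_carrier: "kunit N U \<Longrightarrow> U \<in> carrier_mat N N"
  by (simp add: kunit_def)

lemma kunitI: "U \<in> carrier_mat N N \<Longrightarrow> U' \<in> carrier_mat N N \<Longrightarrow> over U \<Longrightarrow> over U' \<Longrightarrow>
   U * U' = 1\<^sub>m N \<Longrightarrow> U' * U = 1\<^sub>m N \<Longrightarrow> kunit N U"
  by (auto simp: kunit_def)

lemma kunit_one [simp]: "kunit N (1\<^sub>m N)"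
  by (rule kunitI[of _ _ "1\<^sub>m N"]) auto

lemma kunit_mult:
  assumes "kunit N U" "kunit N V" shows "kunit N (U * V)"
proof -
  obtain U' V' where U: "U \<in> carrier_mat N N" "over U" "U' \<in> carrier_mat N N" "over U'" "U * U' = 1\<^sub>m N" "U' * U = 1\<^sub>m N"
    and V: "V \<in> carrier_mat N N" "over V" "V' \<in> carrier_mat N N" "over V'" "V * V' = 1\<^sub>m N" "V' * V = 1\<^sub>m N"
    using assms by (auto simp: kunit_def)
  have "U * V * (V' * U') = U * (V * V') * U'" "V' * U' * (U * V) = V' * (U' * U) * V"
    using U(1,3) V(1,3) by (simp_all add: assoc_mult_mat[of _ N N _ N _ N])
  then show ?thesis
    using U V by (intro kunitI[of _ _ "V' * U'"]) (auto intro!: over_mult[of _ N N])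
qed

lemma kunit_dsum:
  assumes "kunit a U" "kunit b V" shows "kunit (a + b) (dsum U V)"
proof -
  obtain U' V' where U: "U \<in> carrier_mat a a" "over U" "U' \<in> carrier_mat a a" "over U'" "U * U' = 1\<^sub>m a" "U' * U = 1\<^sub>m a"
    and V: "V \<in> carrier_mat b b" "over V" "V' \<in> carrier_mat b b" "over V'" "V * V' = 1\<^sub>m b" "V' * V = 1\<^sub>m b"
    using assms by (auto simp: kunit_def)
  then show ?thesis
    by (intro kunitI[of _ _ "dsum U' V'"]) (auto intro!: over_dsum dsum_carrier simp: dsum_one dsum_mult[of _ a a _ a _ b b _ b])
qed

lemma kunit_transpose:
  assumes "kunit N U" shows "kunit N (transpose_mat U)"
proof -
  obtain U' where U: "U \<in> carrier_mat N N" "over U" "U' \<in> carrier_mat N N" "over U'" "U * U' = 1\<^sub>m N" "U' * U = 1\<^sub>m N"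
    using assms by (auto simp: kunit_def)
  then show ?thesis
    by (intro kunitI[of _ _ "transpose_mat U'"]) (auto intro!: over_transpose simp flip: transpose_mult)
qed

lemma kunit_lower:
  assumes Y: "Y \<in> carrier_mat b a" "over Y"
  shows "kunit (a + b) (four_block_mat (1\<^sub>m a) (0\<^sub>m a b) Y (1\<^sub>m b))"
proof (rule kunitI[of _ _ "four_block_mat (1\<^sub>m a) (0\<^sub>m a b) (- Y) (1\<^sub>m b)"])
  show "four_block_mat (1\<^sub>m a) (0\<^sub>m a b) Y (1\<^sub>m b) * four_block_mat (1\<^sub>m a) (0\<^sub>m a b) (- Y) (1\<^sub>m b) = 1\<^sub>m (a + b)"
    "four_block_mat (1\<^sub>m a) (0\<^sub>m a b) (- Y) (1\<^sub>m b) * four_block_mat (1\<^sub>m a) (0\<^sub>m a b) Y (1\<^sub>m b) = 1\<^sub>m (a + b)"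
    using Y by (subst mult_four_block_mat[of _ a a _ b _ b _ _ a _ b]; auto intro!: eq_matI)+
qed (use Y in \<open>auto intro!: over_four_block[of _ a a _ b _ b] over_uminus\<close>)

text \<open>
  The sign in the upper left block absorbs the \<open>- I\<close> that each step below produces there.
\<close>
lemma kunit_upper:
  assumes Y: "Y \<in> carrier_mat a b" "over Y"
  shows "kunit (a + b) (four_block_mat (- 1\<^sub>m a) Y (0\<^sub>m b a) (1\<^sub>m b))"
proof (rule kunitI[of _ _ "four_block_mat (- 1\<^sub>m a) Y (0\<^sub>m b a) (1\<^sub>m b)"])
  have "- 1\<^sub>m a * - 1\<^sub>m a = (1\<^sub>m a :: 'a mat)"
    by (subst uminus_mult_left_mat; (subst uminus_mult_right_mat)?) auto
  moreover have "- 1\<^sub>m a * Y = - Y"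
    using Y by (subst uminus_mult_left_mat) auto
  ultimately show "four_block_mat (- 1\<^sub>m a) Y (0\<^sub>m b a) (1\<^sub>m b) * four_block_mat (- 1\<^sub>m a) Y (0\<^sub>m b a) (1\<^sub>m b) = 1\<^sub>m (a + b)"
    using Y by (subst mult_four_block_mat[of _ a a _ b _ b _ _ a _ b]) (auto intro!: eq_matI)
  then show "four_block_mat (- 1\<^sub>m a) Y (0\<^sub>m b a) (1\<^sub>m b) * four_block_mat (- 1\<^sub>m a) Y (0\<^sub>m b a) (1\<^sub>m b) = 1\<^sub>m (a + b)" .
qed (use Y in \<open>auto intro!: over_four_block[of _ a a _ b _ b] over_uminus\<close>)

end

section \<open>Reflection along the antidiagonal\<close>

text \<open>
  An anti-automorphism like the transpose, but one that also reverses the order of the blocks. It is used to exchange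
  the roles of the leading and the trailing coefficient.
\<close>
definition antitranspose :: "'a mat \<Rightarrow> 'a mat" where
  "antitranspose M = mat (dim_col M) (dim_row M) (\<lambda>(i, j). M $$ (dim_row M - Suc j, dim_col M - Suc i))"

lemma antitranspose_carrier [simp]: "M \<in> carrier_mat a b \<Longrightarrow> antitranspose M \<in> carrier_mat b a"
  by (auto simp: antitranspose_def)
lemma antitranspose_dims [simp]: "dim_row (antitranspose M) = dim_col M" "dim_col (antitranspose M) = dim_row M"
  by (auto simp: antitranspose_def)
lemma antitranspose_index: "M \<in> carrier_mat a b \<Longrightarrow> i < b \<Longrightarrow> j < a \<Longrightarrow>
   antitranspose M $$ (i, j) = M $$ (a - Suc j, b - Suc i)"
  by (auto simp: antitranspose_def)
lemma antitranspose_involution [simp]: "antitranspose (antitranspose M) = M"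
  by (rule eq_matI) (auto simp: antitranspose_def)
lemma antitranspose_one [simp]: "antitranspose (1\<^sub>m N) = 1\<^sub>m N"
  by (rule eq_matI) (auto simp: antitranspose_def)
lemma antitranspose_zero [simp]: "antitranspose (0\<^sub>m a b) = 0\<^sub>m b a"
  by (rule eq_matI) (auto simp: antitranspose_def)
lemma antitranspose_uminus: "antitranspose (- M) = - antitranspose (M :: 'a::comm_ring_1 mat)"
  by (rule eq_matI) (auto simp: antitranspose_def)
lemma antitranspose_smult: "antitranspose (x \<cdot>\<^sub>m M) = x \<cdot>\<^sub>m antitranspose (M :: 'a::comm_ring_1 mat)"
  by (rule eq_matI) (auto simp: antitranspose_def)
lemma antitranspose_minus: "M \<in> carrier_mat a b \<Longrightarrow> N \<in> carrier_mat a b \<Longrightarrow>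
   antitranspose (M - N) = antitranspose M - antitranspose (N :: 'a::comm_ring_1 mat)"
  by (rule eq_matI) (auto simp: antitranspose_def)
lemma antitranspose_mult:
  fixes M :: "'a::comm_ring_1 mat"
  assumes M: "M \<in> carrier_mat a b" and N: "N \<in> carrier_mat b c"
  shows "antitranspose (M * N) = antitranspose N * antitranspose M"
proof (rule eq_matI)
  fix i j assume "i < dim_row (antitranspose N * antitranspose M)" "j < dim_col (antitranspose N * antitranspose M)"
  then have ij: "i < c" "j < a" using M N by auto
  have "antitranspose (M * N) $$ (i, j) = (M * N) $$ (a - Suc j, c - Suc i)"
    using ij M N by (intro antitranspose_index) auto
  also have "\<dots> = (\<Sum>k<b. M $$ (a - Suc j, k) * N $$ (k, c - Suc i))"
    using ij by (intro mat_mult_index_sum[OF M N]) auto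
  also have "\<dots> = (\<Sum>k<b. M $$ (a - Suc j, b - Suc k) * N $$ (b - Suc k, c - Suc i))"
    by (rule sum.nat_diff_reindex[symmetric])
  also have "\<dots> = (\<Sum>k<b. antitranspose N $$ (i, k) * antitranspose M $$ (k, j))"
    using ij M N by (intro sum.cong) (auto simp: antitranspose_index[OF M] antitranspose_index[OF N] mult.commute)
  also have "\<dots> = (antitranspose N * antitranspose M) $$ (i, j)"
    using ij M N by (intro mat_mult_index_sum[symmetric]) auto
  finally show "antitranspose (M * N) $$ (i, j) = (antitranspose N * antitranspose M) $$ (i, j)" .
qed (use M N in auto)

lemma reversed_index_split:
  fixes a b k :: nat
  assumes "k < a + b"
  shows "a + b - Suc k < a \<longleftrightarrow> \<not> k < b"
    and "\<not> k < b \<Longrightarrow> a + b - Suc k = a - Suc (k - b)"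
    and "k < b \<Longrightarrow> a + b - Suc k - a = b - Suc k"
    and "a + b - Suc k < a + b"
  using assms by arith+

lemma antitranspose_four_block:
  assumes "M1 \<in> carrier_mat a c" "M2 \<in> carrier_mat a d" "M3 \<in> carrier_mat b c" "M4 \<in> carrier_mat b d"
  shows "antitranspose (four_block_mat M1 M2 M3 M4) = four_block_mat (antitranspose M4) (antitranspose M2)
    (antitranspose M3) (antitranspose M1)" (is "?l = ?r")
proof (rule eq_matI)
  fix i j assume "i < dim_row ?r" "j < dim_col ?r"
  then have ij: "i < c + d" "j < a + b" using assms by auto
  define p q where "p = c + d - Suc i" and "q = a + b - Suc j"
  have p: "p < c \<longleftrightarrow> \<not> i < d" "\<not> i < d \<Longrightarrow> p = c - Suc (i - d)" "i < d \<Longrightarrow> p - c = d - Suc i" "p < c + d"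
    unfolding p_def by (fact reversed_index_split[OF ij(1)])+
  have q: "q < a \<longleftrightarrow> \<not> j < b" "\<not> j < b \<Longrightarrow> q = a - Suc (j - b)" "j < b \<Longrightarrow> q - a = b - Suc j" "q < a + b"
    unfolding q_def by (fact reversed_index_split[OF ij(2)])+
  have l: "?l $$ (i, j) = four_block_mat M1 M2 M3 M4 $$ (q, p)"
    unfolding p_def q_def using ij assms by (intro antitranspose_index) auto
  have 1: "i - d < c" if "\<not> i < d" using ij that by arith
  have 2: "j - b < a" if "\<not> j < b" using ij that by arith
  have 3: "c - Suc (i - d) < c" if "\<not> i < d" using 1[OF that] by arith
  have 4: "a - Suc (j - b) < a" if "\<not> j < b" using 2[OF that] by arith
  have m: "four_block_mat M1 M2 M3 M4 $$ (q, p) =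
     (if q < a then if p < c then M1 $$ (q, p) else M2 $$ (q, p - c)
      else if p < c then M3 $$ (q - a, p) else M4 $$ (q - a, p - c))"
    using assms p(4) q(4) by (subst index_mat_four_block(1)) auto
  have r: "?r $$ (i, j) =
     (if i < d then if j < b then antitranspose M4 $$ (i, j) else antitranspose M2 $$ (i, j - b)
      else if j < b then antitranspose M3 $$ (i - d, j) else antitranspose M1 $$ (i - d, j - b))"
    using assms ij by (subst index_mat_four_block(1)) auto
  show "?l $$ (i, j) = ?r $$ (i, j)"
    unfolding l m r
    by (cases "i < d"; cases "j < b"; simp only: 3 4 p(1-3) q(1-3) 1 2 if_True if_False not_True_eq_False
        not_False_eq_True antitranspose_index[OF assms(1)] antitranspose_index[OF assms(2)]
        antitranspose_index[OF assms(3)] antitranspose_index[OF assms(4)])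
qed (use assms in auto)

lemma antitranspose_dsum:
  assumes "M \<in> carrier_mat a a" "N \<in> carrier_mat b b"
  shows "antitranspose (dsum M N) = dsum (antitranspose N) (antitranspose M)"
  unfolding dsum_def using assms by (subst antitranspose_four_block[of _ a a _ b _ b]) auto

lemma antitranspose_emb:
  assumes "Z \<in> carrier_mat d d"
  shows "antitranspose (emb a Z b) = emb b (antitranspose Z) a"
  unfolding emb_def using assms
  by (subst antitranspose_dsum[of _ a _ "d + b"]; (subst antitranspose_dsum[of _ d _ b])?)
    (auto simp: dsum_assoc intro!: dsum_carrier)

lemma antitranspose_swap2:
  assumes "X \<in> carrier_mat n n" "Y \<in> carrier_mat n n"
  shows "antitranspose (swap2 n X Y) = swap2 n (antitranspose Y) (antitranspose X)"
    unfolding swap2_def using assms by (subst antitranspose_four_block[of _ n n _ n _ n]) auto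

lemma antitranspose_cross:
  assumes "X \<in> carrier_mat n n" "Y \<in> carrier_mat n n" "c + 2 \<le> m"
  shows "antitranspose (cross n m c X Y) = cross n m (m - c - 2) (antitranspose Y) (antitranspose X)"
  unfolding cross_def using assms by (subst antitranspose_emb[of _ "n + n"]) (auto simp: antitranspose_swap2)

lemma antitranspose_spot:
  assumes "X \<in> carrier_mat n n" "c < m"
  shows "antitranspose (spot n m c X) = spot n m (m - c - 1) (antitranspose X)"
  unfolding spot_def using assms by (subst antitranspose_emb[of _ n]) auto

lemma antitranspose_mat_prod:
  fixes Ms :: "'a::comm_ring_1 mat list"
  shows "set Ms \<subseteq> carrier_mat N N \<Longrightarrow>
    antitranspose (mat_prod N Ms) = mat_prod N (rev (map antitranspose Ms))"
proof (induction Ms)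
  case (Cons M Ms)
  then have "antitranspose (mat_prod N (M # Ms)) = mat_prod N (rev (map antitranspose Ms)) * antitranspose M"
    by (auto simp: antitranspose_mult[of _ N N _ N] mat_prod_carrier)
  also have "\<dots> = mat_prod N (rev (map antitranspose Ms) @ [antitranspose M])"
    using Cons.prems by (subst mat_prod_append) (auto intro!: arg_cong[of _ _ "\<lambda>x. _ * x"] right_mult_one_mat[symmetric])
  finally show ?case by simp
qed simp

section \<open>Splitting off the first block\<close>

definition first_block :: "nat \<Rightarrow> nat \<Rightarrow> 'a::{zero,one} mat" where
  "first_block n k = mat (n + k) n (\<lambda>(i, j). if i = j then 1 else 0)"

lemma first_block_carrier [simp]: "first_block n k \<in> carrier_mat (n + k) n"
  "transpose_mat (first_block n k) \<in> carrier_mat n (n + k)"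
  by (auto simp: first_block_def)

lemma first_block_dims [simp]: "dim_row (first_block n k) = n + k" "dim_col (first_block n k) = n"
  by (auto simp: first_block_def)

lemma first_block_index [simp]:
  fixes M X :: "'a::comm_ring_1 mat"
  shows "M \<in> carrier_mat a (n + k) \<Longrightarrow> i < a \<Longrightarrow> j < n \<Longrightarrow> (M * first_block n k) $$ (i, j) = M $$ (i, j)"
    "X \<in> carrier_mat n b \<Longrightarrow> i < n + k \<Longrightarrow> j < b \<Longrightarrow>
       (first_block n k * X) $$ (i, j) = (if i < n then X $$ (i, j) else 0)"
    "M \<in> carrier_mat (n + k) b \<Longrightarrow> i < n \<Longrightarrow> j < b \<Longrightarrow>
       (transpose_mat (first_block n k) * M) $$ (i, j) = M $$ (i, j)"
    "X \<in> carrier_mat a n \<Longrightarrow> i < a \<Longrightarrow> j < n + k \<Longrightarrow>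
       (X * transpose_mat (first_block n k)) $$ (i, j) = (if j < n then X $$ (i, j) else 0)"
proof -
  assume *: "M \<in> carrier_mat a (n + k)" "i < a" "j < n"
  have "(M * first_block n k) $$ (i, j) = (\<Sum>l<n+k. M $$ (i, l) * first_block n k $$ (l, j))"
    using * by (intro mat_mult_index_sum[of _ a _ _ n]) auto
  also have "\<dots> = (\<Sum>l<n+k. if l = j then M $$ (i, l) else 0)"
    using * by (intro sum.cong) (auto simp: first_block_def)
  finally show "(M * first_block n k) $$ (i, j) = M $$ (i, j)" using * by simp
next
  assume *: "X \<in> carrier_mat n b" "i < n + k" "j < b"
  have "(first_block n k * X) $$ (i, j) = (\<Sum>l<n. first_block n k $$ (i, l) * X $$ (l, j))"
    using * by (intro mat_mult_index_sum[of _ "n + k" _ _ b]) auto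
  also have "\<dots> = (\<Sum>l<n. if l = i then X $$ (l, j) else 0)"
    using * by (intro sum.cong) (auto simp: first_block_def)
  finally show "(first_block n k * X) $$ (i, j) = (if i < n then X $$ (i, j) else 0)" using * by simp
next
  assume *: "M \<in> carrier_mat (n + k) b" "i < n" "j < b"
  have "(transpose_mat (first_block n k) * M) $$ (i, j) = (\<Sum>l<n+k. transpose_mat (first_block n k) $$ (i, l) * M $$ (l, j))"
    using * by (intro mat_mult_index_sum[of _ n _ _ b]) auto
  also have "\<dots> = (\<Sum>l<n+k. if l = i then M $$ (l, j) else 0)"
    using * by (intro sum.cong) (auto simp: first_block_def)
  finally show "(transpose_mat (first_block n k) * M) $$ (i, j) = M $$ (i, j)" using * by simp
next
  assume *: "X \<in> carrier_mat a n" "i < a" "j < n + k"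
  have "(X * transpose_mat (first_block n k)) $$ (i, j) = (\<Sum>l<n. X $$ (i, l) * transpose_mat (first_block n k) $$ (l, j))"
    using * by (intro mat_mult_index_sum[of _ a _ _ "n + k"]) auto
  also have "\<dots> = (\<Sum>l<n. if l = j then X $$ (i, l) else 0)"
    using * by (intro sum.cong) (auto simp: first_block_def)
  finally show "(X * transpose_mat (first_block n k)) $$ (i, j) = (if j < n then X $$ (i, j) else 0)" using * by simp
qed

abbreviation "first_row n k \<equiv> transpose_mat (first_block n k)"

lemma dsum_swap2_four_block:
  fixes X Y :: "'a::comm_ring_1 mat"
  assumes "X \<in> carrier_mat n n" "Y \<in> carrier_mat n n"
  shows "dsum (swap2 n X Y) (1\<^sub>m k) = four_block_mat X (first_row n k) (first_block n k) (dsum Y (1\<^sub>m k))"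
  using assms by (intro eq_matI) (auto simp: swap2_def first_block_def)

lemma (in unital_subring) over_first_block [simp]: "over (first_block n k)" "over (first_row n k)"
  by (auto simp: over_def first_block_def K_one K_zero)

text \<open>
  The step for an index \<open>m\<close> whose factor \<open>M_{-m}(A)\<close> belongs to the leading part. Then
  \<open>T = [[- I, x W], [x e, x (A \<oplus> I) D - E]]\<close> with \<open>W = Q e\<^sup>T D\<close>, where \<open>e\<close> is the first block column. The block \<open>- I\<close> serves as pivot,
  and its Schur complement is \<open>x ((x Q + A) \<oplus> I) D - E\<close> since \<open>e W = (Q \<oplus> 0) D\<close>.
\<close>
lemma (in unital_subring) peel_neg:
  assumes c: "D \<in> carrier_mat (n + k) (n + k)" "E \<in> carrier_mat (n + k) (n + k)"
      "Q \<in> carrier_mat n n" "A \<in> carrier_mat n n"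
    and K: "over D" "over Q" "x \<in> K"
  defines "T \<equiv> x \<cdot>\<^sub>m (dsum Q (1\<^sub>m (n + k)) * (dsum (swap2 n (0\<^sub>m n n) A) (1\<^sub>m k) * dsum (1\<^sub>m n) D)) - dsum (1\<^sub>m n) E"
    and "U \<equiv> four_block_mat (1\<^sub>m n) (0\<^sub>m n (n + k)) (x \<cdot>\<^sub>m first_block n k) (1\<^sub>m (n + k))"
    and "V \<equiv> four_block_mat (- 1\<^sub>m n) (x \<cdot>\<^sub>m (Q * (first_row n k * D))) (0\<^sub>m (n + k) n) (1\<^sub>m (n + k))"
  shows "U * T * V = dsum (1\<^sub>m n) (x \<cdot>\<^sub>m (dsum (x \<cdot>\<^sub>m Q + A) (1\<^sub>m k) * D) - E)" "kunit (n + (n + k)) U" "kunit (n + (n + k)) V"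
proof -
  let ?e = "first_block n k :: 'a mat" and ?f = "first_row n k :: 'a mat"
  define W where "W = Q * (?f * D)"
  define J where "J = dsum A (1\<^sub>m k)"
  define J' where "J' = dsum (x \<cdot>\<^sub>m Q + A) (1\<^sub>m k)"
  have W: "W \<in> carrier_mat n (n + k)" and J: "J \<in> carrier_mat (n + k) (n + k)" "J' \<in> carrier_mat (n + k) (n + k)"
    using c by (auto simp: W_def J_def J'_def intro!: dsum_carrier mult_carrier_mat[of Q _ n] mult_carrier_mat[of ?f _ "n + k"])
  have fD: "?f * D \<in> carrier_mat n (n + k)" using c by (intro mult_carrier_mat) auto
  have 1: "dsum (swap2 n (0\<^sub>m n n) A) (1\<^sub>m k) * dsum (1\<^sub>m n) D = four_block_mat (0\<^sub>m n n) (?f * D) ?e (J * D)"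
    unfolding dsum_swap2_four_block[OF zero_carrier_mat c(4)] J_def[symmetric] unfolding dsum_def[of "1\<^sub>m n" D]
    using c J fD
    by (subst mult_four_block_mat[of _ n n _ "n + k" _ "n + k" _ _ n _ "n + k"])
       (auto intro!: cong_four_block_mat simp: left_add_zero_mat[of _ n "n + k"] left_add_zero_mat[of _ "n + k" "n + k"])
  have 2: "dsum Q (1\<^sub>m (n + k)) * four_block_mat (0\<^sub>m n n) (?f * D) ?e (J * D) = four_block_mat (0\<^sub>m n n) W ?e (J * D)"
    unfolding dsum_def[of Q "1\<^sub>m (n + k)"] using c J fD W
    by (subst mult_four_block_mat[of _ n n _ "n + k" _ "n + k" _ _ n _ "n + k"])
       (auto intro!: cong_four_block_mat simp: W_def)
  have T: "T = four_block_mat (- 1\<^sub>m n) (x \<cdot>\<^sub>m W) (x \<cdot>\<^sub>m ?e) (x \<cdot>\<^sub>m (J * D) - E)"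
    unfolding T_def 1 2 using c J W by (intro eq_matI) (auto simp: dsum_def)
  have eW: "?e * W = dsum Q (0\<^sub>m k k) * D"
  proof -
    have "?e * W = (?e * Q * ?f) * D"
      using c by (simp add: W_def assoc_mult_mat[of _ "n + k" n _ n _ "n + k"] assoc_mult_mat[of _ n n _ "n + k" _ "n + k"]
          assoc_mult_mat[of _ "n + k" n _ "n + k" _ "n + k"] mult_carrier_mat[of _ n n _ "n + k"] )
    also have "?e * Q \<in> carrier_mat (n + k) n" using c by (intro mult_carrier_mat[of _ _ n]) auto
    then have "?e * Q * ?f = dsum Q (0\<^sub>m k k)"
      using c by (intro eq_matI) (auto simp del: index_mult_mat(1) simp: first_block_index(4)[where a = "n + k"])
    finally show ?thesis .
  qed
  have J'J: "x \<cdot>\<^sub>m dsum Q (0\<^sub>m k k) + J = J'"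
    using c by (intro eq_matI) (auto simp: J_def J'_def)
  have "(x \<cdot>\<^sub>m ?e) * (x \<cdot>\<^sub>m W) + (x \<cdot>\<^sub>m (J * D) - E) = x \<cdot>\<^sub>m (x \<cdot>\<^sub>m dsum Q (0\<^sub>m k k) * D) + (x \<cdot>\<^sub>m (J * D) - E)"
    using W c by (simp add: mult_smult_distrib[of _ "n + k" n] mult_smult_assoc_mat[of _ "n + k" n] mult_smult_assoc_mat[of _ "n + k" "n + k"] eW dsum_carrier)
  also have "\<dots> = x \<cdot>\<^sub>m ((x \<cdot>\<^sub>m dsum Q (0\<^sub>m k k) + J) * D) - E"
    using c J by (subst add_mult_distrib_mat[of _ "n + k" "n + k"])
       (auto intro!: eq_matI dsum_carrier simp del: index_mult_mat(1) simp: algebra_simps)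
  finally have key: "(x \<cdot>\<^sub>m ?e) * (x \<cdot>\<^sub>m W) + (x \<cdot>\<^sub>m (J * D) - E) = x \<cdot>\<^sub>m (J' * D) - E"
    unfolding J'J .
  have s: "x \<cdot>\<^sub>m ?e * - 1\<^sub>m n + x \<cdot>\<^sub>m ?e = 0\<^sub>m (n + k) n"
    by (subst uminus_mult_right_mat) (auto intro!: eq_matI)
  have UT: "U * T = four_block_mat (- 1\<^sub>m n) (x \<cdot>\<^sub>m W) (0\<^sub>m (n + k) n) (x \<cdot>\<^sub>m (J' * D) - E)"
    unfolding U_def T using c J W
    by (subst mult_four_block_mat[of _ n n _ "n + k" _ "n + k" _ _ n _ "n + k"])
       (auto intro!: cong_four_block_mat simp: key s left_mult_one_mat[of _ n n] left_mult_one_mat[of _ n "n + k"] left_mult_one_mat[of _ "n + k" "n + k"])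
  have m1: "- 1\<^sub>m n * - 1\<^sub>m n = (1\<^sub>m n :: 'a mat)"
    by (subst uminus_mult_left_mat; (subst uminus_mult_right_mat)?) auto
  have m2: "- 1\<^sub>m n * (x \<cdot>\<^sub>m W) + x \<cdot>\<^sub>m W = 0\<^sub>m n (n + k)"
    using W by (subst uminus_mult_left_mat) (auto intro!: eq_matI)
  show "U * T * V = dsum (1\<^sub>m n) (x \<cdot>\<^sub>m (dsum (x \<cdot>\<^sub>m Q + A) (1\<^sub>m k) * D) - E)"
    unfolding UT V_def W_def[symmetric] J'_def[symmetric] dsum_def[of "1\<^sub>m n"] using c J W
    by (subst mult_four_block_mat[of _ n n _ "n + k" _ "n + k" _ _ n _ "n + k"])
       (auto intro!: cong_four_block_mat simp: m1 m2)
  show "kunit (n + (n + k)) U" unfolding U_def by (intro kunit_lower over_smult K) auto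
  show "kunit (n + (n + k)) V" unfolding V_def W_def[symmetric] using W c K
    by (intro kunit_upper over_smult K) (auto simp: W_def intro!: over_mult[OF c(3) fD] over_mult[of ?f n "n + k" D "n + k"])
qed

text \<open>
  The step for an index \<open>m\<close> whose factor \<open>M_m(- A)\<close> belongs to the trailing part. The upper left block of \<open>T\<close> is then
  \<open>x Q + A\<close>, which is no pivot, and the block below it starts with \<open>- I\<close>. Multiplication by \<open>M_{-m}(x Q + A)\<close> exchanges
  the first two block rows and at the same time eliminates \<open>x Q + A\<close> by means of \<open>- I\<close>. The result is the same as in \<open>peel_neg\<close>.
\<close>
lemma (in unital_subring) peel_pos:
  assumes c: "D \<in> carrier_mat (n + k) (n + k)" "E \<in> carrier_mat (n + k) (n + k)"
      "Q \<in> carrier_mat n n" "A \<in> carrier_mat n n"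
    and K: "over D" "over Q" "over A" "x \<in> K"
  defines "T \<equiv> x \<cdot>\<^sub>m (dsum Q (1\<^sub>m (n + k)) * dsum (1\<^sub>m n) D) - dsum (swap2 n (- A) (0\<^sub>m n n)) (1\<^sub>m k) * dsum (1\<^sub>m n) E"
    and "U \<equiv> dsum (swap2 n (0\<^sub>m n n) (x \<cdot>\<^sub>m Q + A)) (1\<^sub>m k)"
    and "V \<equiv> four_block_mat (- 1\<^sub>m n) (x \<cdot>\<^sub>m (first_row n k * D)) (0\<^sub>m (n + k) n) (1\<^sub>m (n + k))"
  shows "U * T * V = dsum (1\<^sub>m n) (x \<cdot>\<^sub>m (dsum (x \<cdot>\<^sub>m Q + A) (1\<^sub>m k) * D) - E)" "kunit (n + (n + k)) U" "kunit (n + (n + k)) V"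
proof -
  let ?e = "first_block n k :: 'a mat" and ?f = "first_row n k :: 'a mat"
  define Q' where "Q' = x \<cdot>\<^sub>m Q + A"
  define J where "J = dsum (0\<^sub>m n n) (1\<^sub>m k :: 'a mat)"
  define J' where "J' = dsum Q' (1\<^sub>m k)"
  have Q': "Q' \<in> carrier_mat n n" using c by (auto simp: Q'_def)
  have J: "J \<in> carrier_mat (n + k) (n + k)" "J' \<in> carrier_mat (n + k) (n + k)"
    using Q' by (auto simp: J_def J'_def intro!: dsum_carrier)
  have fc: "?f * D \<in> carrier_mat n (n + k)" "?f * E \<in> carrier_mat n (n + k)" using c by (auto intro!: mult_carrier_mat[of _ _ "n + k"])
  have 1: "dsum (swap2 n (- A) (0\<^sub>m n n)) (1\<^sub>m k) * dsum (1\<^sub>m n) E = four_block_mat (- A) (?f * E) ?e (J * E)"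
    unfolding dsum_swap2_four_block[OF uminus_carrier_mat[OF c(4)] zero_carrier_mat] J_def[symmetric] unfolding dsum_def[of "1\<^sub>m n" E]
    using c J fc
    by (subst mult_four_block_mat[of _ n n _ "n + k" _ "n + k" _ _ n _ "n + k"])
       (auto intro!: cong_four_block_mat simp: left_add_zero_mat[of _ n "n + k"] left_add_zero_mat[of _ "n + k" "n + k"] right_mult_one_mat[of _ n n])
  have 2: "dsum Q (1\<^sub>m (n + k)) * dsum (1\<^sub>m n) D = dsum Q D"
    using c by (subst dsum_mult[of _ n n _ n _ "n + k" "n + k" _ "n + k"]) auto
  have T: "T = four_block_mat Q' (- (?f * E)) (- ?e) (x \<cdot>\<^sub>m D - J * E)"
    unfolding T_def 1 2 using c J fc by (intro eq_matI) (auto simp: dsum_def Q'_def)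
  have U: "U = four_block_mat (0\<^sub>m n n) ?f ?e J'"
    unfolding U_def J'_def Q'_def[symmetric] by (rule dsum_swap2_four_block) (auto simp: Q')
  have fe: "?f * ?e = 1\<^sub>m n" by (intro eq_matI) (auto simp del: index_mult_mat(1) simp: first_block_index(3)[where b = n], auto simp: first_block_def)
  have fJ: "?f * J = 0\<^sub>m n (n + k)" using J by (intro eq_matI) (auto simp del: index_mult_mat(1) simp: first_block_index(3)[where b = "n + k"], auto simp: J_def)
  have J'e: "J' * ?e = ?e * Q'" using J Q' by (intro eq_matI) (auto simp del: index_mult_mat(1) simp: first_block_index(1)[where a = "n + k"], auto simp: J'_def)
  have J'J: "J' * J = J" unfolding J_def J'_def using Q' by (subst dsum_mult[of _ n n _ n _ k k _ k]) auto
  have ef: "?e * ?f + J = 1\<^sub>m (n + k)"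
    by (intro eq_matI) (auto simp del: index_mult_mat(1) simp: first_block_index(4)[where a = "n + k"] J_def, auto simp: first_block_def)
  have b11: "0\<^sub>m n n * Q' + ?f * - ?e = - 1\<^sub>m n"
    using Q' by (simp add: uminus_mult_right_mat fe)
  have b21: "?e * Q' + J' * - ?e = 0\<^sub>m (n + k) n"
    using Q' J mult_carrier_mat[OF first_block_carrier(1) Q', of k] by (simp add: J'e) (auto intro!: eq_matI simp del: index_mult_mat(1))
  have fJE: "?f * (J * E) = 0\<^sub>m n (n + k)"
    using c J by (simp add: assoc_mult_mat[of _ n "n + k" _ "n + k" _ "n + k", symmetric] fJ)
  have b12: "0\<^sub>m n n * - (?f * E) + ?f * (x \<cdot>\<^sub>m D - J * E) = x \<cdot>\<^sub>m (?f * D)"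
    using c J fc fJE by (subst mult_minus_distrib_mat[of _ n "n + k" _ "n + k"])
      (auto simp: mult_smult_distrib[of _ n "n + k" _ "n + k"] left_add_zero_mat[of _ n "n + k"] intro!: eq_matI)
  have J'JE: "J' * (J * E) = J * E"
    using c J by (simp add: assoc_mult_mat[of _ "n + k" "n + k" _ "n + k" _ "n + k", symmetric] J'J)
  have efE: "?e * (?f * E) + J * E = E"
  proof -
    have "?e * (?f * E) + J * E = (?e * ?f + J) * E"
      using c J by (subst add_mult_distrib_mat[of _ "n + k" "n + k"]) (auto simp: assoc_mult_mat[of _ "n + k" n _ "n + k" _ "n + k"])
    then show ?thesis using c by (simp add: ef)
  qed
  have efc: "?e * (?f * E) \<in> carrier_mat (n + k) (n + k)" using fc by (auto intro!: mult_carrier_mat[of _ _ n])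
  have "?e * - (?f * E) + J' * (x \<cdot>\<^sub>m D - J * E) = - (?e * (?f * E)) + (x \<cdot>\<^sub>m (J' * D) - J * E)"
    using c J fc J'JE by (subst mult_minus_distrib_mat[of _ "n + k" "n + k" _ "n + k"])
      (auto simp: mult_smult_distrib[of _ "n + k" "n + k" _ "n + k"])
  also have "\<dots> = x \<cdot>\<^sub>m (J' * D) - (?e * (?f * E) + J * E)"
    using c J efc by (intro eq_matI) (auto simp del: index_mult_mat(1))
  finally have b22: "?e * - (?f * E) + J' * (x \<cdot>\<^sub>m D - J * E) = x \<cdot>\<^sub>m (J' * D) - E"
    unfolding efE .
  have UT: "U * T = four_block_mat (- 1\<^sub>m n) (x \<cdot>\<^sub>m (?f * D)) (0\<^sub>m (n + k) n) (x \<cdot>\<^sub>m (J' * D) - E)"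
    unfolding U T b11[symmetric] b12[symmetric] b21[symmetric] b22[symmetric] using c J fc Q'
    by (intro mult_four_block_mat[of _ n n _ "n + k" _ "n + k" _ _ n _ "n + k"]) auto
  have m1: "- 1\<^sub>m n * - 1\<^sub>m n = (1\<^sub>m n :: 'a mat)"
    by (subst uminus_mult_left_mat; (subst uminus_mult_right_mat)?) auto
  have m2: "- 1\<^sub>m n * (x \<cdot>\<^sub>m (?f * D)) + x \<cdot>\<^sub>m (?f * D) = 0\<^sub>m n (n + k)"
    using fc by (subst uminus_mult_left_mat) (auto intro!: eq_matI)
  show "U * T * V = dsum (1\<^sub>m n) (x \<cdot>\<^sub>m (dsum (x \<cdot>\<^sub>m Q + A) (1\<^sub>m k) * D) - E)"
    unfolding UT V_def Q'_def[symmetric] J'_def[symmetric] dsum_def[of "1\<^sub>m n"] using c J fc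
    by (subst mult_four_block_mat[of _ n n _ "n + k" _ "n + k" _ _ n _ "n + k"])
       (auto intro!: cong_four_block_mat simp: m1 m2)
  have oQ: "over Q'" unfolding Q'_def using c K by (auto intro!: over_add[of _ n n] over_smult)
  show "kunit (n + (n + k)) V" unfolding V_def using fc c K
    by (intro kunit_upper over_smult K) (auto intro!: over_mult[of _ n "n + k" _ "n + k"])
  have "kunit (n + n) (swap2 n (0\<^sub>m n n) Q')"
    using swap2_mult[of "- Q'" n] Q' oQ
    by (intro kunitI[of _ _ "swap2 n (- Q') (0\<^sub>m n n)"])
       (auto simp: swap2_def intro!: over_four_block[of _ n n _ n _ n] over_uminus)
  then show "kunit (n + (n + k)) U" unfolding U_def Q'_def[symmetric]
    by (metis kunit_dsum kunit_one add.assoc)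
qed

section \<open>Fiedler pencils with alternating factors\<close>

text \<open>
  For a set \<open>s\<close> of indices, \<open>neg_prod\<close> is the product of the \<open>M_{-j}(A_j)\<close> with \<open>j \<in> s\<close>, and \<open>pos_prod\<close> the product of
  the \<open>M_j(- A_j)\<close> with \<open>j \<notin> s\<close>, closed by \<open>M_0(- A_0)\<close>; both run through the indices in descending order.
  In \<open>gf_pencil\<close> the coefficient \<open>Q\<close> of the factor \<open>M_{-m}\<close> is separate from \<open>A\<close>, since it changes with each step of the
  reduction. The set \<open>s\<close> is arbitrary because reflection turns \<open>s\<close> into another set.
\<close>
definition neg_prod :: "nat \<Rightarrow> (nat \<Rightarrow> bool) \<Rightarrow> (nat \<Rightarrow> 'a::comm_ring_1 mat) \<Rightarrow> nat \<Rightarrow> 'a mat" where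
  "neg_prod n s A m = mat_prod (m * n)
     (map (\<lambda>j. cross n m (m - j - 1) (0\<^sub>m n n) (A j)) (filter s (rev [1..<m])))"

definition pos_prod :: "nat \<Rightarrow> (nat \<Rightarrow> bool) \<Rightarrow> (nat \<Rightarrow> 'a::comm_ring_1 mat) \<Rightarrow> nat \<Rightarrow> 'a mat" where
  "pos_prod n s A m = mat_prod (m * n)
     (map (\<lambda>j. cross n m (m - j - 1) (- A j) (0\<^sub>m n n)) (filter (\<lambda>j. \<not> s j) (rev [1..<m])))
     * spot n m (m - 1) (- A 0)"

definition gf_pencil :: "nat \<Rightarrow> (nat \<Rightarrow> bool) \<Rightarrow> 'a \<Rightarrow> (nat \<Rightarrow> 'a mat) \<Rightarrow> nat \<Rightarrow> 'a mat \<Rightarrow> 'a::comm_ring_1 mat" where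
  "gf_pencil n s x A m Q = x \<cdot>\<^sub>m (spot n m 0 Q * neg_prod n s A m) - pos_prod n s A m"

fun horner :: "'a::comm_ring_1 \<Rightarrow> (nat \<Rightarrow> 'a mat) \<Rightarrow> nat \<Rightarrow> 'a mat \<Rightarrow> 'a mat" where
  "horner x A 0 Q = Q"
| "horner x A (Suc m) Q = horner x A m (x \<cdot>\<^sub>m Q + A m)"

text \<open>
  With \<open>Q = A_m\<close> this is the value of the matrix polynomial at \<open>x\<close>.
\<close>
lemma horner_sum:
  assumes "Q \<in> carrier_mat n n" "\<And>k. k < m \<Longrightarrow> A k \<in> carrier_mat n n"
  shows "horner x A m Q \<in> carrier_mat n n"
    "i < n \<Longrightarrow> j < n \<Longrightarrow> horner x A m Q $$ (i, j) = x ^ m * Q $$ (i, j) + (\<Sum>k<m. x ^ k * A k $$ (i, j))"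
proof -
  have "horner x A m Q \<in> carrier_mat n n \<and>
    (\<forall>i<n. \<forall>j<n. horner x A m Q $$ (i, j) = x ^ m * Q $$ (i, j) + (\<Sum>k<m. x ^ k * A k $$ (i, j)))"
    using assms
  proof (induction m arbitrary: Q)
    case (Suc m)
    have "x \<cdot>\<^sub>m Q + A m \<in> carrier_mat n n" using Suc.prems by auto
    moreover have "(x \<cdot>\<^sub>m Q + A m) $$ (i, j) = x * Q $$ (i, j) + A m $$ (i, j)" if "i < n" "j < n" for i j
      using Suc.prems(1) Suc.prems(2)[of m] that by auto
    ultimately show ?case using Suc.IH[of "x \<cdot>\<^sub>m Q + A m"] Suc.prems(2) by (auto simp: algebra_simps)
  qed simp
  then show "horner x A m Q \<in> carrier_mat n n"
    "i < n \<Longrightarrow> j < n \<Longrightarrow> horner x A m Q $$ (i, j) = x ^ m * Q $$ (i, j) + (\<Sum>k<m. x ^ k * A k $$ (i, j))"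
    by blast+
qed

lemma filter_rev_upt_Suc: "1 \<le> m \<Longrightarrow> filter s (rev [1..<Suc m]) = (if s m then [m] else []) @ filter s (rev [1..<m])"
  by simp

context
  fixes n :: nat and A :: "nat \<Rightarrow> 'a::comm_ring_1 mat" and s :: "nat \<Rightarrow> bool" and m :: nat
  assumes A: "\<And>j. j < m \<Longrightarrow> A j \<in> carrier_mat n n" and m: "1 \<le> m"
begin

lemma neg_factors_carrier: "set (map (\<lambda>j. cross n m (m - j - 1) (0\<^sub>m n n) (A j)) (filter s (rev [1..<m]))) \<subseteq> carrier_mat (m * n) (m * n)"
  using A by (auto intro!: cross_carrier)

lemma pos_factors_carrier: "set (map (\<lambda>j. cross n m (m - j - 1) (- A j) (0\<^sub>m n n)) (filter (\<lambda>j. \<not> s j) (rev [1..<m]))) \<subseteq> carrier_mat (m * n) (m * n)"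
  using A by (auto intro!: cross_carrier)

lemma neg_prod_carrier: "neg_prod n s A m \<in> carrier_mat (m * n) (m * n)"
  unfolding neg_prod_def by (rule mat_prod_carrier[OF neg_factors_carrier])

lemma pos_prod_carrier: "pos_prod n s A m \<in> carrier_mat (m * n) (m * n)"
  unfolding pos_prod_def using A[of 0] m
  by (intro mult_carrier_mat[OF mat_prod_carrier[OF pos_factors_carrier]] spot_carrier) auto

lemma neg_shift: "mat_prod (Suc m * n) (map (\<lambda>j. cross n (Suc m) (Suc m - j - 1) (0\<^sub>m n n) (A j)) (filter s (rev [1..<m])))
   = dsum (1\<^sub>m n) (neg_prod n s A m)"
proof -
  have "map (\<lambda>j. cross n (Suc m) (Suc m - j - 1) (0\<^sub>m n n) (A j)) (filter s (rev [1..<m]))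
    = map (dsum (1\<^sub>m n)) (map (\<lambda>j. cross n m (m - j - 1) (0\<^sub>m n n) (A j)) (filter s (rev [1..<m])))"
    by (auto simp flip: cross_shift simp: Suc_diff_Suc)
  then show ?thesis
    unfolding neg_prod_def mult_Suc by (simp only: mat_prod_dsum(1)[OF neg_factors_carrier])
qed

lemma pos_shift: "mat_prod (Suc m * n) (map (\<lambda>j. cross n (Suc m) (Suc m - j - 1) (- A j) (0\<^sub>m n n)) (filter (\<lambda>j. \<not> s j) (rev [1..<m])))
   * spot n (Suc m) (Suc m - 1) (- A 0)
   = dsum (1\<^sub>m n) (pos_prod n s A m)"
proof -
  have "map (\<lambda>j. cross n (Suc m) (Suc m - j - 1) (- A j) (0\<^sub>m n n)) (filter (\<lambda>j. \<not> s j) (rev [1..<m]))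
    = map (dsum (1\<^sub>m n)) (map (\<lambda>j. cross n m (m - j - 1) (- A j) (0\<^sub>m n n)) (filter (\<lambda>j. \<not> s j) (rev [1..<m])))"
    by (auto simp flip: cross_shift simp: Suc_diff_Suc)
  then have 1: "mat_prod (Suc m * n) (map (\<lambda>j. cross n (Suc m) (Suc m - j - 1) (- A j) (0\<^sub>m n n)) (filter (\<lambda>j. \<not> s j) (rev [1..<m])))
    = dsum (1\<^sub>m n) (mat_prod (m * n) (map (\<lambda>j. cross n m (m - j - 1) (- A j) (0\<^sub>m n n)) (filter (\<lambda>j. \<not> s j) (rev [1..<m]))))"
    unfolding mult_Suc by (simp only: mat_prod_dsum(1)[OF pos_factors_carrier])
  have 2: "spot n (Suc m) (Suc m - 1) (- A 0) = dsum (1\<^sub>m n) (spot n m (m - 1) (- A 0))"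
    using m by (simp flip: spot_shift)
  show ?thesis
    unfolding 1 2 pos_prod_def using A[of 0] m mat_prod_carrier[OF pos_factors_carrier]
    by (subst dsum_mult[of _ n n _ n _ "m * n" "m * n" _ "m * n"]) (auto intro!: spot_carrier)
qed

lemma neg_prod_Suc:
  assumes "A m \<in> carrier_mat n n"
  shows "neg_prod n s A (Suc m) =
    (if s m then cross n (Suc m) 0 (0\<^sub>m n n) (A m) * dsum (1\<^sub>m n) (neg_prod n s A m)
     else dsum (1\<^sub>m n) (neg_prod n s A m))"
  unfolding neg_prod_def[of n s A "Suc m"] filter_rev_upt_Suc[OF m]
  using neg_shift by simp

lemma pos_prod_Suc:
  assumes "A m \<in> carrier_mat n n"
  shows "pos_prod n s A (Suc m) =
    (if s m then dsum (1\<^sub>m n) (pos_prod n s A m)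
     else cross n (Suc m) 0 (- A m) (0\<^sub>m n n) * dsum (1\<^sub>m n) (pos_prod n s A m))"
proof (cases "s m")
  case True
  then show ?thesis
    unfolding pos_prod_def[of n s A "Suc m"] filter_rev_upt_Suc[OF m] using pos_shift by simp
next
  case False
  let ?P = "mat_prod (Suc m * n) (map (\<lambda>j. cross n (Suc m) (Suc m - j - 1) (- A j) (0\<^sub>m n n)) (filter (\<lambda>j. \<not> s j) (rev [1..<m])))"
  let ?C = "cross n (Suc m) 0 (- A m) (0\<^sub>m n n)" and ?S = "spot n (Suc m) (Suc m - 1) (- A 0)"
  have c: "?P \<in> carrier_mat (Suc m * n) (Suc m * n)" "?C \<in> carrier_mat (Suc m * n) (Suc m * n)"
    "?S \<in> carrier_mat (Suc m * n) (Suc m * n)"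
    using A A[of 0] m assms by (auto intro!: mat_prod_carrier cross_carrier spot_carrier simp del: mult_Suc)
  have "pos_prod n s A (Suc m) = ?C * ?P * ?S"
    unfolding pos_prod_def[of n s A "Suc m"] filter_rev_upt_Suc[OF m] using False by simp
  also have "\<dots> = ?C * (?P * ?S)" using c by (intro assoc_mult_mat[of _ _ "Suc m * n"]) auto
  finally show ?thesis using False pos_shift by simp
qed

end

definition last_block :: "nat \<Rightarrow> nat \<Rightarrow> 'a::comm_ring_1 mat" where
  "last_block n m = plc (m * n) ((m - 1) * n) (1\<^sub>m n)"

lemma last_block_carrier [simp]: "last_block n m \<in> carrier_mat (m * n) n"
  unfolding last_block_def by (rule plc_carrier[of _ n]) simp

lemma last_block_fixed:
  fixes U :: "'a::comm_ring_1 mat"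
  assumes "U \<in> carrier_mat (m * n) (m * n)" "1 \<le> m"
    "\<And>i j. i < m * n \<Longrightarrow> j < m * n \<Longrightarrow> (m - 1) * n \<le> j \<Longrightarrow> U $$ (i, j) = (if i = j then 1 else 0)"
  shows "U * last_block n m = last_block n m"
proof -
  have e: "(m - 1) * n + n = m * n" using assms(2) by (cases m) auto
  show ?thesis unfolding last_block_def
    using assms e by (intro plc_mult[of _ _ _ n n]) auto
qed

context unital_subring
begin

lemma over_neg_prod:
  assumes "\<And>j. j < m \<Longrightarrow> A j \<in> carrier_mat n n \<and> over (A j)" "1 \<le> m"
  shows "over (neg_prod n s A m)"
  unfolding neg_prod_def using assms
  by (intro over_mat_prod neg_factors_carrier) (auto intro!: over_cross)

text \<open>
  The last block is second when two blocks are left, that is, in the step for index 1. The step for an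
  index outside \<open>s\<close> changes the second block, the step for an index in \<open>s\<close> only adds multiples of the first
  block to it. So \<open>s 1\<close> is what keeps the last block column fixed.
\<close>
lemma peel_block:
  assumes A: "\<And>j. j < Suc m \<Longrightarrow> A j \<in> carrier_mat n n \<and> over (A j)" and m: "1 \<le> m"
    and Q: "Q \<in> carrier_mat n n" "over Q" and x: "x \<in> K"
  shows "\<exists>U V. kunit (Suc m * n) U \<and> kunit (Suc m * n) V \<and>
     U * gf_pencil n s x A (Suc m) Q * V = dsum (1\<^sub>m n) (gf_pencil n s x A m (x \<cdot>\<^sub>m Q + A m)) \<and>
     (s 1 \<longrightarrow> U * last_block n (Suc m) = last_block n (Suc m) \<and>
        transpose_mat V * last_block n (Suc m) = last_block n (Suc m))"
proof -
  define k where "k = (m - 1) * n"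
  have N: "m * n = n + k" using m by (cases m) (auto simp: k_def)
  have N': "Suc m * n = n + (n + k)" using N by simp
  define D where "D = neg_prod n s A m"
  define E where "E = pos_prod n s A m"
  have c: "D \<in> carrier_mat (n + k) (n + k)" "E \<in> carrier_mat (n + k) (n + k)" "Q \<in> carrier_mat n n" "A m \<in> carrier_mat n n"
    using neg_prod_carrier[of m A n s] pos_prod_carrier[of m A n s] A m Q by (auto simp: D_def E_def simp flip: N)
  have o: "over D" "over Q" "over (A m)"
    using over_neg_prod[of m A n s] A m Q by (auto simp: D_def)
  have sp: "spot n (Suc m) 0 X = dsum X (1\<^sub>m (n + k))" "spot n m 0 X = dsum X (1\<^sub>m k)" for X :: "'a mat"
    using N by (auto simp: spot_def k_def)
  have cr: "cross n (Suc m) 0 X Y = dsum (swap2 n X Y) (1\<^sub>m k)" for X Y :: "'a mat"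
    by (auto simp: cross_def k_def)
  have km: "Suc m - 1 = m" by simp
  show ?thesis
  proof (cases "s m")
    case True
    have T: "gf_pencil n s x A (Suc m) Q = x \<cdot>\<^sub>m (dsum Q (1\<^sub>m (n + k)) * (dsum (swap2 n (0\<^sub>m n n) (A m)) (1\<^sub>m k) * dsum (1\<^sub>m n) D)) - dsum (1\<^sub>m n) E"
      unfolding gf_pencil_def sp using A m True by (simp add: neg_prod_Suc pos_prod_Suc cr D_def E_def)
    note st = peel_neg[OF c o(1,2) x]
    show ?thesis
      apply (rule exI, rule exI, intro conjI)
         apply (subst N', rule st(2))
        apply (subst N', rule st(3))
       apply (subst T, subst st(1))
       apply (simp add: gf_pencil_def sp D_def E_def)
      apply (intro impI conjI last_block_fixed)
           apply (use N' N c in \<open>auto simp: first_block_def km less_diff_conv2 intro!: mult_carrier_mat[of Q _ n] mult_carrier_mat[of _ _ "n + k"]\<close>)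
      done
  next
    case False
    have T: "gf_pencil n s x A (Suc m) Q = x \<cdot>\<^sub>m (dsum Q (1\<^sub>m (n + k)) * dsum (1\<^sub>m n) D) - dsum (swap2 n (- A m) (0\<^sub>m n n)) (1\<^sub>m k) * dsum (1\<^sub>m n) E"
      unfolding gf_pencil_def sp using A m False by (simp add: neg_prod_Suc pos_prod_Suc cr D_def E_def)
    note st = peel_pos[OF c o x]
    have m2: "n + n \<le> m * n" if "s 1"
    proof -
      have "m \<noteq> 1" using False that by auto
      then have "2 \<le> m" using m by simp
      then have "2 * n \<le> m * n" by (rule mult_right_mono) simp
      then show ?thesis by (simp only: mult_2)
    qed
    have eU: "dsum (swap2 n (0\<^sub>m n n) (x \<cdot>\<^sub>m Q + A m)) (1\<^sub>m k) $$ (i, j) = (if i = j then 1 else 0)"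
      if "s 1" "i < Suc m * n" "j < Suc m * n" "(Suc m - 1) * n \<le> j" for i j
      using that m2 c N N' by (auto simp: swap2_def)
    show ?thesis
      apply (rule exI, rule exI, intro conjI)
         apply (subst N', rule st(2))
        apply (subst N', rule st(3))
       apply (subst T, subst st(1))
       apply (simp add: gf_pencil_def sp D_def E_def)
      apply (intro impI conjI last_block_fixed)
           apply (use st(2,3)[THEN kunit_carrier] in \<open>simp only: N' transpose_carrier_mat\<close>)
          apply simp
         apply (rule eU; assumption)
        apply (use st(2,3)[THEN kunit_carrier] in \<open>simp only: N' transpose_carrier_mat\<close>)
       apply simp
      apply (use N' N c in \<open>auto simp: km\<close>)
      done
  qed
qed

text \<open>
  Each step of \<open>peel_block\<close> is a step of Horner's scheme in the coefficient \<open>Q\<close>. That the last block is fixed allows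
  the transformations to be applied to a pencil with a border attached to that block.
\<close>
theorem gf_pencil_horner:
  assumes "1 \<le> m" "\<And>j. j < m \<Longrightarrow> A j \<in> carrier_mat n n \<and> over (A j)"
    and "Q \<in> carrier_mat n n" "over Q" "x \<in> K"
  shows "\<exists>U V. kunit (m * n) U \<and> kunit (m * n) V \<and>
     U * gf_pencil n s x A m Q * V = dsum (1\<^sub>m ((m - 1) * n)) (horner x A m Q) \<and>
     (s 1 \<longrightarrow> U * last_block n m = last_block n m \<and> transpose_mat V * last_block n m = last_block n m)"
  using assms
proof (induction m arbitrary: Q rule: nat_induct_at_least)
  case base
  have "gf_pencil n s x A 1 Q = horner x A 1 Q"
    using base.prems(1)[of 0] base.prems(2) by (auto simp: gf_pencil_def neg_prod_def pos_prod_def spot_def intro!: eq_matI)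
  moreover have "horner x A 1 Q \<in> carrier_mat n n" using base.prems(1)[of 0] base.prems(2) by auto
  moreover have "1\<^sub>m (1 * n) * last_block n 1 = (last_block n 1 :: 'a mat)"
    by (rule left_mult_one_mat[OF last_block_carrier])
  ultimately show ?case
    by (intro exI[of _ "1\<^sub>m (1 * n)"]) (auto simp: left_mult_one_mat[of _ n n] right_mult_one_mat[of _ n n])
next
  case (Suc m)
  let ?Q = "x \<cdot>\<^sub>m Q + A m" and ?T = "gf_pencil n s x A (Suc m) Q" and ?N = "Suc m * n"
  have Q': "?Q \<in> carrier_mat n n" "over ?Q"
    using Suc.prems(1)[of m] Suc.prems(2-4) by (auto intro!: over_add[of _ n n] over_smult)
  obtain U1 V1 where 1: "kunit ?N U1" "kunit ?N V1" "U1 * ?T * V1 = dsum (1\<^sub>m n) (gf_pencil n s x A m ?Q)"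
    and l1: "s 1 \<Longrightarrow> U1 * last_block n (Suc m) = last_block n (Suc m) \<and>
        transpose_mat V1 * last_block n (Suc m) = last_block n (Suc m)"
    using peel_block[where A = A and s = s, OF Suc.prems(1) Suc.hyps Suc.prems(2-4)] by blast
  obtain U2 V2 where 2: "kunit (m * n) U2" "kunit (m * n) V2"
      "U2 * gf_pencil n s x A m ?Q * V2 = dsum (1\<^sub>m ((m - 1) * n)) (horner x A m ?Q)"
    and l2: "s 1 \<Longrightarrow> U2 * last_block n m = last_block n m \<and> transpose_mat V2 * last_block n m = last_block n m"
    using Suc.IH[OF _ Q' Suc.prems(4)] Suc.prems(1) less_SucI by blast
  define U where "U = dsum (1\<^sub>m n) U2"
  define V where "V = dsum (1\<^sub>m n) V2"
  have UV: "kunit ?N U" "kunit ?N V" using 2 by (auto simp: U_def V_def intro!: kunit_dsum)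
  have T: "?T \<in> carrier_mat ?N ?N"
    unfolding gf_pencil_def using Suc.prems Suc.hyps
    by (intro minus_carrier_mat pos_prod_carrier) auto
  have Tm: "gf_pencil n s x A m ?Q \<in> carrier_mat (m * n) (m * n)"
    unfolding gf_pencil_def using Suc.prems Suc.hyps
    by (intro minus_carrier_mat pos_prod_carrier) auto
  note car = 1(1,2)[THEN kunit_carrier] UV[THEN kunit_carrier] T
  have car2: "U2 \<in> carrier_mat (m * n) (m * n)" "V2 \<in> carrier_mat (m * n) (m * n)"
    using 2 by (auto dest: kunit_carrier)
  have "U * U1 * ?T * (V1 * V) = U * (U1 * ?T * V1) * V"
    using car by (simp add: assoc_mult_mat[of _ ?N ?N _ ?N _ ?N] del: mult_Suc)
  also have "\<dots> = dsum (1\<^sub>m n) (dsum (1\<^sub>m ((m - 1) * n)) (horner x A m ?Q))"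
    unfolding 1(3) U_def V_def using 2(3) car2 Tm
    by (simp add: dsum_mult[of _ n n _ n _ "m * n" "m * n" _ "m * n"])
  also have "\<dots> = dsum (1\<^sub>m ((Suc m - 1) * n)) (horner x A (Suc m) Q)"
    using Suc.hyps by (cases m) (simp_all add: dsum_one flip: dsum_assoc)
  finally have main: "U * U1 * ?T * (V1 * V) = dsum (1\<^sub>m ((Suc m - 1) * n)) (horner x A (Suc m) Q)" .
  have lb: "U * last_block n (Suc m) = last_block n (Suc m) \<and> transpose_mat V * last_block n (Suc m) = last_block n (Suc m)" if "s 1"
  proof -
    have e: "n + (m - 1) * n = (Suc m - 1) * n" using Suc.hyps by (cases m) auto
    have "dsum (1\<^sub>m n) W * last_block n (Suc m) = last_block n (Suc m)"
      if "W \<in> carrier_mat (m * n) (m * n)" "W * last_block n m = last_block n m" for W :: "'a mat"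
      using plc_dsum[OF that(1) one_carrier_mat, where k = n] that(2) unfolding last_block_def e[symmetric] by simp
    from this[OF car2(1)] this[of "transpose_mat V2"] show ?thesis
      using l2[OF that] car2 by (simp add: U_def V_def dsum_transpose)
  qed
  have lbc: "U * U1 * last_block n (Suc m) = U * (U1 * last_block n (Suc m))"
    "transpose_mat (V1 * V) * last_block n (Suc m) = transpose_mat V * (transpose_mat V1 * last_block n (Suc m))"
    using car last_block_carrier[of n "Suc m"]
    by (simp_all add: assoc_mult_mat[of _ ?N ?N _ ?N _ n] transpose_mult[of _ ?N ?N _ ?N] del: mult_Suc)
  show ?case
    using main lb l1 lbc kunit_mult[OF UV(1) 1(1)] kunit_mult[OF 1(2) UV(2)]
    by (intro exI[of _ "U * U1"] exI[of _ "V1 * V"]) auto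
qed

end

section \<open>Inverses of matrices\<close>

lemma mat_inv_unique:
  fixes M :: "'a::field mat"
  assumes "M \<in> carrier_mat N N" "M' \<in> carrier_mat N N" "M * M' = 1\<^sub>m N" "M' * M = 1\<^sub>m N"
  shows "mat_inv M = M'"
proof -
  have "M \<in> Units (ring_mat TYPE('a) N ())"
    using assms unfolding Units_def by (auto simp: ring_mat_def)
  then have "mat_inverse M \<noteq> None" using mat_inverse(1)[OF assms(1), of "()"] by blast
  then obtain C where C: "mat_inverse M = Some C" by blast
  from mat_inverse(2)[OF assms(1) this] have c: "M * C = 1\<^sub>m N" "C \<in> carrier_mat N N" by auto
  have "M' = M' * (M * C)" using c assms(1,2) by simp
  also have "\<dots> = M' * M * C" using c assms(1,2) by (intro assoc_mult_mat[symmetric, of _ N N _ N _ N]) auto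
  also have "\<dots> = C" using c assms(4) by simp
  finally show ?thesis unfolding mat_inv_def C by simp
qed

lemma invertible_mat_obtain_inverse:
  fixes M :: "'a::comm_ring_1 mat"
  assumes "invertible_mat M" "M \<in> carrier_mat N N"
  obtains M' where "M' \<in> carrier_mat N N" "M * M' = 1\<^sub>m N" "M' * M = 1\<^sub>m N"
proof -
  obtain B where B: "M * B = 1\<^sub>m (dim_row M)" "B * M = 1\<^sub>m (dim_row B)"
    using assms(1) by (auto simp: invertible_mat_def inverts_mat_def)
  have "dim_col (M * B) = dim_row M" "dim_col (B * M) = dim_row B" unfolding B by auto
  then have "B \<in> carrier_mat N N" using assms(2) by auto
  then show ?thesis using that[of B] B assms(2) by auto
qed

lemma invertible_matI:
  fixes M :: "'a::comm_ring_1 mat"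
  assumes "M \<in> carrier_mat N N" "M' \<in> carrier_mat N N" "M * M' = 1\<^sub>m N" "M' * M = 1\<^sub>m N"
  shows "invertible_mat M"
  using assms by (auto simp: invertible_mat_def inverts_mat_def intro!: exI[of _ M'])

section \<open>The reversed pencil\<close>

lemma rev_upt_diff: "rev [1..<m] = map (\<lambda>j. m - j) [1..<m]"
  by (rule nth_equalityI) (auto simp: rev_nth)

lemma map_diff_filter:
  "map (\<lambda>j. f (m - j)) (filter s [1..<m]) = map f (filter (\<lambda>i. s (m - i)) (rev [1..<m]))"
  unfolding rev_upt_diff filter_map map_map o_def
  by (rule arg_cong2[of _ _ _ _ map]) (auto intro!: filter_cong)

text \<open>
  Reflection sends a factor at block position \<open>m - j - 1\<close> to position \<open>j - 1\<close>, which is the position of index \<open>m - j\<close>, and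
  exchanges the two diagonal corners of the factor: \<open>M_{-j}(A_j)\<close> becomes \<open>M_{m-j}\<close> and \<open>M_j(- A_j)\<close>
  becomes \<open>M_{-(m-j)}\<close>. Since the order of products is reversed twice, by reflection and by \<open>j \<mapsto> m - j\<close>, the
  product formulas have the same shape; the leading and the trailing part trade places, which explains the sign.
\<close>
lemma gf_pencil_antitranspose:
  fixes A :: "nat \<Rightarrow> 'a::comm_ring_1 mat"
  assumes m: "1 \<le> m" and A: "\<And>j. j \<le> m \<Longrightarrow> A j \<in> carrier_mat n n" and x: "x * \<mu> = 1"
  defines "A' \<equiv> \<lambda>i. - antitranspose (A (m - i))"
  shows "antitranspose (\<mu> \<cdot>\<^sub>m gf_pencil n s x A m (A m)) = - gf_pencil n (\<lambda>i. \<not> s (m - i)) \<mu> A' m (A' m)"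
proof -
  let ?N = "m * n" and ?s = "\<lambda>i. \<not> s (m - i)"
  have A': "A' j \<in> carrier_mat n n" for j using A by (auto simp: A'_def)
  have D: "neg_prod n s A m \<in> carrier_mat ?N ?N" "pos_prod n s A m \<in> carrier_mat ?N ?N"
    "neg_prod n ?s A' m \<in> carrier_mat ?N ?N" "pos_prod n ?s A' m \<in> carrier_mat ?N ?N"
    using m A A' by (auto intro!: neg_prod_carrier pos_prod_carrier)
  have S: "spot n m c X \<in> carrier_mat ?N ?N" if "c < m" "X \<in> carrier_mat n n" for c and X :: "'a mat"
    using that by (rule spot_carrier)
  have f1: "map antitranspose (map (\<lambda>j. cross n m (m - j - 1) (0\<^sub>m n n) (A j)) (filter s [1..<m]))
    = map (\<lambda>i. cross n m (m - i - 1) (- A' i) (0\<^sub>m n n)) (filter (\<lambda>i. s (m - i)) (rev [1..<m]))"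
    unfolding map_diff_filter[symmetric] map_map
    by (rule map_cong) (auto simp: antitranspose_cross A A'_def)
  have f2: "map antitranspose (map (\<lambda>j. cross n m (m - j - 1) (- A j) (0\<^sub>m n n)) (filter (\<lambda>j. \<not> s j) [1..<m]))
    = map (\<lambda>i. cross n m (m - i - 1) (0\<^sub>m n n) (A' i)) (filter ?s (rev [1..<m]))"
    unfolding map_diff_filter[of _ m "\<lambda>j. \<not> s j", symmetric] map_map
    by (rule map_cong) (auto simp: antitranspose_cross A A'_def antitranspose_uminus)
  have c1: "set (map (\<lambda>j. cross n m (m - j - 1) (0\<^sub>m n n) (A j)) (filter s (rev [1..<m]))) \<subseteq> carrier_mat ?N ?N"
    "set (map (\<lambda>j. cross n m (m - j - 1) (- A j) (0\<^sub>m n n)) (filter (\<lambda>j. \<not> s j) (rev [1..<m]))) \<subseteq> carrier_mat ?N ?N"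
    using m A by (auto intro!: cross_carrier)
  have r: "rev (map antitranspose (map f (filter p (rev l)))) = map antitranspose (map f (filter p l))"
    for f :: "nat \<Rightarrow> 'a mat" and p l by (simp add: rev_map rev_filter)
  have s1: "antitranspose (spot n m 0 (A m)) = spot n m (m - 1) (- A' 0)"
    using A m by (subst antitranspose_spot[of _ n]) (auto simp: A'_def)
  have s2: "antitranspose (spot n m (m - 1) (- A 0)) = spot n m 0 (A' m)"
    using A m by (subst antitranspose_spot[of _ n]) (auto simp: A'_def antitranspose_uminus)
  have n1: "antitranspose (neg_prod n s A m) = mat_prod ?N (map (\<lambda>i. cross n m (m - i - 1) (- A' i) (0\<^sub>m n n)) (filter (\<lambda>i. s (m - i)) (rev [1..<m])))"
    unfolding neg_prod_def antitranspose_mat_prod[OF c1(1)] r f1 ..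
  have n2: "antitranspose (mat_prod ?N (map (\<lambda>j. cross n m (m - j - 1) (- A j) (0\<^sub>m n n)) (filter (\<lambda>j. \<not> s j) (rev [1..<m])))) = neg_prod n ?s A' m"
    unfolding neg_prod_def antitranspose_mat_prod[OF c1(2)] r f2 ..
  have 1: "antitranspose (spot n m 0 (A m) * neg_prod n s A m) = pos_prod n ?s A' m"
    using S[of 0 "A m"] A m D(1)
    by (subst antitranspose_mult[of _ ?N ?N _ ?N]) (simp_all only: n1 s1 pos_prod_def not_not)
  have 2: "antitranspose (pos_prod n s A m) = spot n m 0 (A' m) * neg_prod n ?s A' m"
  proof -
    have "spot n m (m - 1) (- A 0) \<in> carrier_mat ?N ?N" using A m by (intro S) auto
    from antitranspose_mult[OF mat_prod_carrier[OF c1(2)] this] show ?thesis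
      unfolding pos_prod_def n2 s2 .
  qed
  have "antitranspose (\<mu> \<cdot>\<^sub>m gf_pencil n s x A m (A m))
      = \<mu> \<cdot>\<^sub>m (x \<cdot>\<^sub>m pos_prod n ?s A' m - spot n m 0 (A' m) * neg_prod n ?s A' m)"
    unfolding gf_pencil_def antitranspose_smult using D S[of 0 "A m"] A m
    by (subst antitranspose_minus[of _ ?N ?N]) (simp_all add: antitranspose_smult 1 2)
  also have "\<dots> = - gf_pencil n ?s \<mu> A' m (A' m)"
    unfolding gf_pencil_def using D S[of 0 "A' m"] A' m x
    by (intro eq_matI) (auto simp del: index_mult_mat(1) simp: algebra_simps mult.assoc[symmetric])
  finally show ?thesis .
qed

lemma permutes_less: "p permutes {0..<r} \<Longrightarrow> i < r \<Longrightarrow> p i < (r::nat)"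
  using permutes_in_image[of p "{0..<r}" i] by simp

context unital_subring
begin

lemma over_antitranspose: "over M \<Longrightarrow> over (antitranspose M)"
  unfolding over_def by (auto simp: antitranspose_def)

lemma kunit_antitranspose:
  assumes "kunit N U" shows "kunit N (antitranspose U)"
proof -
  obtain U' where U: "U \<in> carrier_mat N N" "over U" "U' \<in> carrier_mat N N" "over U'" "U * U' = 1\<^sub>m N" "U' * U = 1\<^sub>m N"
    using assms by (auto simp: kunit_def)
  then show ?thesis
    by (intro kunitI[of _ _ "antitranspose U'"]) (auto intro!: over_antitranspose simp flip: antitranspose_mult)
qed

text \<open>
  Reflection leaves the nontrivial block first; these permutations put it last.
\<close>
lemma block_swap:
  assumes "Z \<in> carrier_mat n n"
  defines "P \<equiv> \<lambda>a b. four_block_mat (0\<^sub>m a b) (1\<^sub>m a) (1\<^sub>m b) (0\<^sub>m b a) :: 'a mat"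
  shows "P k n * dsum Z (1\<^sub>m k) * P n k = dsum (1\<^sub>m k) Z" "kunit (n + k) (P k n)" "kunit (n + k) (P n k)"
proof -
  have inv: "P a b * P b a = 1\<^sub>m (a + b)" for a b
    unfolding P_def by (subst mult_four_block_mat[of _ a b _ a _ b _ _ a _ b]) auto
  have c: "P a b \<in> carrier_mat (a + b) (a + b)" for a b unfolding P_def by (auto simp: add.commute)
  have o: "over (P a b)" for a b unfolding P_def by (auto simp: over_def K_zero K_one)
  have "P k n * dsum Z (1\<^sub>m k) = four_block_mat (0\<^sub>m k n) (1\<^sub>m k) Z (0\<^sub>m n k)"
    unfolding P_def dsum_def using assms(1)
    by (subst mult_four_block_mat[of _ k n _ k _ n _ _ n _ k]) (auto intro!: cong_four_block_mat)
  then show "P k n * dsum Z (1\<^sub>m k) * P n k = dsum (1\<^sub>m k) Z"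
    using assms(1) unfolding dsum_def[of "1\<^sub>m k"]
    by (simp add: P_def) (subst mult_four_block_mat[of _ k n _ k _ n _ _ k _ n], auto intro!: cong_four_block_mat)
  show "kunit (n + k) (P k n)" "kunit (n + k) (P n k)"
    using inv[of n k] inv[of k n] c[of n k] c[of k n] o
    by (auto intro: kunitI[of "P k n" _ "P n k"] kunitI[of "P n k" _ "P k n"] simp: add.commute)
qed

text \<open>
  Here only \<open>\<mu> = x\<inverse>\<close>, and not \<open>x\<close>, has to lie in \<open>K\<close>. The reflected pencil is reduced by \<open>gf_pencil_horner\<close> to the
  reversed polynomial \<open>\<mu>\<^sup>m P(x)\<close>, and the transformations are reflected back.
\<close>
theorem gf_pencil_reversed_horner:
  assumes m: "1 \<le> m" and A: "\<And>j. j \<le> m \<Longrightarrow> A j \<in> carrier_mat n n \<and> over (A j)"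
    and x: "x * \<mu> = 1" and \<mu>: "\<mu> \<in> K"
  shows "\<exists>U V. kunit (m * n) U \<and> kunit (m * n) V \<and>
     U * (\<mu> \<cdot>\<^sub>m gf_pencil n s x A m (A m)) * V = dsum (1\<^sub>m ((m - 1) * n)) (\<mu> ^ m \<cdot>\<^sub>m horner x A m (A m))"
proof -
  let ?N = "m * n" and ?s = "\<lambda>i. \<not> s (m - i)" and ?k = "(m - 1) * n"
  have N: "n + ?k = ?N" using m by (cases m) auto
  define A' where "A' = (\<lambda>i. - antitranspose (A (m - i)))"
  define T where "T = \<mu> \<cdot>\<^sub>m gf_pencil n s x A m (A m)"
  define R where "R = \<mu> ^ m \<cdot>\<^sub>m horner x A m (A m)"
  have A': "A' j \<in> carrier_mat n n \<and> over (A' j)" for j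
    using A by (auto simp: A'_def intro!: over_uminus over_antitranspose)
  have h: "horner x A m (A m) \<in> carrier_mat n n" using A by (intro horner_sum) auto
  then have R: "R \<in> carrier_mat n n" by (simp add: R_def)
  have T: "T \<in> carrier_mat ?N ?N"
    unfolding T_def gf_pencil_def using A m by (intro smult_carrier_mat minus_carrier_mat pos_prod_carrier) auto
  have hh: "horner \<mu> A' m (A' m) = - antitranspose R"
  proof (rule eq_matI)
    have h': "horner \<mu> A' m (A' m) \<in> carrier_mat n n" using A' by (intro horner_sum) auto
    fix i j assume "i < dim_row (- antitranspose R)" "j < dim_col (- antitranspose R)"
    then have ij: "i < n" "j < n" using R by auto
    let ?i = "n - Suc j" and ?j = "n - Suc i"
    have ij': "?i < n" "?j < n" using ij by auto
    have a': "A' k $$ (i, j) = - A (m - k) $$ (?i, ?j)" for k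
      using A[of "m - k"] ij by (auto simp: A'_def antitranspose_index[of _ n n])
    have "horner \<mu> A' m (A' m) $$ (i, j) = \<mu> ^ m * A' m $$ (i, j) + (\<Sum>k<m. \<mu> ^ k * A' k $$ (i, j))"
      using A' ij by (intro horner_sum) auto
    also have "\<dots> = (\<Sum>k<Suc m. \<mu> ^ k * A' k $$ (i, j))" by simp
    also have "\<dots> = (\<Sum>k<Suc m. \<mu> ^ (m - k) * A' (m - k) $$ (i, j))"
      by (subst sum.nat_diff_reindex[symmetric]) simp
    also have "\<dots> = (\<Sum>k<Suc m. - (\<mu> ^ m * (x ^ k * A k $$ (?i, ?j))))"
    proof (rule sum.cong)
      fix k assume "k \<in> {..<Suc m}"
      then have k: "k \<le> m" by simp
      have "\<mu> ^ m * x ^ k = \<mu> ^ (m - k) * (\<mu> * x) ^ k"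
        using k by (simp add: power_mult_distrib mult.assoc flip: power_add) (metis le_add_diff_inverse2 mult.assoc power_add)
      also have "\<dots> = \<mu> ^ (m - k)" using x by (simp add: mult.commute)
      finally show "\<mu> ^ (m - k) * A' (m - k) $$ (i, j) = - (\<mu> ^ m * (x ^ k * A k $$ (?i, ?j)))"
        unfolding a' using k by (simp add: mult.assoc[symmetric])
    qed simp
    also have "\<dots> = - (\<mu> ^ m * (\<Sum>k<Suc m. x ^ k * A k $$ (?i, ?j)))"
      by (simp only: sum_negf sum_distrib_left)
    also have "(\<Sum>k<Suc m. x ^ k * A k $$ (?i, ?j)) = horner x A m (A m) $$ (?i, ?j)"
      using A ij' by (subst horner_sum(2)[of _ n]) auto
    also have "- (\<mu> ^ m * \<dots>) = (- antitranspose R) $$ (i, j)"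
      using h R ij by (auto simp: antitranspose_index[of _ n n] R_def)
    finally show "horner \<mu> A' m (A' m) $$ (i, j) = (- antitranspose R) $$ (i, j)" .
  qed (use R A' in \<open>auto simp: horner_sum(1)[of _ n, THEN carrier_matD(1)] horner_sum(1)[of _ n, THEN carrier_matD(2)]\<close>)
  have tT: "antitranspose T = - gf_pencil n ?s \<mu> A' m (A' m)"
    unfolding T_def A'_def using gf_pencil_antitranspose[OF m _ x, of A n s] A by auto
  obtain U V where UV: "kunit ?N U" "kunit ?N V"
    "U * gf_pencil n ?s \<mu> A' m (A' m) * V = dsum (1\<^sub>m ?k) (- antitranspose R)"
    using gf_pencil_horner[of m A' n "A' m" \<mu> ?s] m A' \<mu> unfolding hh by blast
  have c: "U \<in> carrier_mat ?N ?N" "V \<in> carrier_mat ?N ?N" using UV by (auto dest: kunit_carrier)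
  have gc: "gf_pencil n ?s \<mu> A' m (A' m) \<in> carrier_mat ?N ?N"
    unfolding gf_pencil_def using A' m by (intro minus_carrier_mat pos_prod_carrier) auto
  have "U * antitranspose T * V = - (dsum (1\<^sub>m ?k) (- antitranspose R))"
    unfolding tT UV(3)[symmetric] using c gc by simp
  also have "\<dots> = dsum (- 1\<^sub>m ?k) (antitranspose R)" using R by (intro eq_matI) auto
  finally have e: "U * antitranspose T * V = dsum (- 1\<^sub>m ?k) (antitranspose R)" .
  have "antitranspose V * T * antitranspose U = antitranspose (U * antitranspose T * V)"
  proof -
    have tT: "antitranspose T \<in> carrier_mat ?N ?N" using T by simp
    show ?thesis
      unfolding antitranspose_mult[OF mult_carrier_mat[OF c(1) tT] c(2)] antitranspose_mult[OF c(1) tT]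
      using c T by (simp add: assoc_mult_mat[of _ ?N ?N _ ?N _ ?N])
  qed
  also have "\<dots> = dsum R (- 1\<^sub>m ?k)"
    unfolding e using R by (subst antitranspose_dsum[of _ ?k _ n]) (auto simp: antitranspose_uminus)
  finally have e2: "antitranspose V * T * antitranspose U = dsum R (- 1\<^sub>m ?k)" .
  \<comment> \<open>the two signs from the reflection leave \<open>- I\<close> in place of \<open>I\<close>\<close>
  define F where "F = dsum (1\<^sub>m n) (- 1\<^sub>m ?k :: 'a mat)"
  have m1: "- 1\<^sub>m ?k * - 1\<^sub>m ?k = (1\<^sub>m ?k :: 'a mat)"
    by (subst uminus_mult_left_mat; (subst uminus_mult_right_mat)?) auto
  have F: "kunit ?N F" "F \<in> carrier_mat ?N ?N"
  proof -
    show c: "F \<in> carrier_mat ?N ?N" unfolding F_def N[symmetric] by (intro dsum_carrier) auto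
    have "F * F = 1\<^sub>m ?N" unfolding F_def
      by (subst dsum_mult[of _ n n _ n _ ?k ?k _ ?k]) (auto simp: m1 dsum_one N simp del: One_nat_def)
    then show "kunit ?N F" using c by (intro kunitI[of F _ F]) (auto simp: F_def intro!: over_dsum over_uminus)
  qed
  define P where "P = (\<lambda>a b. four_block_mat (0\<^sub>m a b) (1\<^sub>m a) (1\<^sub>m b) (0\<^sub>m b a) :: 'a mat)"
  have bs: "P ?k n * dsum R (1\<^sub>m ?k) * P n ?k = dsum (1\<^sub>m ?k) R" "kunit ?N (P ?k n)" "kunit ?N (P n ?k)"
    unfolding P_def using block_swap[OF R, of ?k] unfolding N by blast+
  note bc = bs(2,3)[THEN kunit_carrier]
  have FR: "F * dsum R (- 1\<^sub>m ?k) = dsum R (1\<^sub>m ?k)"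
    unfolding F_def using R by (subst dsum_mult[of _ n n _ n _ ?k ?k _ ?k]) (auto simp: m1)
  have tc: "antitranspose V \<in> carrier_mat ?N ?N" "antitranspose U \<in> carrier_mat ?N ?N" using c by auto
  have "(P ?k n * F * antitranspose V) * T * (antitranspose U * P n ?k)
     = P ?k n * (F * (antitranspose V * T * antitranspose U)) * P n ?k"
    using bc F(2) tc T by (simp add: assoc_mult_mat[of _ ?N ?N _ ?N _ ?N])
  also have "\<dots> = dsum (1\<^sub>m ?k) R" unfolding e2 FR by (rule bs(1))
  finally have "(P ?k n * F * antitranspose V) * T * (antitranspose U * P n ?k) = dsum (1\<^sub>m ?k) R" .
  then show ?thesis
    using bs(2,3) F(1) kunit_antitranspose[OF UV(1)] kunit_antitranspose[OF UV(2)]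
    unfolding T_def R_def by (intro exI conjI) (auto intro!: kunit_mult)
qed

lemma det_in_subring:
  assumes "M \<in> carrier_mat r r" "over M" shows "det M \<in> K"
proof -
  have "signof p \<in> K" for p using signof_pm_one[of p, where 'a = 'a] K_one K_uminus[OF K_one] by auto
  then show ?thesis
    unfolding det_def'[OF assms(1)] using assms
    by (auto simp: over_def permutes_less intro!: K_sum K_mult K_prod)
qed

text \<open>
  By the adjugate, whose entries are determinants of submatrices and so lie in \<open>K\<close>.
\<close>
lemma kunit_if_det:
  assumes M: "M \<in> carrier_mat r r" "over M" and d: "det M * d = 1" "d \<in> K"
  shows "kunit r M"
proof (rule kunitI[of _ _ "d \<cdot>\<^sub>m adj_mat M"])
  note a = adj_mat[OF M(1)]
  have "mat_delete M i j \<in> carrier_mat (r - 1) (r - 1)" "over (mat_delete M i j)" if "i < r" "j < r" for i j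
    using M that by (auto simp: over_def mat_delete_def)
  then have "det (mat_delete M i j) \<in> K" if "i < r" "j < r" for i j
    using that by (intro det_in_subring) auto
  then show "over (d \<cdot>\<^sub>m adj_mat M)"
    using M d(2) unfolding over_def adj_mat_def cofactor_def
    by (auto intro!: K_mult K_power K_uminus K_one)
  show "M * (d \<cdot>\<^sub>m adj_mat M) = 1\<^sub>m r" "d \<cdot>\<^sub>m adj_mat M * M = 1\<^sub>m r"
    using a M d by (auto simp: mult_smult_distrib[of _ r r _ r] mult_smult_assoc_mat[of _ r r _ r] mult.commute intro!: eq_matI)
qed (use M adj_mat(1)[OF M(1)] in auto)

end

section \<open>Proper rational functions\<close>

lemma at_infinity_complex_nontrivial: "(at_infinity :: complex filter) \<noteq> bot"
proof
  assume "(at_infinity :: complex filter) = bot"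
  then have "eventually (\<lambda>_. False) (at_infinity :: complex filter)" by simp
  then obtain b where "\<forall>z::complex. b \<le> norm z \<longrightarrow> False" unfolding eventually_at_infinity by blast
  from this[rule_format, of "of_real b"] show False using abs_ge_self[of b] by (simp add: norm_of_real)
qed

lemma eventually_poly_nonzero:
  fixes p :: "complex poly"
  assumes "p \<noteq> 0" shows "eventually (\<lambda>z::complex. poly p z \<noteq> 0) at_infinity"
proof -
  have "finite {z. poly p z = 0}" using poly_roots_finite[OF assms] .
  then have f: "finite (norm ` {z. poly p z = 0})" by simp
  show ?thesis unfolding eventually_at_infinity
  proof (intro exI allI impI)
    fix z :: complex assume z: "Max (insert 0 (norm ` {z. poly p z = 0})) + 1 \<le> norm z"
    show "poly p z \<noteq> 0"
    proof
      assume "poly p z = 0"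
      then have "norm z \<le> Max (insert 0 (norm ` {z. poly p z = 0}))" using f by (intro Max_ge) auto
      then show False using z by simp
    qed
  qed
qed

text \<open>
  The evaluation of a fraction uses one chosen representation. Two representations agree wherever
  their denominators do not vanish, hence near infinity.
\<close>
lemma rat_eval_Fract:
  assumes "b \<noteq> 0"
  shows "eventually (\<lambda>z. rat_eval (Fract a b) z = poly a z / poly b z) at_infinity"
proof -
  let ?q = "quot_of_fract (Fract a b)"
  have "Fract (fst ?q) (snd ?q) = Fract a b" by simp
  then have e: "fst ?q * b = a * snd ?q"
    using assms snd_quot_of_fract_nonzero[of "Fract a b"] by (subst (asm) eq_fract) auto
  have "eventually (\<lambda>z. poly b z \<noteq> 0 \<and> poly (snd ?q) z \<noteq> 0) at_infinity"
    using assms by (intro eventually_conj eventually_poly_nonzero) auto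
  then show ?thesis
  proof eventually_elim
    case (elim z)
    have "poly (fst ?q) z * poly b z = poly a z * poly (snd ?q) z"
      using arg_cong[OF e, of "\<lambda>p. poly p z"] by simp
    then show ?case using elim by (simp add: rat_eval_def field_simps)
  qed
qed

lemma rat_eval_diff: "eventually (\<lambda>z. rat_eval (f - g) z = rat_eval f z - rat_eval g z) at_infinity"
proof -
  obtain a b c d where f: "f = Fract a b" "b \<noteq> 0" and g: "g = Fract c d" "d \<noteq> 0"
    by (metis Fract_cases)
  have s: "f - g = Fract (a * d - c * b) (b * d)" using f g by simp
  have "b * d \<noteq> 0" using f g by simp
  from rat_eval_Fract[OF this, of "a * d - c * b"] rat_eval_Fract[OF f(2), of a] rat_eval_Fract[OF g(2), of c]
    eventually_poly_nonzero[OF f(2)] eventually_poly_nonzero[OF g(2)]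
  show ?thesis unfolding s unfolding f(1) g(1) by eventually_elim (simp add: diff_frac_eq)
qed

lemma rat_eval_mult: "eventually (\<lambda>z. rat_eval (f * g) z = rat_eval f z * rat_eval g z) at_infinity"
proof -
  obtain a b c d where f: "f = Fract a b" "b \<noteq> 0" and g: "g = Fract c d" "d \<noteq> 0"
    by (metis Fract_cases)
  have s: "f * g = Fract (a * c) (b * d)" using f g by simp
  have "b * d \<noteq> 0" using f g by simp
  from rat_eval_Fract[OF this, of "a * c"] rat_eval_Fract[OF f(2), of a] rat_eval_Fract[OF g(2), of c]
  show ?thesis unfolding s unfolding f(1) g(1) by eventually_elim simp
qed

text \<open>
  The functions with a finite limit at infinity form a subring, and the limit is a ring homomorphism on it.
\<close>
definition proper_fracts :: "complex poly fract set" where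
  "proper_fracts = {f. \<exists>l. (rat_eval f \<longlongrightarrow> l) at_infinity}"

definition limit_at_infinity :: "complex poly fract \<Rightarrow> complex" where
  "limit_at_infinity f = Lim at_infinity (rat_eval f)"

lemma proper_limit: "f \<in> proper_fracts \<Longrightarrow> (rat_eval f \<longlongrightarrow> limit_at_infinity f) at_infinity"
  unfolding proper_fracts_def limit_at_infinity_def
  using tendsto_Lim[OF at_infinity_complex_nontrivial] by fastforce

lemma limit_at_infinity_eqI: "(rat_eval f \<longlongrightarrow> l) at_infinity \<Longrightarrow> limit_at_infinity f = l"
  unfolding limit_at_infinity_def by (rule tendsto_Lim[OF at_infinity_complex_nontrivial])

lemma proper_fractI: "(rat_eval f \<longlongrightarrow> l) at_infinity \<Longrightarrow> f \<in> proper_fracts"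
  unfolding proper_fracts_def by blast

lemma rat_eval_to_fract: "rat_eval (to_fract p) z = poly p z"
  by (simp add: rat_eval_def quot_of_fract_to_fract)

lemma const_limit: "(rat_eval (to_fract [:c:]) \<longlongrightarrow> c) at_infinity"
proof -
  have "rat_eval (to_fract [:c:]) = (\<lambda>_. c)" by (rule ext) (simp add: rat_eval_to_fract)
  then show ?thesis by simp
qed

lemma diff_limit:
  assumes "f \<in> proper_fracts" "g \<in> proper_fracts"
  shows "(rat_eval (f - g) \<longlongrightarrow> limit_at_infinity f - limit_at_infinity g) at_infinity"
  using tendsto_diff[OF proper_limit[OF assms(1)] proper_limit[OF assms(2)]]
  by (rule Lim_transform_eventually) (use rat_eval_diff[of f g] in \<open>auto elim: eventually_mono\<close>)

lemma mult_limit: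
  assumes "f \<in> proper_fracts" "g \<in> proper_fracts"
  shows "(rat_eval (f * g) \<longlongrightarrow> limit_at_infinity f * limit_at_infinity g) at_infinity"
  using tendsto_mult[OF proper_limit[OF assms(1)] proper_limit[OF assms(2)]]
  by (rule Lim_transform_eventually) (use rat_eval_mult[of f g] in \<open>auto elim: eventually_mono\<close>)

lemma one_limit: "(rat_eval 1 \<longlongrightarrow> 1) at_infinity"
  using const_limit[of 1] by (simp add: one_pCons[symmetric])

lemma zero_limit: "(rat_eval 0 \<longlongrightarrow> 0) at_infinity"
  using const_limit[of 0] by simp

interpretation proper: unital_subring proper_fracts
  by standard (auto intro: proper_fractI[OF one_limit] proper_fractI[OF diff_limit] proper_fractI[OF mult_limit])

lemma limit_simps [simp]:
  "limit_at_infinity 1 = 1" "limit_at_infinity 0 = 0" "limit_at_infinity (to_fract [:c:]) = c"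
  "f \<in> proper_fracts \<Longrightarrow> g \<in> proper_fracts \<Longrightarrow> limit_at_infinity (f - g) = limit_at_infinity f - limit_at_infinity g"
  "f \<in> proper_fracts \<Longrightarrow> g \<in> proper_fracts \<Longrightarrow> limit_at_infinity (f * g) = limit_at_infinity f * limit_at_infinity g"
  by (auto intro!: limit_at_infinity_eqI one_limit zero_limit const_limit diff_limit mult_limit)

lemma limit_uminus [simp]: "f \<in> proper_fracts \<Longrightarrow> limit_at_infinity (- f) = - limit_at_infinity f"
  using limit_simps(4)[of 0 f] proper.K_zero by simp

lemma limit_add [simp]: "f \<in> proper_fracts \<Longrightarrow> g \<in> proper_fracts \<Longrightarrow> limit_at_infinity (f + g) = limit_at_infinity f + limit_at_infinity g"
  using limit_simps(4)[of f "- g"] proper.K_uminus by simp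

lemma limit_sum: "(\<And>i. i \<in> I \<Longrightarrow> f i \<in> proper_fracts) \<Longrightarrow>
  limit_at_infinity (sum f I) = (\<Sum>i\<in>I. limit_at_infinity (f i))"
  by (induction I rule: infinite_finite_induct) (auto simp: proper.K_sum)

lemma limit_prod: "(\<And>i. i \<in> I \<Longrightarrow> f i \<in> proper_fracts) \<Longrightarrow>
  limit_at_infinity (prod f I) = (\<Prod>i\<in>I. limit_at_infinity (f i))"
  by (induction I rule: infinite_finite_induct) (auto simp: proper.K_prod)

lemma const_proper [simp]: "to_fract [:c:] \<in> proper_fracts"
  by (rule proper_fractI[OF const_limit])

lemma limit_mult_mat:
  assumes "M \<in> carrier_mat a b" "M' \<in> carrier_mat b c" "proper.over M" "proper.over M'"
  shows "map_mat limit_at_infinity (M * M') = map_mat limit_at_infinity M * map_mat limit_at_infinity M'"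
proof (rule eq_matI)
  fix i j assume "i < dim_row (map_mat limit_at_infinity M * map_mat limit_at_infinity M')"
    "j < dim_col (map_mat limit_at_infinity M * map_mat limit_at_infinity M')"
  then have ij: "i < a" "j < c" using assms by auto
  have p: "M $$ (i, k) \<in> proper_fracts" "M' $$ (k, j) \<in> proper_fracts" if "k < b" for k
    using assms that ij by (auto simp: proper.over_def)
  have "map_mat limit_at_infinity (M * M') $$ (i, j) = limit_at_infinity (\<Sum>k<b. M $$ (i, k) * M' $$ (k, j))"
    using assms ij mat_mult_index_sum[OF assms(1,2) ij] by simp
  also have "\<dots> = (\<Sum>k<b. limit_at_infinity (M $$ (i, k)) * limit_at_infinity (M' $$ (k, j)))"
    using p by (subst limit_sum) (auto intro: proper.K_mult)
  also have "\<dots> = (map_mat limit_at_infinity M * map_mat limit_at_infinity M') $$ (i, j)"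
    using assms ij by (subst mat_mult_index_sum[of _ a b _ c]) auto
  finally show "map_mat limit_at_infinity (M * M') $$ (i, j)
    = (map_mat limit_at_infinity M * map_mat limit_at_infinity M') $$ (i, j)" .
qed (use assms in auto)

text \<open>
  The limit homomorphism maps an inverse pair to an inverse pair.
\<close>
lemma kunit_biproper:
  assumes "proper.kunit N U" shows "biproper N U"
proof -
  obtain U' where U: "U \<in> carrier_mat N N" "proper.over U" "U' \<in> carrier_mat N N" "proper.over U'" "U * U' = 1\<^sub>m N" "U' * U = 1\<^sub>m N"
    using assms by (auto simp: proper.kunit_def)
  let ?l = "map_mat limit_at_infinity"
  have one: "?l (1\<^sub>m N) = 1\<^sub>m N" by (intro eq_matI) auto
  have "?l U * ?l U' = 1\<^sub>m N" "?l U' * ?l U = 1\<^sub>m N"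
    using limit_mult_mat[OF U(1,3,2,4)] limit_mult_mat[OF U(3,1,4,2)] unfolding U(5,6) one by auto
  then have "invertible_mat (?l U)" using U by (intro invertible_matI[of _ N "?l U'"]) auto
  then show ?thesis unfolding biproper_def using U
    by (intro conjI bexI[of _ "?l U"]) (auto simp: proper.over_def intro!: proper_limit)
qed

text \<open>
  The limit of the determinant is the determinant of the limit, hence nonzero, so that the inverse of the determinant
  is again proper.
\<close>
lemma kunit_of_invertible_limit:
  assumes M: "M \<in> carrier_mat r r" "proper.over M" and inv: "invertible_mat (map_mat limit_at_infinity M)"
  shows "proper.kunit r M"
proof -
  let ?l = limit_at_infinity
  have sg: "signof p \<in> proper_fracts \<and> ?l (signof p) = signof p" for p
    using signof_pm_one[of p, where 'a = "complex poly fract"]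
    by (auto simp: proper.K_one sign_def intro: proper.K_uminus)
  have p: "M $$ (i, k) \<in> proper_fracts" if "i < r" "k < r" for i k
    using M that by (auto simp: proper.over_def)
  have "?l (det M) = det (map_mat ?l M)"
  proof -
    have "?l (det M) = (\<Sum>q | q permutes {0..<r}. ?l (signof q * (\<Prod>i = 0..<r. M $$ (i, q i))))"
      unfolding det_def'[OF M(1)] using sg p
      by (intro limit_sum) (auto intro!: proper.K_mult proper.K_prod simp: permutes_less)
    also have "\<dots> = (\<Sum>q | q permutes {0..<r}. signof q * (\<Prod>i = 0..<r. map_mat ?l M $$ (i, q i)))"
    proof (rule sum.cong)
      fix q assume "q \<in> {q. q permutes {0..<r}}"
      then have q: "q i < r" if "i < r" for i using that permutes_less by auto
      have "?l (signof q * (\<Prod>i = 0..<r. M $$ (i, q i))) = signof q * ?l (\<Prod>i = 0..<r. M $$ (i, q i))"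
        using sg[of q] p q by (subst limit_simps(5)) (auto intro!: proper.K_prod)
      also have "?l (\<Prod>i = 0..<r. M $$ (i, q i)) = (\<Prod>i = 0..<r. ?l (M $$ (i, q i)))"
        using p q by (intro limit_prod) auto
      also have "\<dots> = (\<Prod>i = 0..<r. map_mat ?l M $$ (i, q i))"
        using M q by (intro prod.cong) auto
      finally show "?l (signof q * (\<Prod>i = 0..<r. M $$ (i, q i))) = signof q * (\<Prod>i = 0..<r. map_mat ?l M $$ (i, q i))" .
    qed simp
    also have "\<dots> = det (map_mat ?l M)" using M by (intro det_def'[symmetric]) auto
    finally show ?thesis .
  qed
  moreover have "det (map_mat ?l M) \<noteq> 0"
    using invertible_mat_obtain_inverse[OF inv, of r] M
    by (metis det_mult det_one map_carrier_mat mult_zero_left zero_neq_one)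
  ultimately have l: "?l (det M) \<noteq> 0" by simp
  have dp: "det M \<in> proper_fracts" using proper.det_in_subring[OF M] .
  have d0: "det M \<noteq> 0" using l by auto
  have ev: "eventually (\<lambda>z. rat_eval (det M) z \<noteq> 0) at_infinity"
    using tendsto_imp_eventually_ne[OF proper_limit[OF dp] l] .
  have "eventually (\<lambda>z. inverse (rat_eval (det M) z) = rat_eval (inverse (det M)) z) at_infinity"
  proof -
    have "eventually (\<lambda>z. rat_eval (det M * inverse (det M)) z = rat_eval (det M) z * rat_eval (inverse (det M)) z) at_infinity"
      by (rule rat_eval_mult)
    then show ?thesis using ev
    proof eventually_elim
      case (elim z)
      have "rat_eval (det M * inverse (det M)) z = 1"
        using d0 rat_eval_to_fract[of 1 z] by simp
      then show ?case using elim by (simp add: field_simps)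
    qed
  qed
  then have "(rat_eval (inverse (det M)) \<longlongrightarrow> inverse (?l (det M))) at_infinity"
    by (rule Lim_transform_eventually[OF tendsto_inverse[OF proper_limit[OF dp] l], rotated])
  then have "inverse (det M) \<in> proper_fracts" by (rule proper_fractI)
  then show ?thesis using M d0 by (intro proper.kunit_if_det[of _ _ "inverse (det M)"]) auto
qed

section \<open>Rank and kernel\<close>

lemma invertible_mat_if_det:
  fixes M :: "'a::field mat"
  assumes "M \<in> carrier_mat r r" "det M \<noteq> 0"
  obtains M' where "M' \<in> carrier_mat r r" "M * M' = 1\<^sub>m r" "M' * M = 1\<^sub>m r"
proof -
  interpret unital_subring "UNIV :: 'a set" by standard auto
  have "kunit r M" using assms by (intro kunit_if_det[of _ _ "inverse (det M)"]) (auto simp: over_def)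
  then show ?thesis using that by (auto simp: kunit_def)
qed

lemma rank_eq_dim_col_if_kernel_trivial:
  fixes M :: "'a::field mat"
  assumes M: "M \<in> carrier_mat N r" and ker: "\<And>v. v \<in> carrier_vec r \<Longrightarrow> M *\<^sub>v v = 0\<^sub>v N \<Longrightarrow> v = 0\<^sub>v r"
  shows "vec_space.rank N M = r"
proof -
  interpret vec_space "TYPE('a)" N .
  have d: "distinct (cols M)" unfolding distinct_conv_nth
  proof (intro allI impI)
    fix i j assume ij: "i < length (cols M)" "j < length (cols M)" "i \<noteq> j"
    then have ij': "i < r" "j < r" using M by auto
    show "cols M ! i \<noteq> cols M ! j"
    proof
      assume "cols M ! i = cols M ! j"
      then have e: "col M i = col M j" using ij by simp
      let ?v = "unit_vec r i - unit_vec r j :: 'a vec"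
      have "M *\<^sub>v ?v = M *\<^sub>v unit_vec r i - M *\<^sub>v unit_vec r j"
        using M by (intro mult_minus_distrib_mat_vec) auto
      also have "\<dots> = 0\<^sub>v N" using M ij' e by (auto simp: col_def vec_eq_iff intro!: eq_vecI)
      finally have "?v = 0\<^sub>v r" using ker by auto
      then have "?v $ i = 0" using ij' by simp
      then show False using ij' ij(3) by simp
    qed
  qed
  have "lin_indpt (set (cols M))" using lin_depE[OF M _ d] ker by blast
  then show ?thesis using lin_indpt_full_rank[OF M d] by blast
qed

text \<open>
  A right inverse of \<open>M\<close> is obtained from the Gram matrix \<open>M M\<^sup>*\<close>, which is nonsingular because
  \<open>v\<^sup>* M M\<^sup>* v\<close> is the squared norm of \<open>M\<^sup>* v\<close>.
\<close>
lemma rank_eq_dim_row_if_left_kernel_trivial: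
  fixes M :: "complex mat"
  assumes M: "M \<in> carrier_mat r c" and ker: "\<And>v. v \<in> carrier_vec r \<Longrightarrow> transpose_mat M *\<^sub>v v = 0\<^sub>v c \<Longrightarrow> v = 0\<^sub>v r"
  shows "vec_space.rank r M = r"
proof -
  interpret vec_space "TYPE(complex)" r .
  define H where "H = transpose_mat (map_mat cnj M)"
  have H: "H \<in> carrier_mat c r" using M by (auto simp: H_def)
  have cnj_mult: "map_vec cnj (Q *\<^sub>v v) = map_mat cnj Q *\<^sub>v map_vec cnj v" if "Q \<in> carrier_mat a b" "v \<in> carrier_vec b"
    for Q :: "complex mat" and v a b
    using that by (intro eq_vecI) (auto simp: scalar_prod_def)
  have "det (M * H) \<noteq> 0"
  proof
    assume "det (M * H) = 0"
    then obtain v where v: "v \<in> carrier_vec r" "v \<noteq> 0\<^sub>v r" "(M * H) *\<^sub>v v = 0\<^sub>v r"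
      using det_0_iff_vec_prod_zero_field[of "M * H" r] M H by auto
    define w where "w = H *\<^sub>v v"
    have w: "w \<in> carrier_vec c" using H v by (auto simp: w_def)
    have cw: "map_vec cnj w = transpose_mat M *\<^sub>v map_vec cnj v"
    proof -
      have "map_mat cnj H = transpose_mat M" by (intro eq_matI) (auto simp: H_def)
      then show ?thesis unfolding w_def using cnj_mult[OF H v(1)] by simp
    qed
    have Mw: "M *\<^sub>v w = 0\<^sub>v r" using v(3) M H v(1) unfolding w_def by (simp add: assoc_mult_mat_vec[of _ r c _ r])
    have "map_vec cnj w \<bullet> w = map_vec cnj v \<bullet> (M *\<^sub>v w)"
      unfolding cw using M w v(1) by (intro transpose_vec_mult_scalar) auto
    also have "\<dots> = 0" unfolding Mw using v(1) by simp
    finally have "(\<Sum>i<c. cnj (w $ i) * w $ i) = 0" using w by (simp add: scalar_prod_def atLeast0LessThan)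
    then have "complex_of_real (\<Sum>i<c. (cmod (w $ i))\<^sup>2) = 0"
      by (simp add: complex_norm_square mult.commute del: of_real_power)
    then have "(\<Sum>i<c. (cmod (w $ i))\<^sup>2) = 0" using of_real_eq_0_iff by blast
    then have "\<forall>i<c. (cmod (w $ i))\<^sup>2 = 0" by (subst (asm) sum_nonneg_eq_0_iff) auto
    then have "w = 0\<^sub>v c" using w by (intro eq_vecI) auto
    then have "transpose_mat M *\<^sub>v map_vec cnj v = 0\<^sub>v c" unfolding cw[symmetric] by (auto intro!: eq_vecI)
    then have z: "map_vec cnj v = 0\<^sub>v r" using ker[of "map_vec cnj v"] v(1) by auto
    have "v = 0\<^sub>v r"
    proof (rule eq_vecI)
      fix i assume "i < dim_vec (0\<^sub>v r)"
      then show "v $ i = 0\<^sub>v r $ i" using arg_cong[OF z, of "\<lambda>u::complex vec. u $ i"] v(1) by simp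
    qed (use v(1) in simp)
    then show False using v(2) by simp
  qed
  then obtain R where R: "R \<in> carrier_mat r r" "M * H * R = 1\<^sub>m r"
    using invertible_mat_if_det[of "M * H" r] M H by auto
  have "span (set (cols M)) = carrier_vec r"
  proof -
    have "\<exists>x\<in>carrier_vec c. M *\<^sub>v x = y" if y: "y \<in> carrier_vec r" for y
    proof
      show "H *\<^sub>v (R *\<^sub>v y) \<in> carrier_vec c" using H R y by auto
      have "M *\<^sub>v (H *\<^sub>v (R *\<^sub>v y)) = (M * H * R) *\<^sub>v y"
        using M H R(1) y by (simp add: assoc_mult_mat_vec[of _ r c _ r] assoc_mult_mat_vec[of _ r r _ r])
      then show "M *\<^sub>v (H *\<^sub>v (R *\<^sub>v y)) = y" using R y by simp
    qed
    then show ?thesis using col_space_eq[OF M] M unfolding col_space_def by auto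
  qed
  then have "span_vs (set (cols M)) = V" by (simp add: module_vec_def)
  then show ?thesis unfolding rank_def using dim_is_n by simp
qed

section \<open>Constant matrices and the transfer function\<close>

definition const_rat :: "complex mat \<Rightarrow> complex poly fract mat" where
  "const_rat M = map_mat (\<lambda>c. to_fract [:c:]) M"

lemma rat_const_mat: "rat_mat (const_mat M) = const_rat M"
  by (auto simp: rat_mat_def const_mat_def const_rat_def)

interpretation const_hom: comm_ring_hom "\<lambda>c::complex. [:c:]"
  by unfold_locales (auto simp: one_pCons)

interpretation fract_hom: comm_ring_hom "to_fract :: complex poly \<Rightarrow> _"
  by unfold_locales auto

interpretation const_rat_hom: comm_ring_hom "\<lambda>c::complex. to_fract [:c:]"
  by unfold_locales (auto simp: one_pCons[symmetric] simp flip: to_fract_add to_fract_mult)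

lemma const_rat_dims [simp]: "dim_row (const_rat M) = dim_row M" "dim_col (const_rat M) = dim_col M"
  by (auto simp: const_rat_def)
lemma const_rat_carrier [simp]: "const_rat M \<in> carrier_mat a b \<longleftrightarrow> M \<in> carrier_mat a b"
  by (auto simp: const_rat_def)
lemma const_rat_mult: "M \<in> carrier_mat a b \<Longrightarrow> N \<in> carrier_mat b c \<Longrightarrow> const_rat (M * N) = const_rat M * const_rat N"
  unfolding const_rat_def by (rule const_rat_hom.mat_hom_mult)
lemma const_rat_one [simp]: "const_rat (1\<^sub>m k) = 1\<^sub>m k"
  unfolding const_rat_def by (rule const_rat_hom.mat_hom_one)
lemma const_rat_transpose: "transpose_mat (const_rat M) = const_rat (transpose_mat M)"
  by (auto simp: const_rat_def)
lemma const_mat_dims [simp]: "dim_row (const_mat M) = dim_row M" "dim_col (const_mat M) = dim_col M"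
  by (auto simp: const_mat_def)
lemma const_mat_carrier [simp]: "const_mat M \<in> carrier_mat a b \<longleftrightarrow> M \<in> carrier_mat a b"
  by (auto simp: const_mat_def)
lemma const_mat_mult: "M \<in> carrier_mat a b \<Longrightarrow> N \<in> carrier_mat b c \<Longrightarrow> const_mat (M * N) = const_mat M * const_mat N"
  unfolding const_mat_def by (rule const_hom.mat_hom_mult)
lemma const_mat_one [simp]: "const_mat (1\<^sub>m k) = 1\<^sub>m k"
  unfolding const_mat_def by (rule const_hom.mat_hom_one)
lemma const_mat_transpose: "transpose_mat (const_mat M) = const_mat (transpose_mat M)"
  by (auto simp: const_mat_def)
lemma const_rat_uminus: "const_rat (- M) = - const_rat M"
  by (rule eq_matI) (auto simp: const_rat_def simp flip: to_fract_uminus)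
lemma rat_mat_dims [simp]: "dim_row (rat_mat M) = dim_row M" "dim_col (rat_mat M) = dim_col M"
  by (auto simp: rat_mat_def)
lemma rat_mat_carrier [simp]: "rat_mat M \<in> carrier_mat a b \<longleftrightarrow> M \<in> carrier_mat a b"
  by (auto simp: rat_mat_def)
lemma over_const_rat [simp]: "proper.over (const_rat M)"
  by (auto simp: proper.over_def const_rat_def)

definition rat_var :: "complex poly fract" where "rat_var = to_fract [:0, 1:]"

lemma rat_var_nonzero: "rat_var \<noteq> 0"
  by (simp add: rat_var_def)

lemma inverse_rat_var_limit: "(rat_eval (inverse rat_var) \<longlongrightarrow> 0) at_infinity"
proof -
  have "inverse rat_var = Fract 1 [:0, 1:]" by (simp add: rat_var_def to_fract_def)
  then have "eventually (\<lambda>z. rat_eval (inverse rat_var) z = inverse z) at_infinity"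
    using rat_eval_Fract[of "[:0, 1:]" 1] by (auto simp: inverse_eq_divide)
  then show ?thesis
    by (intro Lim_transform_eventually[OF tendsto_inverse_0]) (auto elim: eventually_mono)
qed

lemma inverse_rat_var_proper: "inverse rat_var \<in> proper_fracts" "limit_at_infinity (inverse rat_var) = 0"
  using proper_fractI[OF inverse_rat_var_limit] limit_at_infinity_eqI[OF inverse_rat_var_limit] by auto

lemma rat_pencil:
  "rat_mat ([:0, 1:] \<cdot>\<^sub>m const_mat E - const_mat A) = rat_var \<cdot>\<^sub>m const_rat E - const_rat A"
  if "A \<in> carrier_mat r r" "E \<in> carrier_mat r r"
  using that by (intro eq_matI) (auto simp: rat_mat_def const_mat_def const_rat_def rat_var_def
      simp flip: to_fract_mult to_fract_diff)

text \<open>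
  \<open>\<lambda> E - A = \<lambda> (E - \<lambda>\<inverse> A)\<close>, and the matrix in parentheses tends to the invertible matrix \<open>E\<close>.
\<close>
lemma rat_pencil_inverse:
  assumes A: "A \<in> carrier_mat r r" and E: "E \<in> carrier_mat r r" "invertible_mat E"
  obtains R where "R \<in> carrier_mat r r" "proper.over R"
    "(rat_var \<cdot>\<^sub>m const_rat E - const_rat A) * R = 1\<^sub>m r" "R * (rat_var \<cdot>\<^sub>m const_rat E - const_rat A) = 1\<^sub>m r"
    "mat_inv (rat_mat ([:0, 1:] \<cdot>\<^sub>m const_mat E - const_mat A)) = R"
proof -
  let ?\<mu> = "inverse rat_var"
  define M where "M = const_rat E - ?\<mu> \<cdot>\<^sub>m const_rat A"
  have M: "M \<in> carrier_mat r r" using A E by (auto simp: M_def)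
  have "proper.over M" unfolding M_def using A E
    by (intro proper.over_minus[of _ r r] proper.over_smult) (auto simp: inverse_rat_var_proper)
  moreover have "map_mat limit_at_infinity M = E"
    using A E inverse_rat_var_proper by (intro eq_matI) (auto simp: M_def const_rat_def proper.K_mult)
  ultimately have "proper.kunit r M" using M E by (intro kunit_of_invertible_limit) auto
  then obtain R where R: "R \<in> carrier_mat r r" "proper.over R" "M * R = 1\<^sub>m r" "R * M = 1\<^sub>m r"
    by (auto simp: proper.kunit_def)
  have D: "rat_var \<cdot>\<^sub>m const_rat E - const_rat A = rat_var \<cdot>\<^sub>m M"
    using A E rat_var_nonzero by (intro eq_matI) (auto simp: M_def algebra_simps)
  have 1: "(rat_var \<cdot>\<^sub>m M) * (?\<mu> \<cdot>\<^sub>m R) = 1\<^sub>m r" "(?\<mu> \<cdot>\<^sub>m R) * (rat_var \<cdot>\<^sub>m M) = 1\<^sub>m r"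
    using M R rat_var_nonzero by (auto simp: mult_smult_distrib[of _ r r _ r] mult_smult_assoc_mat[of _ r r _ r] intro!: eq_matI)
  have "mat_inv (rat_mat ([:0, 1:] \<cdot>\<^sub>m const_mat E - const_mat A)) = ?\<mu> \<cdot>\<^sub>m R"
    unfolding rat_pencil[OF A E(1)] D using 1 M R by (intro mat_inv_unique[of _ r]) auto
  then show ?thesis using 1 R M
    by (intro that[of "?\<mu> \<cdot>\<^sub>m R"]) (auto simp: D inverse_rat_var_proper intro!: proper.over_smult)
qed

lemma transfer_function_eq:
  assumes "A \<in> carrier_mat r r" "E \<in> carrier_mat r r"
    and R: "R \<in> carrier_mat r r" "(rat_var \<cdot>\<^sub>m const_rat E - const_rat A) * R = 1\<^sub>m r"
      "R * (rat_var \<cdot>\<^sub>m const_rat E - const_rat A) = 1\<^sub>m r"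
  shows "transfer_function P C B A E = rat_mat P + const_rat C * R * const_rat B"
proof -
  have "mat_inv (rat_mat ([:0, 1:] \<cdot>\<^sub>m const_mat E - const_mat A)) = R"
    unfolding rat_pencil[OF assms(1,2)] using assms by (intro mat_inv_unique[of _ r]) auto
  then show ?thesis by (simp add: transfer_function_def rat_const_mat)
qed

section \<open>Minimal realizations are controllable\<close>

lemma invertible_mat_with_first_row:
  fixes x :: "'a::field vec"
  assumes "x \<in> carrier_vec r" "x \<noteq> 0\<^sub>v r"
  obtains T T' where "T \<in> carrier_mat r r" "T' \<in> carrier_mat r r" "T * T' = 1\<^sub>m r" "T' * T = 1\<^sub>m r" "row T 0 = x" "0 < r"
proof -
  interpret vec_space "TYPE('a)" r .
  define bs where "bs = basis_completion x"
  note bc = basis_completion[OF assms, folded bs_def]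
  have r: "0 < r" using assms by (cases r) auto
  define M where "M = mat_of_cols r bs"
  have M: "M \<in> carrier_mat r r" and cM: "cols M = bs" using bc by (auto simp: M_def)
  have "rank M = r" using lin_indpt_full_rank[OF M] bc unfolding cM by blast
  then have "det M \<noteq> 0" using det_rank_iff[OF M] by simp
  then obtain M' where M': "M' \<in> carrier_mat r r" "M * M' = 1\<^sub>m r" "M' * M = 1\<^sub>m r"
    using invertible_mat_if_det[OF M] by blast
  have "col M 0 = x" using bc(6,7) r cM M
    by (metis carrier_matD(2) cols_nth hd_conv_nth length_greater_0_conv)
  then have "row (transpose_mat M) 0 = x" using r M by simp
  moreover have "transpose_mat M * transpose_mat M' = 1\<^sub>m r" "transpose_mat M' * transpose_mat M = 1\<^sub>m r"
    using M M' by (simp_all flip: transpose_mult[of _ r r _ r])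
  ultimately show ?thesis using that[of "transpose_mat M" "transpose_mat M'"] M M' r by auto
qed

lemma smult_mat_mat_vec:
  fixes M :: "'a::comm_ring_1 mat"
  shows "M \<in> carrier_mat a b \<Longrightarrow> v \<in> carrier_vec b \<Longrightarrow> (z \<cdot>\<^sub>m M) *\<^sub>v v = z \<cdot>\<^sub>v (M *\<^sub>v v)"
  by (intro eq_vecI) (auto simp: scalar_prod_def sum_distrib_left mult.assoc)

text \<open>
  Let \<open>x \<noteq> 0\<close> be a left null vector of both \<open>B\<close> and \<open>A - z E\<close>, and let \<open>y = E\<^sup>T x\<close>. Change the bases of the
  equations and of the states so that \<open>x\<close> and \<open>y\<close> become first coordinate functionals. The first rows of \<open>E\<close>, \<open>A\<close> and \<open>B\<close>
  turn into \<open>(1, 0)\<close>, \<open>(z, 0)\<close> and \<open>0\<close>, so the first state is identically zero under every input and can be deleted without changing the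
  transfer function. This contradicts minimality.
\<close>
theorem minimal_realization_controllable:
  assumes min: "minimal_realization n r G P A E B C"
    and x: "x \<in> carrier_vec r" "transpose_mat B *\<^sub>v x = 0\<^sub>v n"
      "transpose_mat (A - z \<cdot>\<^sub>m E) *\<^sub>v x = 0\<^sub>v r"
  shows "x = 0\<^sub>v r"
proof (rule ccontr)
  assume x0: "x \<noteq> 0\<^sub>v r"
  have c: "P \<in> carrier_mat n n" "A \<in> carrier_mat r r" "E \<in> carrier_mat r r" "invertible_mat E" "B \<in> carrier_mat r n"
    "C \<in> carrier_mat n r" "G = transfer_function P C B A E"
    using min by (auto simp: minimal_realization_def realization_def)
  obtain E' where E': "E' \<in> carrier_mat r r" "E * E' = 1\<^sub>m r" "E' * E = 1\<^sub>m r"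
    using invertible_mat_obtain_inverse[OF c(4,3)] .
  define y where "y = transpose_mat E *\<^sub>v x"
  have y: "y \<in> carrier_vec r" using c x by (auto simp: y_def)
  have "y \<noteq> 0\<^sub>v r"
  proof
    assume "y = 0\<^sub>v r"
    have "x = transpose_mat (E * E') *\<^sub>v x" using x E' by simp
    also have "\<dots> = transpose_mat E' *\<^sub>v y"
      unfolding y_def using c E' x by (subst transpose_mult[of _ r r _ r]) (auto simp: assoc_mult_mat_vec[of _ r r _ r])
    also have "\<dots> = 0\<^sub>v r" using \<open>y = 0\<^sub>v r\<close> E' by auto
    finally show False using x0 by simp
  qed
  then obtain Z W where Z: "Z \<in> carrier_mat r r" "W \<in> carrier_mat r r" "Z * W = 1\<^sub>m r" "W * Z = 1\<^sub>m r" "row Z 0 = y" "0 < r"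
    using invertible_mat_with_first_row[OF y] by metis
  obtain T T' where T: "T \<in> carrier_mat r r" "T' \<in> carrier_mat r r" "T * T' = 1\<^sub>m r" "T' * T = 1\<^sub>m r" "row T 0 = x"
    using invertible_mat_with_first_row[OF x(1) x0] by metis
  define q where "q = r - 1"
  have r: "r = 1 + q" using Z(6) by (simp add: q_def)
  \<comment> \<open>the realization in the new coordinates; \<open>W\<close> is the inverse of the matrix \<open>Z\<close> with first row \<open>y\<close>\<close>
  define A1 where "A1 = T * A * W"
  define E1 where "E1 = T * E * W"
  define B1 where "B1 = T * B"
  define C1 where "C1 = C * W"
  have c1: "A1 \<in> carrier_mat r r" "E1 \<in> carrier_mat r r" "B1 \<in> carrier_mat r n" "C1 \<in> carrier_mat n r"
    using c T Z by (auto simp: A1_def E1_def B1_def C1_def intro!: mult_carrier_mat[of _ _ r])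
  have row0: "(T * M) $$ (0, j) = (transpose_mat M *\<^sub>v x) $ j" if "M \<in> carrier_mat r k" "j < k" for M :: "complex mat" and j k
    using that T Z(6) x(1) by (simp add: T(5) comm_scalar_prod[of _ r])
  have Ax: "transpose_mat A *\<^sub>v x = z \<cdot>\<^sub>v y"
  proof -
    have "transpose_mat (A - z \<cdot>\<^sub>m E) = transpose_mat A - z \<cdot>\<^sub>m transpose_mat E" using c by (intro eq_matI) auto
    then have "transpose_mat A *\<^sub>v x - z \<cdot>\<^sub>v y = 0\<^sub>v r"
      using x c by (simp add: minus_mult_distrib_mat_vec[of _ r r] y_def smult_mat_mat_vec)
    then show ?thesis using c x y by (auto simp: vec_eq_iff)
  qed
  have yW: "(transpose_mat W *\<^sub>v y) $ j = (if j = 0 then 1 else 0)" if "j < r" for j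
  proof -
    have "(Z * W) $$ (0, j) = row Z 0 \<bullet> col W j" using Z(1,2,6) that by simp
    then have "y \<bullet> col W j = (if j = 0 then 1 else 0)" unfolding Z(3,5) using Z(6) that by auto
    then show ?thesis using Z that y by (simp add: comm_scalar_prod[of _ r])
  qed
  have E1r: "E1 $$ (0, j) = (if j = 0 then 1 else 0)" if "j < r" for j
  proof -
    have "E1 $$ (0, j) = (transpose_mat (E * W) *\<^sub>v x) $ j"
      unfolding E1_def using c T Z that by (subst row0[symmetric, of _ r]) (auto simp: assoc_mult_mat[of _ r r _ r _ r])
    also have "transpose_mat (E * W) *\<^sub>v x = transpose_mat W *\<^sub>v y"
      unfolding y_def using c Z x by (subst transpose_mult[of _ r r _ r]) (auto simp: assoc_mult_mat_vec[of _ r r _ r])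
    finally show ?thesis using yW[OF that] by simp
  qed
  have A1r: "A1 $$ (0, j) = (if j = 0 then z else 0)" if "j < r" for j
  proof -
    have "A1 $$ (0, j) = (transpose_mat (A * W) *\<^sub>v x) $ j"
      unfolding A1_def using c T Z that by (subst row0[symmetric, of _ r]) (auto simp: assoc_mult_mat[of _ r r _ r _ r])
    also have "transpose_mat (A * W) *\<^sub>v x = transpose_mat W *\<^sub>v (z \<cdot>\<^sub>v y)"
      unfolding Ax[symmetric] using c Z x by (subst transpose_mult[of _ r r _ r]) (auto simp: assoc_mult_mat_vec[of _ r r _ r])
    also have "\<dots> $ j = z * (transpose_mat W *\<^sub>v y) $ j"
      using Z y that by (subst mult_mat_vec[of _ r r]) auto
    finally show ?thesis using yW[OF that] by simp
  qed
  have B1r: "B1 $$ (0, j) = 0" if "j < n" for j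
    unfolding B1_def using row0[OF c(5) that] x(2) that by simp
  \<comment> \<open>deletion of the first row and column\<close>
  define sub where "sub = (\<lambda>M::complex mat. mat q q (\<lambda>(i, j). M $$ (Suc i, Suc j)))"
  define A2 where "A2 = sub A1"
  define E2 where "E2 = sub E1"
  define B2 where "B2 = mat q n (\<lambda>(i, j). B1 $$ (Suc i, j))"
  define C2 where "C2 = mat n q (\<lambda>(i, j). C1 $$ (i, Suc j))"
  have c2: "A2 \<in> carrier_mat q q" "E2 \<in> carrier_mat q q" "B2 \<in> carrier_mat q n" "C2 \<in> carrier_mat n q"
    by (auto simp: A2_def E2_def B2_def C2_def sub_def)
  have E1b: "E1 = four_block_mat (1\<^sub>m 1) (0\<^sub>m 1 q) (mat q 1 (\<lambda>(i, j). E1 $$ (Suc i, j))) E2"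
    using c1 E1r unfolding r by (intro eq_matI) (auto simp: E2_def sub_def)
  have "invertible_mat E2"
  proof -
    have nz: "det M \<noteq> 0" if "M \<in> carrier_mat r r" "N \<in> carrier_mat r r" "M * N = 1\<^sub>m r" for M N :: "complex mat"
      using det_mult[OF that(1,2)] that(3) by auto
    have "det E1 = det T * det E * det W"
      unfolding E1_def using T(1) c(3) Z(2) by (simp add: det_mult[of _ r] mult_carrier_mat[of _ r r _ r])
    then have "det E1 \<noteq> 0" using nz[OF T(1-3)] nz[OF c(3) E'(1,2)] nz[OF Z(2,1,4)] by simp
    moreover have "det E1 = det E2"
      using c2 by (subst E1b, subst det_four_block_mat_upper_right_zero[of _ 1 _ q]) auto
    ultimately have "det E2 \<noteq> 0" by simp
    then show ?thesis using invertible_mat_if_det[OF c2(2)] invertible_matI[OF c2(2)] by metis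
  qed
  note E2i = this
  obtain R where R: "R \<in> carrier_mat r r" "(rat_var \<cdot>\<^sub>m const_rat E - const_rat A) * R = 1\<^sub>m r"
      "R * (rat_var \<cdot>\<^sub>m const_rat E - const_rat A) = 1\<^sub>m r"
    using rat_pencil_inverse[OF c(2-4)] by metis
  obtain R2 where R2: "R2 \<in> carrier_mat q q" "(rat_var \<cdot>\<^sub>m const_rat E2 - const_rat A2) * R2 = 1\<^sub>m q"
      "R2 * (rat_var \<cdot>\<^sub>m const_rat E2 - const_rat A2) = 1\<^sub>m q"
    using rat_pencil_inverse[OF c2(1,2) E2i] by metis
  let ?D = "rat_var \<cdot>\<^sub>m const_rat E - const_rat A"
  let ?D1 = "rat_var \<cdot>\<^sub>m const_rat E1 - const_rat A1"
  let ?D2 = "rat_var \<cdot>\<^sub>m const_rat E2 - const_rat A2"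
  let ?V = "R2 * const_rat B2"
  \<comment> \<open>the solution of the state equation, with first row zero; the empty blocks
    make it a two by two block matrix, so that block multiplication applies\<close>
  define M where "M = four_block_mat (0\<^sub>m 1 n) (0\<^sub>m 1 0) ?V (0\<^sub>m q 0)"
  have V: "?V \<in> carrier_mat q n" using R2 c2 by (auto intro!: mult_carrier_mat[of _ _ q])
  have M: "M \<in> carrier_mat r n" using V unfolding M_def r by auto
  have D1: "?D1 = four_block_mat (mat 1 1 (\<lambda>_. rat_var - to_fract [:z:])) (0\<^sub>m 1 q) (mat q 1 (\<lambda>(i, j). ?D1 $$ (Suc i, j))) ?D2"
    using c1 c2 E1r A1r unfolding r
    by (intro eq_matI) (auto simp: const_rat_def A2_def E2_def sub_def one_pCons[symmetric])
  have C1b: "const_rat C1 = four_block_mat (mat n 1 (\<lambda>(i, j). const_rat C1 $$ (i, j))) (const_rat C2) (0\<^sub>m 0 1) (0\<^sub>m 0 q)"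
    using c1 c2 unfolding r by (intro eq_matI) (auto simp: const_rat_def C2_def)
  have B1b: "const_rat B1 = four_block_mat (0\<^sub>m 1 n) (0\<^sub>m 1 0) (const_rat B2) (0\<^sub>m q 0)"
    using c1 c2 B1r unfolding r by (intro eq_matI) (auto simp: const_rat_def B2_def)
  have DM: "?D2 * ?V = const_rat B2"
  proof -
    have "?D2 * ?V = ?D2 * R2 * const_rat B2"
      using R2(1) c2 by (intro assoc_mult_mat[symmetric, of _ q q _ q _ n]) auto
    then show ?thesis unfolding R2(2) using c2 by simp
  qed
  have D1M: "?D1 * M = const_rat B1"
  proof -
    obtain d e where de: "d \<in> carrier_mat 1 1" "e \<in> carrier_mat q 1" "?D1 = four_block_mat d (0\<^sub>m 1 q) e ?D2"
      using D1 by (metis mat_carrier)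
    have D2c: "?D2 \<in> carrier_mat q q" using c2 by auto
    show ?thesis
      unfolding de(3) M_def B1b
        mult_four_block_mat[OF de(1) zero_carrier_mat de(2) D2c zero_carrier_mat zero_carrier_mat V zero_carrier_mat]
    proof (rule cong_four_block_mat)
      show "d * 0\<^sub>m 1 n + 0\<^sub>m 1 q * ?V = 0\<^sub>m 1 n"
        unfolding left_mult_zero_mat[OF V] right_mult_zero_mat[OF de(1)] by simp
      show "e * 0\<^sub>m 1 n + ?D2 * ?V = const_rat B2"
        unfolding DM right_mult_zero_mat[OF de(2)] using c2 by simp
    qed (use de(1,2) D2c in \<open>auto intro!: eq_matI\<close>)
  qed
  have C1M: "const_rat C1 * M = const_rat C2 * ?V"
  proof -
    obtain d where d: "d \<in> carrier_mat n 1" "const_rat C1 = four_block_mat d (const_rat C2) (0\<^sub>m 0 1) (0\<^sub>m 0 q)"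
      using C1b by (metis mat_carrier)
    have C2c: "const_rat C2 \<in> carrier_mat n q" using c2 by auto
    have "const_rat C1 * M = four_block_mat (const_rat C2 * ?V) (0\<^sub>m n 0) (0\<^sub>m 0 n) (0\<^sub>m 0 0)"
      unfolding d(2) M_def
        mult_four_block_mat[OF d(1) C2c zero_carrier_mat zero_carrier_mat zero_carrier_mat zero_carrier_mat V zero_carrier_mat]
    proof (rule cong_four_block_mat)
      show "d * 0\<^sub>m 1 n + const_rat C2 * ?V = const_rat C2 * ?V"
        unfolding right_mult_zero_mat[OF d(1)] by (rule left_add_zero_mat[OF mult_carrier_mat[OF C2c V]])
    qed (use d(1) C2c V in \<open>auto intro!: eq_matI\<close>)
    also have "\<dots> = const_rat C2 * ?V" using V c2 by (intro eq_matI) auto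
    finally show ?thesis .
  qed
  have ct: "const_rat T \<in> carrier_mat r r" "const_rat W \<in> carrier_mat r r" "const_rat T' \<in> carrier_mat r r" "?D \<in> carrier_mat r r"
    "const_rat B \<in> carrier_mat r n" "const_rat C \<in> carrier_mat n r"
    using T Z c by auto
  have D1eq: "?D1 = const_rat T * ?D * const_rat W"
  proof -
    have "const_rat A1 = const_rat T * const_rat A * const_rat W" "const_rat E1 = const_rat T * const_rat E * const_rat W"
      using c T Z unfolding A1_def E1_def by (simp_all add: const_rat_mult[of _ r r _ r] mult_carrier_mat[of _ r r _ r])
    then show ?thesis using c T Z
      by (simp add: mult_minus_distrib_mat[of _ r r _ r] minus_mult_distrib_mat[of _ r r _ _ r]
          mult_smult_distrib[of _ r r _ r] mult_smult_assoc_mat[of _ r r _ r] mult_carrier_mat[of _ r r _ r])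
  qed
  have "const_rat T' * (?D1 * M) = const_rat T' * const_rat B1" unfolding D1M ..
  moreover have "const_rat T' * const_rat B1 = const_rat B"
  proof -
    have "T' * (T * B) = T' * T * B" using T(1,2) c(5) by (intro assoc_mult_mat[symmetric]) auto
    then have "const_rat T' * const_rat B1 = const_rat (T' * T * B)"
      unfolding B1_def using const_rat_mult[OF T(2) mult_carrier_mat[OF T(1) c(5)]] by simp
    then show ?thesis unfolding T(4) using c by simp
  qed
  moreover have "const_rat T' * (?D1 * M) = ?D * (const_rat W * M)"
  proof -
    have "const_rat T' * (?D1 * M) = (const_rat T' * const_rat T) * (?D * (const_rat W * M))"
      unfolding D1eq using ct M
      by (simp add: assoc_mult_mat[of _ r r _ r _ r] assoc_mult_mat[of _ r r _ r _ n] mult_carrier_mat[of _ r r _ r] mult_carrier_mat[of _ r r _ n])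
    also have "const_rat T' * const_rat T = 1\<^sub>m r" using T by (simp flip: const_rat_mult[of _ r r])
    finally show ?thesis using ct M by (simp add: mult_carrier_mat[of _ r r _ n] left_mult_one_mat[of _ r n])
  qed
  ultimately have "?D * (const_rat W * M) = const_rat B" by simp
  then have "R * (?D * (const_rat W * M)) = R * const_rat B" by simp
  moreover have WM: "const_rat W * M \<in> carrier_mat r n" using ct M by (auto intro!: mult_carrier_mat[of _ _ r])
  have "R * (?D * (const_rat W * M)) = const_rat W * M"
  proof -
    have "R * (?D * (const_rat W * M)) = R * ?D * (const_rat W * M)"
      using R(1) ct(4) WM by (intro assoc_mult_mat[symmetric, of _ r r _ r _ n]) auto
    then show ?thesis unfolding R(3) left_mult_one_mat[OF WM] .
  qed
  ultimately have RB: "R * const_rat B = const_rat W * M" by simp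
  have "const_rat C * R * const_rat B = const_rat C * (const_rat W * M)"
    using R ct RB by (simp add: assoc_mult_mat[of _ n r _ r _ n])
  also have "\<dots> = const_rat C1 * M"
    unfolding C1_def using ct M Z c by (simp add: const_rat_mult[of _ n r] assoc_mult_mat[of _ n r _ r _ n])
  also have "\<dots> = const_rat C2 * R2 * const_rat B2"
    unfolding C1M using R2 c2 by (simp add: assoc_mult_mat[of _ n q _ q _ n])
  finally have "transfer_function P C B A E = transfer_function P C2 B2 A2 E2"
    unfolding transfer_function_eq[OF c(2,3) R] transfer_function_eq[OF c2(1,2) R2] by simp
  then have "realization n q G P A2 E2 B2 C2"
    using c c2 E2i by (simp add: realization_def)
  then have "r \<le> q" using min unfolding minimal_realization_def by blast
  then show False using r by simp
qed

section \<open>Elementary matrices\<close>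

lemma elem_mat_pos:
  assumes "0 < i" "i < m"
  shows "elem_mat n m (int i) X = cross n m (m - i - 1) X (0\<^sub>m n n)"
proof -
  have "i - 1 = m - (m - i - 1) - 2" using assms by simp
  then show ?thesis using assms unfolding elem_mat_def cross_def swap2_def diag_block_mat_emb by simp
qed

lemma elem_mat_neg:
  assumes "0 < i" "i < m"
  shows "elem_mat n m (- int i) X = cross n m (m - i - 1) (0\<^sub>m n n) X"
proof -
  have "i - 1 = m - (m - i - 1) - 2" using assms by simp
  then show ?thesis using assms unfolding elem_mat_def cross_def swap2_def diag_block_mat_emb by simp
qed

lemma elem_mat_zero: "elem_mat n m 0 X = spot n m (m - 1) X" if "1 \<le> m"
  using that unfolding elem_mat_def spot_def diag_block_mat_two by (simp add: dsum_def)

lemma elem_mat_top: "elem_mat n m (- int m) X = spot n m 0 X" if "1 \<le> m"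
  using that unfolding elem_mat_def spot_def by (simp add: diag_block_mat_two del: diag_block_mat.simps)

lemma elem_mat_cases:
  assumes "- int m \<le> i" "i < int m"
  obtains "i = 0" | "i = - int m" | k where "i = int k" "0 < k" "k < m" | k where "i = - int k" "0 < k" "k < m"
proof -
  consider "i = 0" | "i = - int m" | "0 < i" | "i < 0" "- int m < i" using assms by linarith
  then show ?thesis
  proof cases
    case 3 then show ?thesis using that(3)[of "nat i"] assms by auto
  next
    case 4 then show ?thesis using that(4)[of "nat (- i)"] by auto
  qed (use that in auto)
qed

lemma elem_mat_carrier:
  assumes "- int m \<le> i" "i < int m" "X \<in> carrier_mat n n"
  shows "elem_mat n m i X \<in> carrier_mat (m * n) (m * n)"
  using assms(1,2)
proof (cases rule: elem_mat_cases)
  case 1 then show ?thesis using assms by (auto simp: elem_mat_zero intro!: spot_carrier)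
next
  case 2 then show ?thesis using assms by (auto simp: elem_mat_top intro!: spot_carrier)
next
  case (3 k) then show ?thesis using assms by (auto simp: elem_mat_pos intro!: cross_carrier)
next
  case (4 k) then show ?thesis using assms by (auto simp: elem_mat_neg intro!: cross_carrier)
qed

lemma elem_mat_transpose:
  assumes "- int m \<le> i" "i < int m" "X \<in> carrier_mat n n"
  shows "transpose_mat (elem_mat n m i X) = elem_mat n m i (transpose_mat X)"
  using assms(1,2)
proof (cases rule: elem_mat_cases)
  case 1 then show ?thesis using assms by (auto simp: elem_mat_zero spot_transpose)
next
  case 2 then show ?thesis using assms by (auto simp: elem_mat_top spot_transpose)
next
  case (3 k) then show ?thesis using assms by (auto simp: elem_mat_pos cross_transpose)
next
  case (4 k) then show ?thesis using assms by (auto simp: elem_mat_neg cross_transpose)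
qed

text \<open>
  The rows and columns on which \<open>M_i(X)\<close> differs from the identity. For \<open>i = 0\<close> the interval extends beyond the last
  row, and for \<open>i = - m\<close> the truncated subtraction cuts it down to the first block, so that one formula serves all indices.
\<close>
definition elem_support :: "nat \<Rightarrow> nat \<Rightarrow> int \<Rightarrow> nat set" where
  "elem_support n m i = {(m - nat \<bar>i\<bar> - 1) * n ..< (m + 1 - nat \<bar>i\<bar>) * n}"

lemma cross_supported:
  assumes "X \<in> carrier_mat n n" "Y \<in> carrier_mat n n"
  shows "supported {c * n..<(c + 2) * n} (cross n m c X Y)"
  unfolding cross_def using assms by (intro supported_emb[of _ "n + n"]) (auto simp: algebra_simps)

lemma spot_supported:
  assumes "X \<in> carrier_mat n n"
  shows "supported {c * n..<(c + 1) * n} (spot n m c X)"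
  unfolding spot_def using assms by (intro supported_emb[of _ n]) (auto simp: algebra_simps)

lemma elem_mat_supported:
  assumes "- int m \<le> i" "i < int m" "X \<in> carrier_mat n n"
  shows "supported (elem_support n m i) (elem_mat n m i X)"
  using assms(1,2)
proof (cases rule: elem_mat_cases)
  case 1 then show ?thesis using assms
    by (auto simp: elem_mat_zero elem_support_def intro!: supported_mono[OF spot_supported])
next
  case 2 then show ?thesis using assms
    by (auto simp: elem_mat_top elem_support_def intro!: supported_mono[OF spot_supported])
next
  case (3 k)
  have "m - k - 1 + 2 = m + 1 - k" using 3 by simp
  then show ?thesis using 3 cross_supported[OF assms(3) zero_carrier_mat, of "m - k - 1" m]
    by (simp add: elem_mat_pos elem_support_def)
next
  case (4 k)
  have "m - k - 1 + 2 = m + 1 - k" using 4 by simp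
  then show ?thesis using 4 cross_supported[OF zero_carrier_mat assms(3), of "m - k - 1" m]
    by (simp add: elem_mat_neg elem_support_def)
qed

lemma block_intervals_disjoint:
  "b \<le> c \<or> e \<le> a \<Longrightarrow> {a * n..<b * n} \<inter> {c * n..<e * n} = ({} :: nat set)"
  using mult_le_mono1[of b c n] mult_le_mono1[of e a n] by auto

lemma elem_support_disjoint:
  assumes "\<bar>i\<bar> + 2 \<le> \<bar>j\<bar>" "\<bar>j\<bar> \<le> int m"
  shows "elem_support n m i \<inter> elem_support n m j = {}"
proof -
  have "nat \<bar>i\<bar> + 2 \<le> nat \<bar>j\<bar>" using assms by (simp add: nat_le_iff)
  then have "m + 1 - nat \<bar>j\<bar> \<le> m - nat \<bar>i\<bar> - 1" by arith
  then show ?thesis unfolding elem_support_def by (intro block_intervals_disjoint disjI2)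
qed

text \<open>
  Nonadjacent indices, irrespective of their signs, have disjoint supports.
\<close>
lemma elem_mat_commute:
  assumes "- int m \<le> i" "i < int m" "X \<in> carrier_mat n n"
    and "- int m \<le> j" "j < int m" "Y \<in> carrier_mat n n" and "2 \<le> \<bar>\<bar>i\<bar> - \<bar>j\<bar>\<bar>"
  shows "elem_mat n m i X * elem_mat n m j Y = elem_mat n m j Y * elem_mat n m i X"
proof -
  have "elem_support n m i \<inter> elem_support n m j = {}"
  proof (cases "\<bar>i\<bar> \<le> \<bar>j\<bar>")
    case True then show ?thesis using assms by (intro elem_support_disjoint) auto
  next
    case False then have "elem_support n m j \<inter> elem_support n m i = {}"
      using assms by (intro elem_support_disjoint) auto
    then show ?thesis by blast
  qed
  then show ?thesis
    using assms by (intro supported_commute[OF elem_mat_carrier elem_mat_carrier elem_mat_supported elem_mat_supported]) auto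
qed

lemma elem_mat_inverse:
  assumes "0 < i" "i < int m" "X \<in> carrier_mat n n"
  shows "elem_mat n m i X * elem_mat n m (- i) (- X) = 1\<^sub>m (m * n)"
    "elem_mat n m (- i) (- X) * elem_mat n m i X = 1\<^sub>m (m * n)"
proof -
  obtain k where k: "i = int k" "0 < k" "k < m" using assms by (metis nonneg_int_cases less_imp_le of_nat_0_less_iff of_nat_less_iff)
  show "elem_mat n m i X * elem_mat n m (- i) (- X) = 1\<^sub>m (m * n)"
    "elem_mat n m (- i) (- X) * elem_mat n m i X = 1\<^sub>m (m * n)"
    using k assms(3) by (auto simp: elem_mat_pos elem_mat_neg intro!: cross_inverse)
qed

lemma spot_invertible:
  assumes "X \<in> carrier_mat n n" "invertible_mat X" "c < m"
  shows "invertible_mat (spot n m c (X :: 'a::comm_ring_1 mat))"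
proof -
  obtain Y where Y: "Y \<in> carrier_mat n n" "X * Y = 1\<^sub>m n" "Y * X = 1\<^sub>m n"
    using invertible_mat_obtain_inverse[OF assms(2,1)] .
  have "spot n m c X * spot n m c Y = 1\<^sub>m (m * n)" "spot n m c Y * spot n m c X = 1\<^sub>m (m * n)"
    unfolding spot_def using assms Y spot_size[OF assms(3), of n] by (simp_all add: emb_mult[of _ n] del: diff_diff_left)
  then show ?thesis
    using assms Y by (intro invertible_matI[OF spot_carrier spot_carrier]) auto
qed

lemma elem_mat_invertible:
  assumes "- int m \<le> i" "i < int m" "X \<in> carrier_mat n n"
    and "i = 0 \<or> i = - int m \<Longrightarrow> invertible_mat X"
  shows "invertible_mat (elem_mat n m i X)"
  using assms(1,2)
proof (cases rule: elem_mat_cases)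
  case 1 then show ?thesis using assms by (auto simp: elem_mat_zero intro!: spot_invertible)
next
  case 2 then show ?thesis using assms by (auto simp: elem_mat_top intro!: spot_invertible)
next
  case (3 k) then show ?thesis using elem_mat_inverse[of i m X n] assms
    by (intro invertible_matI[OF elem_mat_carrier elem_mat_carrier, of m i X n "- i" "- X"]) auto
next
  case (4 k) then show ?thesis using elem_mat_inverse[of "- i" m "- X" n] assms
    by (intro invertible_matI[OF elem_mat_carrier elem_mat_carrier, of m i X n "- i" "- X"]) auto
qed

lemma invertible_mat_mult:
  fixes M :: "'a::comm_ring_1 mat"
  assumes "M \<in> carrier_mat N N" "M' \<in> carrier_mat N N" "invertible_mat M" "invertible_mat M'"
  shows "invertible_mat (M * M')"
proof -
  interpret unital_subring "UNIV :: 'a set" by standard auto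
  have *: "kunit N M \<longleftrightarrow> invertible_mat M" if "M \<in> carrier_mat N N" for M
    using that invertible_mat_obtain_inverse[of M N] invertible_matI[of M N]
    by (auto simp: kunit_def over_def)
  show ?thesis using assms kunit_mult[of N M M'] *[of M] *[of M'] *[of "M * M'"] by auto
qed

lemma mat_prod_invertible:
  fixes Ms :: "'a::comm_ring_1 mat list"
  assumes "set Ms \<subseteq> carrier_mat N N" "\<And>M. M \<in> set Ms \<Longrightarrow> invertible_mat M"
  shows "invertible_mat (mat_prod N Ms)"
  using assms
proof (induction Ms)
  case Nil
  show ?case by (auto intro!: invertible_matI[of _ N "1\<^sub>m N"])
next
  case (Cons M Ms)
  then show ?case using invertible_mat_mult[of M N "mat_prod N Ms"] mat_prod_carrier[of Ms N] by auto
qed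

section \<open>Moving a block column through a product of elementary matrices\<close>

text \<open>
  The matrix \<open>M_{s+1}(X)\<close> moves a block column at height \<open>s\<close> (counted from the last block, which has height 0) up
  to height \<open>s + 1\<close>, whereas every other \<open>M_i(X)\<close> with \<open>i \<ge> 0\<close> and \<open>i \<noteq> s\<close> fixes it. So \<open>climb t s\<close> is the
  height reached from \<open>s\<close> under the product for \<open>t\<close>, whose last factor acts first. The factor \<open>M_s(X)\<close> would put
  \<open>X\<close> in front of the block; \<open>climbable\<close> says that this never happens.
\<close>
fun climb :: "int list \<Rightarrow> int \<Rightarrow> int" where
  "climb [] s = s"
| "climb (i # t) s = (if i = climb t s + 1 then i else climb t s)"

fun climbable :: "int list \<Rightarrow> int \<Rightarrow> bool" where
  "climbable [] s = True"
| "climbable (i # t) s = (climbable t s \<and> i \<noteq> climb t s)"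

lemma climb_append: "climb (t @ u) s = climb t (climb u s)"
  by (induction t) auto

lemma climbable_append: "climbable (t @ u) s \<longleftrightarrow> climbable u s \<and> climbable t (climb u s)"
  by (induction t) (auto simp: climb_append)

lemma rev_upto_int: "0 \<le> (p::int) \<Longrightarrow> rev [0..p] = p # rev [0..p - 1]"
  by (simp add: upto_rec2)

text \<open>
  Climbing is the greedy search, from the right, for a subtuple \<open>(p, \<dots>, 1, 0)\<close>. Starting below 0 means
  that the search begins with the entry 0.
\<close>
lemma subseq_descending_iff:
  "- 1 \<le> p \<Longrightarrow> subseq (rev [0..p]) \<beta> \<longleftrightarrow> p \<le> climb \<beta> (- 1)"
proof (induction \<beta> arbitrary: p)
  case Nil
  then show ?case by (cases "p = -1") (auto simp: rev_upto_int)
next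
  case (Cons x \<beta>)
  have ge: "- 1 \<le> climb \<beta> (- 1)" for \<beta>
    by (induction \<beta>) auto
  show ?case
  proof (cases "p = - 1")
    case True then show ?thesis using ge[of "x # \<beta>"] by simp
  next
    case False
    then have p: "0 \<le> p" using Cons.prems by simp
    show ?thesis
      using Cons.IH[of "p - 1"] Cons.IH[of p] p by (auto simp: rev_upto_int subseq_Cons2_iff)
  qed
qed

lemma i0_eq_climb:
  assumes "0 \<le> climb \<beta> (- 1)"
  shows "int (i0 \<beta>) = climb \<beta> (- 1)"
proof -
  have "i0 \<beta> = nat (climb \<beta> (- 1))"
    unfolding i0_def using assms subseq_descending_iff[of _ \<beta>]
    by (intro Greatest_equality) (auto simp: le_nat_iff)
  then show ?thesis using assms by simp
qed

text \<open>
  \<open>e_{m-s} \<otimes> C\<close>, indexed by its height \<open>s\<close> above the last block.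
\<close>
definition elem_col :: "nat \<Rightarrow> nat \<Rightarrow> int \<Rightarrow> complex mat \<Rightarrow> complex mat" where
  "elem_col n m s C = plc (m * n) ((m - 1 - nat s) * n) C"

lemma supported_plc:
  fixes M :: "'a::comm_ring_1 mat"
  assumes "M \<in> carrier_mat N N" "supported S M" "S \<inter> {a..<a + d} = {}" "C \<in> carrier_mat d r" "a + d \<le> N"
  shows "M * plc N a C = plc N a C"
proof (rule plc_mult[OF assms(1,4,5)])
  fix i t assume it: "i < N" "t < d"
  then have "a + t \<notin> S" using assms(3) by auto
  then show "M $$ (i, a + t) = (if i = a + t then 1 else 0)"
    using assms(1,2,5) it by (auto simp: supported_def)
qed

lemma block_fits: "s < m \<Longrightarrow> (m - 1 - s) * n + n \<le> m * (n::nat)"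
proof -
  assume "s < m"
  then have "Suc (m - 1 - s) * n \<le> m * n" by (intro mult_le_mono1) simp
  then show ?thesis by simp
qed

lemma block_gap:
  fixes a k m :: nat
  assumes "a \<noteq> k" "a \<noteq> Suc k" "k < m"
  shows "m + 1 - a \<le> m - 1 - k \<or> Suc (m - 1 - k) \<le> m - a - 1"
  using assms by (cases "a < k") auto

lemma elem_col_fixed:
  assumes "- int m \<le> i" "i < int m" "X \<in> carrier_mat n n" "C \<in> carrier_mat n r" "0 \<le> s" "s < int m"
    and "\<bar>i\<bar> \<noteq> s" "\<bar>i\<bar> \<noteq> s + 1"
  shows "elem_mat n m i X * elem_col n m s C = elem_col n m s C"
proof -
  let ?b = "m - 1 - nat s"
  have a: "nat \<bar>i\<bar> \<noteq> nat s" "nat \<bar>i\<bar> \<noteq> Suc (nat s)" "nat s < m" using assms by auto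
  have "m + 1 - nat \<bar>i\<bar> \<le> ?b \<or> Suc ?b \<le> m - nat \<bar>i\<bar> - 1"
    by (rule block_gap[OF a])
  then have "elem_support n m i \<inter> {?b * n..<Suc ?b * n} = {}"
    unfolding elem_support_def by (rule block_intervals_disjoint)
  then have "elem_support n m i \<inter> {?b * n..<?b * n + n} = {}" by (simp only: mult_Suc add.commute[of n])
  then show ?thesis unfolding elem_col_def
    using assms(4) block_fits[OF a(3)]
    by (rule supported_plc[OF elem_mat_carrier[OF assms(1-3)] elem_mat_supported[OF assms(1-3)]])
qed

lemma elem_col_moved:
  assumes "0 \<le> s" "s + 1 < int m" "X \<in> carrier_mat n n" "C \<in> carrier_mat n r"
  shows "elem_mat n m (s + 1) X * elem_col n m s C = elem_col n m (s + 1) C"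
proof -
  obtain k where k: "s = int k" using assms(1) nonneg_int_cases by blast
  define c where "c = m - Suc k - 1"
  have c: "c + 2 \<le> m" "m - 1 - nat s = Suc c" "m - 1 - nat (s + 1) = c"
    using assms k by (auto simp: c_def nat_add_distrib)
  have e: "elem_mat n m (s + 1) X = cross n m c X (0\<^sub>m n n)"
    using elem_mat_pos[of "Suc k" m n X] assms k by (simp add: c_def add.commute)
  show ?thesis unfolding e elem_col_def c
  proof (rule plc_mult[of _ _ _ n r])
    show "cross n m c X (0\<^sub>m n n) \<in> carrier_mat (m * n) (m * n)" using c assms by (intro cross_carrier) auto
    show "Suc c * n + n \<le> m * n" using cross_size[OF c(1), of n] by simp
    fix i t assume it: "i < m * n" "t < n"
    have i': "i < c * n + (n + n) + (m - c - 2) * n" using it cross_size[OF c(1), of n] by simp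
    have t': "Suc c * n + t < c * n + (n + n) + (m - c - 2) * n" using it cross_size[OF c(1), of n] by simp
    show "cross n m c X (0\<^sub>m n n) $$ (i, Suc c * n + t) = (if i = c * n + t then 1 else 0)"
      unfolding cross_def emb_index[OF swap2_carrier[OF assms(3) zero_carrier_mat] i' t']
      using assms it by (auto simp: swap2_def)
  qed (use assms in auto)
qed

lemma climb_bounds:
  "0 \<le> s \<Longrightarrow> s < int m \<Longrightarrow> set t \<subseteq> {0..<int m} \<Longrightarrow> 0 \<le> climb t s \<and> climb t s < int m"
  by (induction t) auto

lemma elem_prod_carrier:
  assumes "set t \<subseteq> {- int m..<int m}" "set X \<subseteq> carrier_mat n n"
  shows "set (map2 (elem_mat n m) t X) \<subseteq> carrier_mat (m * n) (m * n)"
    "elem_prod n m t X \<in> carrier_mat (m * n) (m * n)"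
proof -
  show 1: "set (map2 (elem_mat n m) t X) \<subseteq> carrier_mat (m * n) (m * n)"
  proof
    fix M assume "M \<in> set (map2 (elem_mat n m) t X)"
    then obtain i Y where "M = elem_mat n m i Y" "(i, Y) \<in> set (zip t X)" by auto
    moreover from this have "i \<in> set t" "Y \<in> set X" by (auto dest: set_zip_leftD set_zip_rightD)
    ultimately show "M \<in> carrier_mat (m * n) (m * n)"
      using assms elem_mat_carrier[of m i Y n] by (auto simp: subset_iff)
  qed
  then show "elem_prod n m t X \<in> carrier_mat (m * n) (m * n)"
    unfolding elem_prod_def by (rule mat_prod_carrier)
qed

lemma elem_prod_climb:
  assumes "length X = length t" "set t \<subseteq> {0..<int m}" "set X \<subseteq> carrier_mat n n" "C \<in> carrier_mat n r"
    "0 \<le> s" "s < int m" "climbable t s"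
  shows "elem_prod n m t X * elem_col n m s C = elem_col n m (climb t s) C"
  using assms
proof (induction t arbitrary: X)
  case Nil
  have "elem_col n m s C \<in> carrier_mat (m * n) r" using Nil by (auto simp: elem_col_def)
  then show ?case using Nil by (simp add: elem_prod_def)
next
  case (Cons i t)
  then obtain M Ms where X: "X = M # Ms" by (cases X) auto
  have c: "elem_prod n m t Ms \<in> carrier_mat (m * n) (m * n)"
    using Cons.prems X by (intro elem_prod_carrier) auto
  have m: "elem_mat n m i M \<in> carrier_mat (m * n) (m * n)"
    using Cons.prems X by (intro elem_mat_carrier) auto
  have e: "elem_col n m s C \<in> carrier_mat (m * n) r" using Cons by (auto simp: elem_col_def)
  have b: "0 \<le> climb t s" "climb t s < int m" using climb_bounds[of s m t] Cons.prems by auto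
  have "elem_prod n m (i # t) X * elem_col n m s C = elem_mat n m i M * (elem_prod n m t Ms * elem_col n m s C)"
    using m c e X by (simp add: elem_prod_def assoc_mult_mat[of _ "m * n" "m * n" _ "m * n" _ r])
  also have "elem_prod n m t Ms * elem_col n m s C = elem_col n m (climb t s) C"
    using Cons.prems X by (intro Cons.IH) auto
  also have "elem_mat n m i M * elem_col n m (climb t s) C = elem_col n m (climb (i # t) s) C"
  proof (cases "i = climb t s + 1")
    case True
    then show ?thesis using elem_col_moved[of "climb t s" m M n C r] Cons.prems X b by auto
  next
    case False
    then show ?thesis using elem_col_fixed[of m i M n C r "climb t s"] Cons.prems X b by auto
  qed
  finally show ?case .
qed

lemma elem_prod_transpose:
  assumes "length X = length t" "set t \<subseteq> {- int m..<int m}" "set X \<subseteq> carrier_mat n n"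
  shows "transpose_mat (elem_prod n m t X) = elem_prod n m (rev t) (rev (map transpose_mat X))"
proof -
  have z: "zip (rev t) (rev (map transpose_mat X)) = rev (zip t (map transpose_mat X))"
    using assms by (simp add: zip_rev)
  have "map transpose_mat (map2 (elem_mat n m) t X) = map2 (elem_mat n m) t (map transpose_mat X)"
    using assms
  proof (induction t X rule: list_induct2')
    case (4 i t M X)
    then show ?case by (auto simp: elem_mat_transpose)
  qed auto
  then show ?thesis
    unfolding elem_prod_def mat_prod_transpose[OF elem_prod_carrier(1)[OF assms(2,3)]] z by (simp add: rev_map)
qed

section \<open>Index tuples\<close>

lemma climb_run:
  assumes "s \<noteq> b" "0 \<le> s"
  shows "climbable [a..b] s \<and> climb [a..b] s = (if s < b \<and> a \<le> s + 1 then s + 1 else s)"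
proof (cases "a \<le> b + 1")
  case True
  then show ?thesis
  proof (induction a rule: int_le_induct)
    case base
    then show ?case using assms by auto
  next
    case (step a)
    have "[a - 1..b] = (a - 1) # [a..b]" using step.hyps by (subst upto_rec1) auto
    then show ?case using step assms by auto
  qed
qed (use assms in auto)

lemma canonical_form_set:
  assumes "canonical_form k t" shows "set t \<subseteq> {0..int k - 2}"
  using assms unfolding canonical_form_def by auto

text \<open>
  The runs of a tuple in canonical form end at \<open>2q - 2, 2q - 4, \<dots>, 0\<close>, and the last run acts first. A
  run raises the height by at most one. So before the run ending at \<open>2d\<close> acts the height is at most \<open>max 1 d\<close>; it is therefore
  different from \<open>2d\<close>, and this rules out the obstruction in \<open>climb_run\<close>.
\<close>
lemma canonical_form_climb:
  assumes "canonical_form (2 * q) t" "1 \<le> q"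
  shows "climbable t 1 \<and> 1 \<le> climb t 1 \<and> climb t 1 \<le> int q"
proof -
  obtain a :: "nat \<Rightarrow> nat" where t: "t = concat (map (\<lambda>i. [int (a i) .. int (2 * q) - 2 * int i]) [1..<q + 1])"
    using assms(1) by (auto simp: canonical_form_def)
  define T where "T = (\<lambda>k. concat (map (\<lambda>i. [int (a i) .. int (2 * q) - 2 * int i]) [k..<q + 1]))"
  \<comment> \<open>\<open>T (q + 1 - d)\<close> consists of the last \<open>d\<close> runs\<close>
  have "climbable (T (q + 1 - d)) 1 \<and> 1 \<le> climb (T (q + 1 - d)) 1 \<and> climb (T (q + 1 - d)) 1 \<le> max 1 (int d)"
    if "d \<le> q" for d
    using that
  proof (induction d)
    case 0
    then show ?case by (simp add: T_def)
  next
    case (Suc d)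
    define k where "k = q - d"
    have k: "q + 1 - Suc d = k" "q + 1 - d = Suc k" "k < q + 1" "int (2 * q) - 2 * int k = 2 * int d"
      using Suc.prems by (auto simp: k_def)
    have T: "T k = [int (a k)..2 * int d] @ T (Suc k)"
      unfolding T_def using k(3,4) by (simp only: upt_conv_Cons list.map concat.simps)
    let ?s = "climb (T (Suc k)) 1"
    have ih: "climbable (T (Suc k)) 1" "1 \<le> ?s" "?s \<le> max 1 (int d)"
      using Suc unfolding k by auto
    then have "?s \<noteq> 2 * int d" by (cases d) auto
    from climb_run[OF this, of "int (a k)"] show ?case
      unfolding k T climb_append climbable_append using ih by (cases d) (auto split: if_splits)
  qed
  from this[of q] show ?thesis using assms(2) by (simp add: T_def t)
qed

text \<open>
  For even \<open>h = 2q\<close>, the tuple \<open>w_h\<close> without its last entry 0, and its complement \<open>c_{w_h}\<close>: the odd indices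
  below \<open>h\<close>, in descending order.
\<close>
abbreviation w_pairs :: "nat \<Rightarrow> int list" where
  "w_pairs q \<equiv> concat (map (\<lambda>j. [int (2 * q) - 1 - 2 * int j, int (2 * q) - 2 * int j]) [0..<q])"

abbreviation c_list :: "nat \<Rightarrow> int list" where
  "c_list q \<equiv> map (\<lambda>j. int (2 * q) - 1 - 2 * int j) [0..<q]"

lemma upto_two: "[a..a + 1] = [a, a + 1 :: int]"
  by (simp add: upto_rec1)

lemma pair_run: "[k - 1 - 2 * j..k - 2 * j] = [k - 1 - 2 * j, k - 2 * j :: int]"
  using upto_two[of "k - 1 - 2 * j"] by simp

lemma w_tuple_even: "w_tuple (2 * q) = w_pairs q @ [0]"
  by (simp add: w_tuple_def simple_admissible_def admissible_tuple_def pair_run)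

lemma cw_tuple_even: "cw_tuple (2 * q) = c_list q"
  by (simp add: cw_tuple_def simple_complement_def symmetric_complement_def)

lemma w_pairs_Suc: "w_pairs (Suc q) = [int (2 * q) + 1, int (2 * q) + 2] @ w_pairs q"
  by (simp add: upt_conv_Cons map_Suc_upt[symmetric] o_def algebra_simps del: upt_Suc)

lemma c_list_Suc: "c_list (Suc q) = (int (2 * q) + 1) # c_list q"
  by (simp add: upt_conv_Cons map_Suc_upt[symmetric] o_def algebra_simps del: upt_Suc)

text \<open>
  All pairs other than the last one, \<open>(1, 2)\<close>, have indices too large to move the column, and \<open>2\<close> acts before \<open>1\<close>. So
  the height is 1 unless there are no pairs.
\<close>
lemma w_pairs_climb: "climbable (w_pairs q) 0 \<and> climb (w_pairs q) 0 = (if q = 0 then 0 else 1)"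
proof (induction q)
  case (Suc q)
  then show ?case unfolding w_pairs_Suc by (cases q) (auto simp: climb_append climbable_append)
qed simp

lemma c_list_climb: "climbable (rev (c_list q)) 0 \<and> climb (rev (c_list q)) 0 = (if q = 0 then 0 else 1)"
proof (induction q)
  case (Suc q)
  have "climb [int (2 * q) + 1] 0 = (if q = 0 then 1 else 0)" "climbable [int (2 * q) + 1] 0" by auto
  then show ?case using Suc.IH unfolding c_list_Suc rev.simps climb_append climbable_append by (cases "q = 0") auto
qed simp

definition fiedler_coeff :: "(nat \<Rightarrow> complex mat) \<Rightarrow> int \<Rightarrow> complex mat" where
  "fiedler_coeff Ac i = (if i \<ge> 0 then - Ac (nat i) else Ac (nat (- i)))"

lemma fiedler_P_coeff: "fiedler_P n m Ac i = elem_mat n m i (fiedler_coeff Ac i)"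
  by (simp add: fiedler_P_def fiedler_coeff_def)

lemma fiedler_P_prod_elem_prod: "fiedler_P_prod n m Ac t = elem_prod n m t (map (fiedler_coeff Ac) t)"
proof -
  have "map (fiedler_P n m Ac) t = map2 (elem_mat n m) t (map (fiedler_coeff Ac) t)"
    by (induction t) (auto simp: fiedler_P_coeff)
  then show ?thesis by (simp add: fiedler_P_prod_def elem_prod_def)
qed

section \<open>Products of Fiedler matrices of the polynomial\<close>

locale fiedler_data =
  fixes n m :: nat and Ac :: "nat \<Rightarrow> complex mat"
  assumes m: "1 \<le> m" and Ac: "\<And>i. i \<le> m \<Longrightarrow> Ac i \<in> carrier_mat n n"
begin

abbreviation "F t \<equiv> fiedler_P_prod n m Ac t"
abbreviation "valid t \<equiv> set t \<subseteq> {- int m..<int m}"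

definition "apart t u \<longleftrightarrow> (\<forall>i\<in>set t. \<forall>j\<in>set u. 2 \<le> \<bar>\<bar>i\<bar> - \<bar>j\<bar>\<bar>)"
definition "spread t \<longleftrightarrow> (\<forall>i\<in>set t. \<forall>j\<in>set t. i = j \<or> 2 \<le> \<bar>\<bar>i\<bar> - \<bar>j\<bar>\<bar>)"

lemma coeff_carrier: "- int m \<le> i \<Longrightarrow> i < int m \<Longrightarrow> fiedler_coeff Ac i \<in> carrier_mat n n"
  using Ac by (auto simp: fiedler_coeff_def)

lemma fiedler_carrier: "- int m \<le> i \<Longrightarrow> i < int m \<Longrightarrow> fiedler_P n m Ac i \<in> carrier_mat (m * n) (m * n)"
  unfolding fiedler_P_coeff by (intro elem_mat_carrier coeff_carrier)

lemma fiedlers_carrier: "valid t \<Longrightarrow> set (map (fiedler_P n m Ac) t) \<subseteq> carrier_mat (m * n) (m * n)"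
  using fiedler_carrier by auto

lemma F_carrier: "valid t \<Longrightarrow> F t \<in> carrier_mat (m * n) (m * n)"
  unfolding fiedler_P_prod_def by (intro mat_prod_carrier fiedlers_carrier)

lemma F_append: "valid t \<Longrightarrow> valid u \<Longrightarrow> F (t @ u) = F t * F u"
  unfolding fiedler_P_prod_def map_append by (intro mat_prod_append fiedlers_carrier)

lemma fiedler_commute: "- int m \<le> i \<Longrightarrow> i < int m \<Longrightarrow> - int m \<le> j \<Longrightarrow> j < int m \<Longrightarrow> 2 \<le> \<bar>\<bar>i\<bar> - \<bar>j\<bar>\<bar> \<Longrightarrow>
   fiedler_P n m Ac i * fiedler_P n m Ac j = fiedler_P n m Ac j * fiedler_P n m Ac i"
  unfolding fiedler_P_coeff by (intro elem_mat_commute coeff_carrier)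

lemma F_commute: "valid t \<Longrightarrow> valid u \<Longrightarrow> apart t u \<Longrightarrow> F t * F u = F u * F t"
  unfolding fiedler_P_prod_def using fiedlers_carrier[of t] fiedlers_carrier[of u]
  by (intro mat_prod_swap) (auto simp: apart_def intro!: fiedler_commute)

text \<open>
  The factors of a spread tuple commute pairwise, and equal indices give equal factors.
\<close>
lemma F_rev: "valid t \<Longrightarrow> spread t \<Longrightarrow> F (rev t) = F t"
proof -
  assume t: "valid t" "spread t"
  have "M * M' = M' * M" if MM: "M \<in> set (map (fiedler_P n m Ac) t)" "M' \<in> set (map (fiedler_P n m Ac) t)" for M M'
  proof -
    obtain i j where ij: "i \<in> set t" "j \<in> set t" "M = fiedler_P n m Ac i" "M' = fiedler_P n m Ac j"
      using MM unfolding set_map by blast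
    show ?thesis
    proof (cases "i = j")
      case False
      then have "2 \<le> \<bar>\<bar>i\<bar> - \<bar>j\<bar>\<bar>" using t(2) ij by (auto simp: spread_def)
      then show ?thesis using ij t(1) by (auto intro!: fiedler_commute)
    qed (use ij in simp)
  qed
  then show "F (rev t) = F t" unfolding fiedler_P_prod_def rev_map[symmetric]
    using fiedlers_carrier[OF t(1)] by (intro mat_prod_rev) auto
qed

text \<open>
  Transposition reverses the order of the symmetric factors, which commute.
\<close>
lemma F_symmetric:
  assumes "valid t" "spread t" "\<And>i. i \<le> m \<Longrightarrow> symmetric_mat (Ac i)"
  shows "transpose_mat (F t) = F t"
proof -
  have c: "transpose_mat (fiedler_coeff Ac i) = fiedler_coeff Ac i" if "- int m \<le> i" "i < int m" for i
    using assms(3) that by (auto simp: fiedler_coeff_def symmetric_mat_def transpose_uminus)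
  have "transpose_mat (F t) = F (rev t)"
  proof -
    have "map transpose_mat (map (fiedler_coeff Ac) t) = map (fiedler_coeff Ac) t"
      using assms(1) by (auto intro!: c simp: subset_iff)
    moreover have "transpose_mat (elem_prod n m t (map (fiedler_coeff Ac) t))
        = elem_prod n m (rev t) (rev (map transpose_mat (map (fiedler_coeff Ac) t)))"
      using assms(1) coeff_carrier by (intro elem_prod_transpose) (auto simp: subset_iff)
    ultimately show ?thesis unfolding fiedler_P_prod_elem_prod by (simp only: rev_map)
  qed
  then show ?thesis using F_rev assms by simp
qed

text \<open>
  \<open>M_{-i}(- X)\<close> is inverse to \<open>M_i(X)\<close>, and the Fiedler matrices of \<open>i\<close> and \<open>- i\<close> carry opposite coefficients.
\<close>
lemma F_inverse:
  assumes "set t \<subseteq> {- int m<..<int m}" "0 \<notin> set t"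
  shows "F t * F (rev (map uminus t)) = 1\<^sub>m (m * n)"
  using assms
proof (induction t)
  case Nil
  then show ?case by (simp add: fiedler_P_prod_def)
next
  case (Cons i t)
  let ?N = "m * n" and ?r = "rev (map uminus t)"
  have v: "valid t" "valid ?r" "valid [i]" "valid [- i]" using Cons.prems by auto
  have c: "F t \<in> carrier_mat ?N ?N" "F ?r \<in> carrier_mat ?N ?N" "F [i] \<in> carrier_mat ?N ?N" "F [- i] \<in> carrier_mat ?N ?N"
    using v by (simp_all add: F_carrier del: set_rev)
  have one: "F [j] = fiedler_P n m Ac j" if "valid [j]" for j
    using fiedler_carrier[of j] that by (simp add: fiedler_P_prod_def)
  have i: "F [i] * F [- i] = 1\<^sub>m ?N"
  proof (cases "0 < i")
    case True
    then show ?thesis using elem_mat_inverse(1)[of i m "fiedler_coeff Ac i" n] coeff_carrier[of i] Cons.prems v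
      by (simp add: one fiedler_P_coeff) (simp add: fiedler_coeff_def)
  next
    case False
    then show ?thesis using elem_mat_inverse(2)[of "- i" m "fiedler_coeff Ac (- i)" n] coeff_carrier[of "- i"] Cons.prems v
      by (simp add: one fiedler_P_coeff) (simp add: fiedler_coeff_def)
  qed
  have "F (i # t) * F (rev (map uminus (i # t))) = (F [i] * F t) * (F ?r * F [- i])"
    using F_append[OF v(3,1)] F_append[OF v(2,4)] by simp
  also have "\<dots> = F [i] * (F t * F ?r) * F [- i]"
    using c by (simp add: assoc_mult_mat[of _ ?N ?N _ ?N _ ?N])
  also have "F t * F ?r = 1\<^sub>m ?N" using Cons by auto
  finally show ?case using c i by simp
qed

lemma F_invertible:
  assumes "valid t" "0 \<notin> set t" "- int m \<in> set t \<Longrightarrow> invertible_mat (Ac m)"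
  shows "invertible_mat (F t)"
  unfolding fiedler_P_prod_def
proof (rule mat_prod_invertible[OF fiedlers_carrier[OF assms(1)]])
  fix M assume "M \<in> set (map (fiedler_P n m Ac) t)"
  then obtain i where i: "i \<in> set t" "M = fiedler_P n m Ac i" by auto
  then show "invertible_mat M" unfolding i(2) fiedler_P_coeff
    using assms i(1) by (intro elem_mat_invertible coeff_carrier) (auto simp: fiedler_coeff_def)
qed

lemma neg_prod_F: "neg_prod n s Ac m = F (map (\<lambda>j. - int j) (filter s (rev [1..<m])))"
proof -
  have "map (\<lambda>j. cross n m (m - j - 1) (0\<^sub>m n n) (Ac j)) (filter s (rev [1..<m]))
    = map (fiedler_P n m Ac) (map (\<lambda>j. - int j) (filter s (rev [1..<m])))"
    by (auto simp: fiedler_P_coeff fiedler_coeff_def elem_mat_neg)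
  then show ?thesis unfolding neg_prod_def fiedler_P_prod_def by (simp only:)
qed

lemma pos_prod_F: "pos_prod n s Ac m = F (map int (filter (\<lambda>j. \<not> s j) (rev [1..<m])) @ [0])"
proof -
  let ?t = "map int (filter (\<lambda>j. \<not> s j) (rev [1..<m]))"
  have e: "map (\<lambda>j. cross n m (m - j - 1) (- Ac j) (0\<^sub>m n n)) (filter (\<lambda>j. \<not> s j) (rev [1..<m]))
    = map (fiedler_P n m Ac) ?t"
    by (auto simp: fiedler_P_coeff fiedler_coeff_def elem_mat_pos)
  have v: "valid ?t" "valid [0]" using m by auto
  have z: "F [0] = spot n m (m - 1) (- Ac 0)"
    using m Ac[of 0] fiedler_carrier[of 0] by (simp add: fiedler_P_prod_def fiedler_P_coeff fiedler_coeff_def elem_mat_zero)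
  show ?thesis unfolding F_append[OF v] z pos_prod_def e unfolding fiedler_P_prod_def ..
qed

lemma top_F: "spot n m 0 (Ac m) = F [- int m]"
  using m fiedler_carrier[of "- int m"] by (simp add: fiedler_P_prod_def fiedler_P_coeff fiedler_coeff_def elem_mat_top)

end

lemma pairs_F:
  assumes "fiedler_data n m Ac" "\<And>j. j < q \<Longrightarrow> - int m \<le> f j \<and> f j < int m" "\<And>j. j < q \<Longrightarrow> - int m \<le> g j \<and> g j < int m"
    "\<And>i j. i < j \<Longrightarrow> j < q \<Longrightarrow> 2 \<le> \<bar>\<bar>g i\<bar> - \<bar>f j\<bar>\<bar>"
  shows "fiedler_P_prod n m Ac (concat (map (\<lambda>j. [f j, g j]) [0..<q])) =
    fiedler_P_prod n m Ac (map f [0..<q]) * fiedler_P_prod n m Ac (map g [0..<q])"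
proof -
  interpret fiedler_data n m Ac by fact
  have "mat_prod (m * n) (concat (map (\<lambda>j. [fiedler_P n m Ac (f j), fiedler_P n m Ac (g j)]) [0..<q]))
    = mat_prod (m * n) (map (\<lambda>j. fiedler_P n m Ac (f j)) [0..<q]) * mat_prod (m * n) (map (\<lambda>j. fiedler_P n m Ac (g j)) [0..<q])"
    using assms(2-4) by (intro mat_prod_pairs) (auto simp: sorted_wrt_iff_nth_less intro!: fiedler_carrier fiedler_commute)
  then show ?thesis by (simp add: fiedler_P_prod_def map_concat o_def)
qed

lemma filter_odd_upt: "map int (filter odd (rev [1..<2 * q + 1])) = c_list q"
proof (induction q)
  case (Suc q)
  have "rev [1..<2 * Suc q + 1] = [2 * q + 2, 2 * q + 1] @ rev [1..<2 * q + 1]" by simp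
  then show ?case using Suc unfolding c_list_Suc by simp
qed simp

abbreviation e_list :: "nat \<Rightarrow> int list" where
  "e_list q \<equiv> map (\<lambda>j. int (2 * q) - 2 * int j) [0..<q]"

lemma e_list_Suc: "e_list (Suc q) = (int (2 * q) + 2) # e_list q"
  by (simp add: upt_conv_Cons map_Suc_upt[symmetric] o_def algebra_simps del: upt_Suc)

lemma filter_even_upt: "map int (filter even (rev [1..<2 * q + 1])) = e_list q"
proof (induction q)
  case (Suc q)
  have "rev [1..<2 * Suc q + 1] = [2 * q + 2, 2 * q + 1] @ rev [1..<2 * q + 1]" by simp
  then show ?case using Suc unfolding e_list_Suc by simp
qed simp

lemma filter_above:
  "filter odd [2 * q + 1..<2 * q + 1 + k] = map (\<lambda>j. 2 * q + 1 + 2 * j) [0..<(k + 1) div 2]"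
  "filter even [2 * q + 1..<2 * q + 1 + k] = map (\<lambda>j. 2 * q + 2 + 2 * j) [0..<k div 2]"
proof (induction k)
  case (Suc k)
  {
    case 1
    show ?case using Suc(1) by (cases "even k") (auto elim!: evenE oddE)
  next
    case 2
    show ?case using Suc(2) by (cases "even k") (auto elim!: evenE oddE)
  }
qed simp_all

section \<open>Factorization of the generalized Fiedler pencil\<close>

text \<open>
  The tuple \<open>w_h\<close> is admissible for \<open>{0:2q}\<close>, that is, \<open>h = 2q\<close>, and \<open>v_h + m\<close> for \<open>{0:k}\<close>. As \<open>h\<close> is even, \<open>k\<close> is odd
  exactly when \<open>m\<close> is even.
\<close>
locale gfpr = fiedler_data n m Ac for n m Ac +
  fixes q k :: nat and tw tv :: "int list" and X Y :: "complex mat list"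
  assumes m_eq: "m = 2 * q + 1 + k"
    and tw: "canonical_form (2 * q) tw" and tv: "canonical_form k (shift (int m) tv)"
    and X: "length X = length tw" "set X \<subseteq> carrier_mat n n" "nonsingular_assignment m tw X"
    and Y: "length Y = length tv" "set Y \<subseteq> carrier_mat n n" "nonsingular_assignment m tv Y"
begin

text \<open>
  Indices up to \<open>h\<close> are low, those above \<open>h\<close> are high and enter with a minus sign. The parameter \<open>l\<close> counts the entries: the
  even high indices are \<open>h + 2, \<dots>, h + 2l\<close>, the odd ones \<open>h + 1, \<dots>, h + 2l - 1\<close>.
\<close>
abbreviation "odd_low \<equiv> c_list q"
abbreviation "even_low \<equiv> e_list q"
abbreviation "even_high l \<equiv> map (\<lambda>j. - (int (2 * q) + 2 + 2 * int j)) [0..<l]"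
abbreviation "odd_high l \<equiv> map (\<lambda>j. - (int (2 * q) + 1 + 2 * int j)) [0..<l]"
abbreviation "top_if b \<equiv> (if b then [- int m] else [])"

lemma k_eq: "m - 2 * q - 1 = k"
  using m_eq by simp

lemma v_tuple_eq: "v_tuple m (2 * q) =
   concat (map (\<lambda>j. [- (int (2 * q) + 2 + 2 * int j), - (int (2 * q) + 1 + 2 * int j)]) [0..<(k + 1) div 2])
   @ top_if (even k)"
proof (cases "even k")
  case True
  then obtain l where l: "k = 2 * l" by blast
  have "v_tuple m (2 * q) = shift (- int m) (w_tuple (2 * l))"
    unfolding v_tuple_def k_eq l w_tuple_def ..
  also have "\<dots> = concat (map (\<lambda>j. [- (int (2 * q) + 2 + 2 * int j), - (int (2 * q) + 1 + 2 * int j)]) [0..<l]) @ [- int m]"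
    unfolding w_tuple_even shift_def using m_eq l by (simp add: map_concat o_def algebra_simps)
  finally show ?thesis using l by simp
next
  case False
  then obtain l where l: "k = 2 * l + 1" by (elim oddE)
  have "v_tuple m (2 * q) = shift (- int m) (concat (map (\<lambda>j. [int k - 1 - 2 * int j, int k - 2 * int j]) [0..<l]) @ [0, 1])"
    using l upto_two[of 0] unfolding v_tuple_def k_eq simple_admissible_def admissible_tuple_def pair_run by simp
  also have "\<dots> = concat (map (\<lambda>j. [- (int (2 * q) + 2 + 2 * int j), - (int (2 * q) + 1 + 2 * int j)]) [0..<l + 1])"
    unfolding shift_def using m_eq l by (simp add: map_concat o_def algebra_simps)
  finally show ?thesis using l by simp
qed

lemma cv_tuple_eq: "cv_tuple m (2 * q) = even_high ((k + 1) div 2)"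
proof (cases "even k")
  case True
  then obtain l where l: "k = 2 * l" by blast
  have "cv_tuple m (2 * q) = shift (- int m) (cw_tuple (2 * l))"
    unfolding cv_tuple_def k_eq l cw_tuple_def ..
  then show ?thesis
    unfolding cw_tuple_even shift_def using m_eq l by (simp add: o_def algebra_simps)
next
  case False
  then obtain l where l: "k = 2 * l + 1" by (elim oddE)
  have "cv_tuple m (2 * q) = shift (- int m) (map (\<lambda>j. int k - 1 - 2 * int j) [0..<l] @ [0])"
    using l unfolding cv_tuple_def k_eq simple_complement_def symmetric_complement_def by simp
  then show ?thesis
    unfolding shift_def using m_eq l by (simp add: o_def algebra_simps)
qed

text \<open>
  For even \<open>m\<close> the complement of \<open>v_h\<close> contains \<open>- m\<close>. This brings the Fiedler matrix of \<open>- m\<close> into \<open>R2\<close>, which has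
  to be invertible, and accounts for the assumption on \<open>A_m\<close>.
\<close>
lemma even_high_eq: "even_high ((k + 1) div 2) = even_high (k div 2) @ top_if (odd k)"
proof (cases "even k")
  case False
  then obtain l where l: "k = 2 * l + 1" by (elim oddE)
  then show ?thesis using m_eq by simp
qed simp

lemma valid_lists:
  "valid odd_low" "valid even_low" "valid (even_high (k div 2))" "valid (odd_high ((k + 1) div 2))" "valid (top_if b)"
  "valid [0]" "valid (even_low @ [0])" "valid (even_high ((k + 1) div 2))"
proof -
  have d: "j < k div 2 \<Longrightarrow> 2 * j + 2 \<le> k" "j < (k + 1) div 2 \<Longrightarrow> 2 * j + 1 \<le> k" for j
    by linarith+
  show "valid odd_low" "valid even_low" "valid (top_if b)" "valid [0]" "valid (even_low @ [0])" using m_eq by auto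
  show "valid (even_high (k div 2))" "valid (odd_high ((k + 1) div 2))" "valid (even_high ((k + 1) div 2))"
    using m_eq d by fastforce+
qed

end

lemma elem_prod_append:
  assumes "set t \<subseteq> {- int m..<int m}" "set X \<subseteq> carrier_mat n n" "length X = length t"
    "set u \<subseteq> {- int m..<int m}" "set Y \<subseteq> carrier_mat n n"
  shows "elem_prod n m (t @ u) (X @ Y) = elem_prod n m t X * elem_prod n m u Y"
  unfolding elem_prod_def using assms elem_prod_carrier(1)[OF assms(1,2)] elem_prod_carrier(1)[OF assms(4,5)]
  by (simp add: mat_prod_append)

lemma elem_prod_fixes_col:
  assumes "length X = length t" "set t \<subseteq> {- int m..<int m}" "set X \<subseteq> carrier_mat n n" "C \<in> carrier_mat n r"
    "0 \<le> s" "s < int m" "\<And>i. i \<in> set t \<Longrightarrow> \<bar>i\<bar> \<noteq> s \<and> \<bar>i\<bar> \<noteq> s + 1"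
  shows "elem_prod n m t X * elem_col n m s C = elem_col n m s C"
  using assms
proof (induction t arbitrary: X)
  case Nil
  have "elem_col n m s C \<in> carrier_mat (m * n) r" using Nil by (auto simp: elem_col_def)
  then show ?case using Nil by (simp add: elem_prod_def)
next
  case (Cons i t)
  then obtain M Ms where X: "X = M # Ms" by (cases X) auto
  have c: "elem_prod n m t Ms \<in> carrier_mat (m * n) (m * n)"
    using Cons.prems X by (intro elem_prod_carrier) auto
  have m: "elem_mat n m i M \<in> carrier_mat (m * n) (m * n)"
    using Cons.prems X by (intro elem_mat_carrier) auto
  have e: "elem_col n m s C \<in> carrier_mat (m * n) r" using Cons by (auto simp: elem_col_def)
  have "elem_prod n m (i # t) X * elem_col n m s C = elem_mat n m i M * (elem_prod n m t Ms * elem_col n m s C)"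
    using m c e X by (simp add: elem_prod_def assoc_mult_mat[of _ "m * n" "m * n" _ "m * n" _ r])
  also have "elem_prod n m t Ms * elem_col n m s C = elem_col n m s C"
    using Cons.prems X by (intro Cons.IH) auto
  also have "elem_mat n m i M * elem_col n m s C = elem_col n m s C"
    using Cons.prems X by (intro elem_col_fixed) auto
  finally show ?case .
qed

lemma elem_prod_invertible:
  assumes "length X = length t" "set t \<subseteq> {- int m..<int m}" "set X \<subseteq> carrier_mat n n" "nonsingular_assignment m t X"
  shows "invertible_mat (elem_prod n m t X)"
  unfolding elem_prod_def
proof (rule mat_prod_invertible[OF elem_prod_carrier(1)[OF assms(2,3)]])
  fix M assume "M \<in> set (map2 (elem_mat n m) t X)"
  then obtain j where j: "j < length t" "M = elem_mat n m (t ! j) (X ! j)"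
    using assms(1) by (auto simp: set_zip)
  have "X ! j \<in> carrier_mat n n" "t ! j \<in> {- int m..<int m}"
    using subsetD[OF assms(3) nth_mem[of j X]] subsetD[OF assms(2) nth_mem[of j t]] assms(1) j(1) by simp_all
  then show "invertible_mat M"
    unfolding j(2) using assms(4) j(1) by (intro elem_mat_invertible) (auto simp: nonsingular_assignment_def)
qed

context gfpr
begin

abbreviation "N \<equiv> m * n"
text \<open>
  \<open>Mo\<close> and \<open>Me\<close> collect the odd and the even low indices, so that the trailing Fiedler factor is \<open>Mo Me\<close>; \<open>N1\<close> and
  \<open>N2\<close> collect the even and the odd high ones (with \<open>- m\<close> in the appropriate factor), so that the leading Fiedler factor is \<open>N1 N2\<close>;
  the complement contributes \<open>Mo N1\<close>. \<open>N1'\<close> is \<open>N1\<close> without \<open>M_{-m}\<close>. The middle pencil is \<open>\<lambda> Tp Dn - Ep\<close>.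
\<close>
definition "Mo = F odd_low"
definition "Me = F (even_low @ [0])"
definition "N1 = F (even_high ((k + 1) div 2))"
definition "N1' = F (even_high (k div 2))"
definition "N2 = F (odd_high ((k + 1) div 2) @ top_if (even k))"
definition "Tp = F [- int m]"
definition "Dn = neg_prod n odd Ac m"
definition "Ep = pos_prod n odd Ac m"

lemma half_bounds: "j < k div 2 \<Longrightarrow> 2 * j + 2 \<le> k" "j < (k + 1) div 2 \<Longrightarrow> 2 * j + 1 \<le> k"
  by linarith+

lemma apart_facts:
  "apart odd_low (even_high l)" "apart odd_low (odd_high l)" "apart (even_low @ [0]) (even_high l)"
  "apart odd_low [- int m]" "even k \<Longrightarrow> apart (odd_high ((k + 1) div 2)) [- int m]"
  using m_eq by (auto simp: apart_def elim!: evenE)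

lemma spread_facts: "spread odd_low" "spread (even_low @ [0])" "spread (even_high l)" "spread (odd_high l)"
  "spread (odd_high ((k + 1) div 2) @ top_if (even k))"
proof -
  show "spread odd_low" "spread (even_low @ [0])" "spread (even_high l)" "spread (odd_high l)"
    by (auto simp: spread_def)
  show "spread (odd_high ((k + 1) div 2) @ top_if (even k))"
    using m_eq by (auto simp: spread_def elim!: evenE)
qed

lemma carriers: "Mo \<in> carrier_mat N N" "Me \<in> carrier_mat N N" "N1 \<in> carrier_mat N N" "N1' \<in> carrier_mat N N"
  "N2 \<in> carrier_mat N N" "Tp \<in> carrier_mat N N" "Dn \<in> carrier_mat N N" "Ep \<in> carrier_mat N N"
proof -
  have v: "valid (odd_high ((k + 1) div 2) @ top_if (even k))" "valid [- int m]"
    using valid_lists(4,5) m by simp_all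
  show "Mo \<in> carrier_mat N N" "Me \<in> carrier_mat N N" "N1 \<in> carrier_mat N N" "N1' \<in> carrier_mat N N"
    "N2 \<in> carrier_mat N N" "Tp \<in> carrier_mat N N"
    unfolding Mo_def Me_def N1_def N1'_def N2_def Tp_def by (intro F_carrier valid_lists v)+
  show "Dn \<in> carrier_mat N N" "Ep \<in> carrier_mat N N"
    unfolding Dn_def Ep_def using m Ac by (intro neg_prod_carrier pos_prod_carrier; simp)+
qed

lemma w_pairs_factor: "F (w_pairs q) = Mo * F even_low"
  unfolding Mo_def using m_eq by (intro pairs_F fiedler_data_axioms) auto

lemma w_factor: "F (w_tuple (2 * q)) = Mo * Me"
proof -
  have v: "valid (w_pairs q)" "valid [0]" using m_eq by auto
  have "F (w_tuple (2 * q)) = Mo * F even_low * F [0]"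
    unfolding w_tuple_even F_append[OF v] w_pairs_factor ..
  also have "\<dots> = Mo * (F even_low * F [0])"
    by (rule assoc_mult_mat[OF carriers(1) F_carrier[OF valid_lists(2)] F_carrier[OF valid_lists(6)]])
  finally show ?thesis unfolding Me_def F_append[OF valid_lists(2,6)] .
qed

lemma v_factor: "F (v_tuple m (2 * q)) = N1 * N2"
proof -
  let ?p = "concat (map (\<lambda>j. [- (int (2 * q) + 2 + 2 * int j), - (int (2 * q) + 1 + 2 * int j)]) [0..<(k + 1) div 2])"
  let ?o = "odd_high ((k + 1) div 2)"
  have b: "2 * int j + 1 \<le> int k" if "j < (k + 1) div 2" for j using half_bounds(2)[OF that] by linarith
  have v: "valid ?p" using m_eq b by (auto 0 4)
  have p: "F ?p = N1 * F ?o"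
    unfolding N1_def using m_eq b by (intro pairs_F fiedler_data_axioms) auto
  have "F (v_tuple m (2 * q)) = N1 * F ?o * F (top_if (even k))"
    unfolding v_tuple_eq F_append[OF v valid_lists(5)] p ..
  also have "\<dots> = N1 * (F ?o * F (top_if (even k)))"
    by (rule assoc_mult_mat[OF carriers(3) F_carrier[OF valid_lists(4)] F_carrier[OF valid_lists(5)]])
  finally show ?thesis unfolding N2_def F_append[OF valid_lists(4,5)] .
qed

lemma c_factor: "F (cw_tuple (2 * q) @ cv_tuple m (2 * q)) = Mo * N1"
  unfolding cw_tuple_even cv_tuple_eq F_append[OF valid_lists(1,8)] Mo_def N1_def ..

lemma N1_split: "N1 = (if even k then N1' else N1' * Tp)"
  unfolding N1_def even_high_eq F_append[OF valid_lists(3,5)] N1'_def Tp_def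
  using F_carrier[OF valid_lists(3)] by (auto simp: fiedler_P_prod_def)

lemma N2_split: "N2 = (if even k then F (odd_high ((k + 1) div 2)) * Tp else F (odd_high ((k + 1) div 2)))"
  unfolding N2_def F_append[OF valid_lists(4,5)] Tp_def
  using F_carrier[OF valid_lists(4)] by (auto simp: fiedler_P_prod_def)

lemma commutes: "Mo * N1 = N1 * Mo" "Mo * N1' = N1' * Mo" "Mo * N2 = N2 * Mo" "Me * N1 = N1 * Me" "Mo * Tp = Tp * Mo"
proof -
  have a: "apart odd_low (odd_high ((k + 1) div 2) @ top_if (even k))"
    using apart_facts(2,4) by (auto simp: apart_def)
  have v: "valid (odd_high ((k + 1) div 2) @ top_if (even k))" using valid_lists(4,5) by auto
  show "Mo * N1 = N1 * Mo" unfolding Mo_def N1_def by (intro F_commute valid_lists apart_facts)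
  show "Mo * N1' = N1' * Mo" unfolding Mo_def N1'_def by (intro F_commute valid_lists apart_facts)
  show "Mo * N2 = N2 * Mo" unfolding Mo_def N2_def by (intro F_commute valid_lists v a)
  show "Me * N1 = N1 * Me" unfolding Me_def N1_def by (intro F_commute valid_lists apart_facts)
  show "Mo * Tp = Tp * Mo" unfolding Mo_def Tp_def using valid_lists(5)[of True] by (intro F_commute valid_lists apart_facts) auto
qed

lemma upt_split: "[1..<m] = [1..<2 * q + 1] @ [2 * q + 1..<2 * q + 1 + k]"
  unfolding m_eq by (rule upt_add_eq_append) simp

text \<open>
  \<open>N1'\<close> consists of the inverses of the factors of \<open>Ep\<close> with indices above \<open>h\<close>.
\<close>
lemma pos_part: "N1' * Ep = Me"
proof -
  let ?r = "rev (map uminus (even_high (k div 2)))"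
  have v: "valid ?r" using valid_lists(3) half_bounds(1) m_eq by fastforce
  have "map int (filter (\<lambda>j. \<not> odd j) (rev [1..<m])) = ?r @ even_low"
  proof -
    have "map int (filter even (rev [1..<m]))
       = rev (map int (filter even [2 * q + 1..<2 * q + 1 + k])) @ map int (filter even (rev [1..<2 * q + 1]))"
      unfolding upt_split by (simp add: rev_map rev_filter)
    also have "\<dots> = ?r @ even_low"
      unfolding filter_even_upt filter_above by (simp add: o_def)
    finally show ?thesis by simp
  qed
  then have "Ep = F ?r * Me"
    unfolding Ep_def pos_prod_F Me_def using F_append[OF v valid_lists(7)] by simp
  moreover have "N1' * F ?r = 1\<^sub>m N"
    unfolding N1'_def using half_bounds(1) m_eq by (intro F_inverse) fastforce+
  ultimately show ?thesis
    using carriers F_carrier[OF v] by (simp add: assoc_mult_mat[of _ N N _ N _ N, symmetric])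
qed

lemma zero_notin_odd_low: "0 \<notin> set odd_low"
proof -
  have "2 * int q - 1 \<noteq> 2 * int j" for j by presburger
  then show ?thesis by auto
qed

text \<open>
  \<open>Mo\<close> consists of the inverses of the factors of \<open>Dn\<close> with indices below \<open>h\<close>.
\<close>
lemma neg_part: "Mo * Dn = F (odd_high ((k + 1) div 2))"
proof -
  let ?r = "rev (map uminus odd_low)" and ?o = "odd_high ((k + 1) div 2)"
  have v: "valid ?r" using m_eq by auto
  have l: "map (\<lambda>j. - int j) (filter odd [1..<m]) = ?r @ ?o"
  proof -
    have "map (\<lambda>j. - int j) (filter odd [1..<m])
      = map (\<lambda>j. - int j) (filter odd [1..<2 * q + 1]) @ map (\<lambda>j. - int j) (filter odd [2 * q + 1..<2 * q + 1 + k])"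
      unfolding upt_split by simp
    also have "map (\<lambda>j. - int j) (filter odd [1..<2 * q + 1]) = rev (map uminus (map int (filter odd (rev [1..<2 * q + 1]))))"
      by (simp add: rev_map rev_filter o_def)
    finally show ?thesis unfolding filter_odd_upt filter_above by (simp add: o_def)
  qed
  have "valid (?r @ ?o)" using v valid_lists(4) by simp
  moreover have "spread (?r @ ?o)"
    unfolding l[symmetric] by (auto simp: spread_def elim!: oddE)
  ultimately have "F (rev (?r @ ?o)) = F (?r @ ?o)" by (rule F_rev)
  moreover have "Dn = F (rev (?r @ ?o))"
    unfolding Dn_def neg_prod_F l[symmetric] by (simp add: rev_map rev_filter)
  ultimately have "Dn = F ?r * F ?o" using F_append[OF v valid_lists(4)] by simp
  moreover have "Mo * F ?r = 1\<^sub>m N"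
    unfolding Mo_def
    using zero_notin_odd_low m_eq by (intro F_inverse) auto
  ultimately show ?thesis
    using carriers F_carrier[OF v] F_carrier[OF valid_lists(4)] by (simp add: assoc_mult_mat[of _ N N _ N _ N, symmetric])
qed

text \<open>
  Together with \<open>v_core\<close>, this extracts the same left factor \<open>N1' Mo\<close> from the trailing and the leading coefficient,
  leaving the parts of the middle pencil.
\<close>
lemma w_core: "Mo * Me = N1' * Mo * Ep"
proof -
  have "N1' * Mo * Ep = Mo * (N1' * Ep)"
    unfolding commutes(2)[symmetric] using carriers by (intro assoc_mult_mat) auto
  then show ?thesis unfolding pos_part by simp
qed

lemma v_core: "N1 * N2 = N1' * Mo * (Tp * Dn)"
proof -
  let ?o = "F (odd_high ((k + 1) div 2))"
  have o: "?o \<in> carrier_mat N N" by (rule F_carrier[OF valid_lists(4)])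
  have "Mo * (Tp * Dn) = Tp * (Mo * Dn)"
  proof -
    have "Mo * (Tp * Dn) = Mo * Tp * Dn" using carriers by (intro assoc_mult_mat[symmetric]) auto
    also have "\<dots> = Tp * (Mo * Dn)" unfolding commutes(5) using carriers by (intro assoc_mult_mat) auto
    finally show ?thesis .
  qed
  then have "N1' * Mo * (Tp * Dn) = N1' * (Tp * ?o)"
    using carriers neg_part by (simp add: assoc_mult_mat[of _ N N _ N _ N])
  moreover have "N1 * N2 = N1' * (Tp * ?o)"
  proof (cases "even k")
    case True
    have "?o * Tp = Tp * ?o" unfolding Tp_def
      using True valid_lists(4) valid_lists(5)[of True] by (intro F_commute apart_facts) auto
    then show ?thesis using True unfolding N1_split N2_split by simp
  next
    case False
    then show ?thesis using carriers o unfolding N1_split N2_split by (simp add: assoc_mult_mat[of _ N N _ N _ N])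
  qed
  ultimately show ?thesis by simp
qed

lemma tuple_ranges: "set tw \<subseteq> {0..int (2 * q) - 2}" "set tv \<subseteq> {- int m..- int (2 * q) - 3}"
  "valid tw" "valid tv"
proof -
  show 1: "set tw \<subseteq> {0..int (2 * q) - 2}" using canonical_form_set[OF tw] by simp
  have "set (shift (int m) tv) \<subseteq> {0..int k - 2}" using canonical_form_set[OF tv] .
  then show 2: "set tv \<subseteq> {- int m..- int (2 * q) - 3}" using m_eq by (auto simp: shift_def)
  show "valid tw" using 1 m_eq by auto
  show "valid tv" using 2 by force
qed

text \<open>
  \<open>Rl\<close> and \<open>Rr\<close> are the outer factors with the assigned matrices; \<open>R1\<close> and \<open>R2\<close> are all that surrounds the middle pencil.
\<close>
definition "Rl = elem_prod n m (tv @ tw) (Y @ X)"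
definition "Rr = elem_prod n m (rev tw @ rev tv) (rev X @ rev Y)"
definition "R1 = Rl * (N1' * Mo)"
definition "R2 = Mo * N1 * Rr"

lemma R_carriers: "Rl \<in> carrier_mat N N" "Rr \<in> carrier_mat N N" "R1 \<in> carrier_mat N N" "R2 \<in> carrier_mat N N"
proof -
  show 1: "Rl \<in> carrier_mat N N" "Rr \<in> carrier_mat N N"
    unfolding Rl_def Rr_def using tuple_ranges(3,4) X(2) Y(2) by (intro elem_prod_carrier; simp)+
  show "R1 \<in> carrier_mat N N" "R2 \<in> carrier_mat N N"
    unfolding R1_def R2_def using 1 carriers by (auto intro!: mult_carrier_mat[of _ _ N])
qed

lemma nonsing_append: "nonsingular_assignment m (tv @ tw) (Y @ X)"
  using X Y unfolding nonsingular_assignment_def by (auto simp: nth_append)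

lemma nonsing_rev: "nonsingular_assignment m t Z \<Longrightarrow> length Z = length t \<Longrightarrow> nonsingular_assignment m (rev t) (rev Z)"
  unfolding nonsingular_assignment_def by (auto simp: rev_nth)

lemma R_invertible:
  assumes "odd k \<Longrightarrow> invertible_mat (Ac m)"
  shows "invertible_mat R1" "invertible_mat R2"
proof -
  have l: "invertible_mat Rl" unfolding Rl_def
    using tuple_ranges X Y nonsing_append by (intro elem_prod_invertible) auto
  have "invertible_mat (elem_prod n m (rev (tv @ tw)) (rev (Y @ X)))"
    using tuple_ranges X Y nonsing_rev[OF nonsing_append] by (intro elem_prod_invertible) auto
  then have r: "invertible_mat Rr" unfolding Rr_def by simp
  have b: "\<And>j. j < k div 2 \<Longrightarrow> 2 * int j + 2 \<le> int k" using half_bounds(1) by force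
  have "- int m \<notin> set (even_high (k div 2))" using m_eq b by fastforce
  moreover have "- int m \<notin> set (even_high ((k + 1) div 2))" if "even k"
    using calculation that by simp
  ultimately have t: "- int m \<notin> set (even_high (k div 2))" "even k \<Longrightarrow> - int m \<notin> set (even_high ((k + 1) div 2))"
    by blast+
  have lo: "0 \<notin> set odd_low" "- int m \<notin> set odd_low" using zero_notin_odd_low by auto
  have hi: "0 \<notin> set (even_high l)" for l by auto
  have "invertible_mat Mo" unfolding Mo_def using F_invertible[OF valid_lists(1) lo(1)] lo(2) by blast
  moreover have "invertible_mat N1" unfolding N1_def
    using F_invertible[OF valid_lists(8) hi] t(2) assms by blast
  moreover have "invertible_mat N1'" unfolding N1'_def using F_invertible[OF valid_lists(3) hi] t(1) by blast
  ultimately have o: "invertible_mat Mo" "invertible_mat N1" "invertible_mat N1'" by auto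
  show "invertible_mat R1" "invertible_mat R2"
    unfolding R1_def R2_def using l r o R_carriers carriers
    by (auto intro!: invertible_mat_mult[of _ N] mult_carrier_mat[of _ _ N])
qed

text \<open>
  The height to which the Fiedler factor of \<open>w_h\<close> lifts the last block column; \<open>top_col\<close> is the final height.
\<close>
definition "\<sigma> = (if q = 0 then 0 else 1 :: int)"
definition "top_col = climb tw \<sigma>"

lemma tw_climb: "climbable tw \<sigma>" "0 \<le> top_col" "top_col \<le> int (2 * q)" "top_col < int m"
proof -
  have "climbable tw \<sigma> \<and> 0 \<le> top_col \<and> top_col \<le> int (2 * q)"
  proof (cases "q = 0")
    case True
    then have "tw = []" using tw by (simp add: canonical_form_def)
    then have "top_col = 0" "climbable tw \<sigma>" unfolding top_col_def \<sigma>_def using True by simp_all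
    then show ?thesis by simp
  next
    case False
    then show ?thesis using canonical_form_climb[OF tw] by (auto simp: top_col_def \<sigma>_def)
  qed
  then show "climbable tw \<sigma>" "0 \<le> top_col" "top_col \<le> int (2 * q)" "top_col < int m" using m_eq by auto
qed

lemma i0_top_col: "int (i0 (tw @ w_tuple (2 * q))) = top_col"
proof -
  have "climb (tw @ w_tuple (2 * q)) (- 1) = top_col"
    unfolding w_tuple_even top_col_def \<sigma>_def using w_pairs_climb[of q] by (simp add: climb_append)
  then show ?thesis using i0_eq_climb[of "tw @ w_tuple (2 * q)"] tw_climb(2) by simp
qed

lemma sigma_bounds: "0 \<le> \<sigma>" "\<sigma> < int m" "\<sigma> \<le> int (2 * q)"
  using m_eq by (auto simp: \<sigma>_def)

text \<open>
  Stated for arbitrary assignments, since the border row of the pencil is handled by transposition,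
  which transposes the assigned matrices. The indices in \<open>tv\<close> are too large in absolute value to move the column.
\<close>
lemma outer_col:
  assumes "length X' = length tw" "set X' \<subseteq> carrier_mat n n" "length Y' = length tv" "set Y' \<subseteq> carrier_mat n n"
    and C: "C \<in> carrier_mat n r"
  shows "elem_prod n m (tv @ tw) (Y' @ X') * elem_col n m \<sigma> C = elem_col n m top_col C"
proof -
  have c: "elem_prod n m tv Y' \<in> carrier_mat N N" "elem_prod n m tw X' \<in> carrier_mat N N"
    "elem_col n m \<sigma> C \<in> carrier_mat N r"
    using tuple_ranges assms by (auto intro!: elem_prod_carrier simp: elem_col_def)
  have "elem_prod n m (tv @ tw) (Y' @ X') * elem_col n m \<sigma> C
     = elem_prod n m tv Y' * (elem_prod n m tw X' * elem_col n m \<sigma> C)"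
    using elem_prod_append[OF tuple_ranges(4) assms(4,3) tuple_ranges(3) assms(2)] assoc_mult_mat[OF c] by simp
  also have "elem_prod n m tw X' * elem_col n m \<sigma> C = elem_col n m top_col C"
    unfolding top_col_def using assms tuple_ranges(1) tw_climb(1) sigma_bounds m_eq
    by (intro elem_prod_climb) auto
  also have "elem_prod n m tv Y' * elem_col n m top_col C = elem_col n m top_col C"
  proof (rule elem_prod_fixes_col)
    fix i assume "i \<in> set tv"
    then have "i \<le> - int (2 * q) - 3" using tuple_ranges(2) by auto
    then show "\<bar>i\<bar> \<noteq> top_col \<and> \<bar>i\<bar> \<noteq> top_col + 1" using tw_climb by auto
  qed (use assms tuple_ranges tw_climb in auto)
  finally show ?thesis .
qed

lemma coeffs_carrier: "valid t \<Longrightarrow> set (map (fiedler_coeff Ac) t) \<subseteq> carrier_mat n n"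
  using coeff_carrier by (auto simp: subset_iff)

lemma F_climb:
  assumes "C \<in> carrier_mat n r" "set t \<subseteq> {0..<int m}" "0 \<le> s" "s < int m" "climbable t s"
  shows "F t * elem_col n m s C = elem_col n m (climb t s) C"
  unfolding fiedler_P_prod_elem_prod using assms
  by (intro elem_prod_climb coeffs_carrier) auto

lemma F_fixes_col:
  assumes "C \<in> carrier_mat n r" "valid t" "0 \<le> s" "s < int m" "\<And>i. i \<in> set t \<Longrightarrow> \<bar>i\<bar> \<noteq> s \<and> \<bar>i\<bar> \<noteq> s + 1"
  shows "F t * elem_col n m s C = elem_col n m s C"
  unfolding fiedler_P_prod_elem_prod using assms
  by (intro elem_prod_fixes_col coeffs_carrier) auto

lemma w_pairs_col: "C \<in> carrier_mat n r \<Longrightarrow> F (w_pairs q) * elem_col n m 0 C = elem_col n m \<sigma> C"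
proof -
  assume C: "C \<in> carrier_mat n r"
  have "set (w_pairs q) \<subseteq> {0..<int m}" using m_eq by auto
  then have "F (w_pairs q) * elem_col n m 0 C = elem_col n m (climb (w_pairs q) 0) C"
    using C m w_pairs_climb[of q] by (intro F_climb) auto
  then show ?thesis using w_pairs_climb[of q] by (simp only: \<sigma>_def)
qed

lemma Mo_col: "C \<in> carrier_mat n r \<Longrightarrow> Mo * elem_col n m 0 C = elem_col n m \<sigma> C"
proof -
  assume C: "C \<in> carrier_mat n r"
  have e: "elem_col n m 0 C \<in> carrier_mat N r" using C by (simp add: elem_col_def)
  have "F even_low * elem_col n m 0 C = elem_col n m 0 C"
    using C valid_lists(2) m by (intro F_fixes_col) auto
  then have "Mo * elem_col n m 0 C = F (w_pairs q) * elem_col n m 0 C"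
    unfolding w_pairs_factor using assoc_mult_mat[OF carriers(1) F_carrier[OF valid_lists(2)] e] by simp
  then show ?thesis using w_pairs_col[OF C] by simp
qed

text \<open>
  The border of the pencil sits in the same block column whether it comes from the middle pencil through \<open>R1\<close>
  or from the Fiedler factor of \<open>w_h\<close> in the definition of the bordered pencil.
\<close>
lemma R1_col:
  assumes C: "C \<in> carrier_mat n r"
  shows "R1 * elem_col n m 0 C = elem_col n m top_col C" "Rl * (F (w_pairs q) * elem_col n m 0 C) = elem_col n m top_col C"
proof -
  have e: "elem_col n m 0 C \<in> carrier_mat N r" using C by (simp add: elem_col_def)
  have Rl: "Rl * elem_col n m \<sigma> C = elem_col n m top_col C"
    unfolding Rl_def using X Y C by (intro outer_col) auto
  have "N1' * elem_col n m \<sigma> C = elem_col n m \<sigma> C"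
    unfolding N1'_def using C valid_lists(3) sigma_bounds
    by (intro F_fixes_col) (auto simp: \<sigma>_def split: if_splits)
  then have "R1 * elem_col n m 0 C = Rl * elem_col n m \<sigma> C"
    unfolding R1_def using Mo_col[OF C] carriers R_carriers e
    by (simp add: assoc_mult_mat[of _ N N _ N _ r])
  then show "R1 * elem_col n m 0 C = elem_col n m top_col C" using Rl by simp
  show "Rl * (F (w_pairs q) * elem_col n m 0 C) = elem_col n m top_col C"
    using w_pairs_col[OF C] Rl by simp
qed

lemma R2_row:
  assumes C: "C \<in> carrier_mat n r"
  shows "transpose_mat (elem_col n m 0 C) * R2 = transpose_mat (elem_col n m top_col C)"
proof -
  have e: "elem_col n m s C \<in> carrier_mat N r" for s using C by (simp add: elem_col_def)
  let ?X = "map transpose_mat X" and ?Y = "map transpose_mat Y"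
  have tX: "set ?X \<subseteq> carrier_mat n n" "set ?Y \<subseteq> carrier_mat n n" using X Y by auto
  have tR: "transpose_mat Rr = elem_prod n m (tv @ tw) (?Y @ ?X)"
    unfolding Rr_def using tuple_ranges X Y by (subst elem_prod_transpose) (auto simp: rev_map)
  have tF: "transpose_mat (F t) = elem_prod n m (rev t) (rev (map transpose_mat (map (fiedler_coeff Ac) t)))" if "valid t" for t
    unfolding fiedler_P_prod_elem_prod using that coeffs_carrier by (intro elem_prod_transpose) auto
  have ct: "set (rev (map transpose_mat (map (fiedler_coeff Ac) t))) \<subseteq> carrier_mat n n" if "valid t" for t
    using coeffs_carrier[OF that] by auto
  have o: "transpose_mat Mo * elem_col n m 0 C = elem_col n m \<sigma> C"
  proof -
    have "elem_prod n m (rev odd_low) (rev (map transpose_mat (map (fiedler_coeff Ac) odd_low))) * elem_col n m 0 C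
      = elem_col n m (climb (rev odd_low) 0) C"
      using C ct[OF valid_lists(1)] c_list_climb[of q] m_eq by (intro elem_prod_climb) auto
    then show ?thesis unfolding Mo_def tF[OF valid_lists(1)] using c_list_climb[of q] by (simp add: \<sigma>_def)
  qed
  have n1: "transpose_mat N1 * elem_col n m \<sigma> C = elem_col n m \<sigma> C"
    unfolding N1_def tF[OF valid_lists(8)]
  proof (rule elem_prod_fixes_col[OF _ _ ct[OF valid_lists(8)] C sigma_bounds(1,2)])
    show "valid (rev (even_high ((k + 1) div 2)))" using valid_lists(8) by simp
  qed (auto simp: \<sigma>_def split: if_splits)
  have "transpose_mat R2 = transpose_mat Rr * (transpose_mat N1 * transpose_mat Mo)"
    unfolding R2_def using carriers R_carriers by (simp add: transpose_mult[of _ N N _ N])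
  then have "transpose_mat R2 * elem_col n m 0 C = transpose_mat Rr * elem_col n m \<sigma> C"
    using carriers R_carriers e[of 0] o n1 by (simp add: assoc_mult_mat[of _ N N _ N _ r])
  also have "\<dots> = elem_col n m top_col C"
    unfolding tR using X Y tX C by (intro outer_col) auto
  finally have "transpose_mat (transpose_mat R2 * elem_col n m 0 C) = transpose_mat (elem_col n m top_col C)" by simp
  then show ?thesis using R_carriers(4) e[of 0] by (simp add: transpose_mult[of _ N N _ r])
qed

text \<open>
  The factors are symmetric, and \<open>Mo\<close> commutes with \<open>N1\<close> and \<open>N2\<close>, and \<open>N1\<close> with \<open>Me\<close>. So the products are
  \<open>N1 (N2 Mo) N1\<close> and \<open>Mo (Me N1) Mo\<close>, with symmetric matrices in parentheses.
\<close>
lemma core_symmetric: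
  assumes "\<And>i. i \<le> m \<Longrightarrow> symmetric_mat (Ac i)"
  shows "transpose_mat (N1 * N2 * (Mo * N1)) = N1 * N2 * (Mo * N1)"
    "transpose_mat (Mo * Me * (Mo * N1)) = Mo * Me * (Mo * N1)"
proof -
  have v: "valid (odd_high ((k + 1) div 2) @ top_if (even k))" using valid_lists(4,5) by auto
  have s: "transpose_mat N1 = N1" "transpose_mat N2 = N2" "transpose_mat Mo = Mo" "transpose_mat Me = Me"
    unfolding N1_def N2_def Mo_def Me_def by (intro F_symmetric valid_lists spread_facts v assms; assumption)+
  note am = assoc_mult_mat[of _ N N _ N _ N]
  have "transpose_mat (N1 * N2 * (Mo * N1)) = N1 * Mo * (N2 * N1)"
    using carriers by (simp add: transpose_mult[of _ N N _ N] s)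
  also have "\<dots> = N1 * (Mo * N2) * N1" using carriers by (simp add: am)
  also have "\<dots> = N1 * N2 * (Mo * N1)" unfolding commutes(3) using carriers by (simp add: am)
  finally show "transpose_mat (N1 * N2 * (Mo * N1)) = N1 * N2 * (Mo * N1)" .
  have "transpose_mat (Mo * Me * (Mo * N1)) = (N1 * Mo) * (Me * Mo)"
    using carriers by (simp add: transpose_mult[of _ N N _ N] s)
  also have "\<dots> = Mo * (N1 * Me) * Mo" unfolding commutes(1)[symmetric] using carriers by (simp add: am)
  also have "\<dots> = Mo * Me * (N1 * Mo)" unfolding commutes(4)[symmetric] using carriers by (simp add: am)
  finally show "transpose_mat (Mo * Me * (Mo * N1)) = Mo * Me * (Mo * N1)" unfolding commutes(1)[symmetric] .
qed

definition "lead = Rl * (N1 * N2 * (Mo * N1)) * Rr"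
definition "trail = Rl * (Mo * Me * (Mo * N1)) * Rr"

lemma lead_trail_carrier: "lead \<in> carrier_mat N N" "trail \<in> carrier_mat N N"
  unfolding lead_def trail_def using carriers R_carriers by (auto intro!: mult_carrier_mat[of _ _ N])

lemma lead_trail_factor: "lead = R1 * (Tp * Dn) * R2" "trail = R1 * Ep * R2"
  unfolding lead_def trail_def R1_def R2_def v_core w_core using carriers R_carriers
  by (simp_all add: assoc_mult_mat[of _ N N _ N _ N] mult_carrier_mat[of _ N N _ N])

lemma lead_trail_symmetric:
  assumes "\<And>i. i \<le> m \<Longrightarrow> symmetric_mat (Ac i)" "\<forall>M\<in>set X \<union> set Y. symmetric_mat M"
  shows "transpose_mat lead = lead" "transpose_mat trail = trail"
proof -
  have "map transpose_mat (Y @ X) = Y @ X"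
    using assms(2) by (intro map_idI) (auto simp: symmetric_mat_def)
  then have R: "transpose_mat Rl = Rr"
    unfolding Rl_def Rr_def using tuple_ranges X Y by (subst elem_prod_transpose) (auto simp del: map_append)
  then have R': "transpose_mat Rr = Rl" using transpose_transpose[of Rl] by simp
  have *: "transpose_mat (Rl * M * Rr) = Rl * M * Rr" if "M \<in> carrier_mat N N" "transpose_mat M = M" for M
    using that R_carriers by (simp add: transpose_mult[of _ N N _ N] R R' assoc_mult_mat[of _ N N _ N _ N])
  show "transpose_mat lead = lead" "transpose_mat trail = trail"
    unfolding lead_def trail_def using carriers core_symmetric[OF assms(1)]
    by (auto intro!: * mult_carrier_mat[of _ _ N])
qed

lemma L_P_eq: "L_P n m Ac (2 * q) tw tv X Y = [:0, 1:] \<cdot>\<^sub>m const_mat lead - const_mat trail"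
proof -
  let ?x = "[:0, 1:] :: complex poly"
  have c: "N1 * N2 \<in> carrier_mat N N" "Mo * Me \<in> carrier_mat N N" "Mo * N1 \<in> carrier_mat N N"
    using carriers by (auto intro!: mult_carrier_mat[of _ _ N])
  have "L_P n m Ac (2 * q) tw tv X Y = const_mat Rl * (?x \<cdot>\<^sub>m const_mat (N1 * N2) - const_mat (Mo * Me)) * const_mat (Mo * N1) * const_mat Rr"
    unfolding L_P_def v_factor w_factor c_factor Rl_def[symmetric] Rr_def[symmetric] ..
  also have "\<dots> = ?x \<cdot>\<^sub>m (const_mat Rl * const_mat (N1 * N2) * const_mat (Mo * N1) * const_mat Rr)
      - const_mat Rl * const_mat (Mo * Me) * const_mat (Mo * N1) * const_mat Rr"
    using c R_carriers
    by (simp add: mult_minus_distrib_mat[of _ N N _ N] minus_mult_distrib_mat[of _ N N _ _ N] mult_smult_distrib[of _ N N _ N]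
        mult_smult_assoc_mat[of _ N N _ N] mult_carrier_mat[of _ N N _ N])
  also have "\<dots> = ?x \<cdot>\<^sub>m const_mat lead - const_mat trail"
    unfolding lead_def trail_def using c R_carriers
    by (simp add: const_mat_mult[of _ N N _ N] assoc_mult_mat[of _ N N _ N _ N] mult_carrier_mat[of _ N N _ N])
  finally show ?thesis .
qed

end

section \<open>The bordered pencil\<close>

lemma kron_e_col:
  assumes "s < m" "C \<in> carrier_mat n r"
  shows "kron (e_col m (m - s)) C = elem_col n m (int s) C"
proof (rule eq_matI)
  fix p c assume "p < dim_row (elem_col n m (int s) C)" "c < dim_col (elem_col n m (int s) C)"
  then have pc: "p < m * n" "c < r" using assms by (auto simp: elem_col_def plc_def)
  then have n: "0 < n" by (cases n) auto
  have d: "p div n < m" using pc(1) by (simp add: less_mult_imp_div_less)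
  define b where "b = m - 1 - s"
  have b: "m - s - 1 = b" "b < m" using assms by (auto simp: b_def)
  have iff: "p div n = b \<longleftrightarrow> b * n \<le> p \<and> p < b * n + n"
    using n by (metis add.commute div_nat_eqI mult_Suc mult.commute dividend_less_times_div times_div_less_eq_dividend)
  have md: "p mod n = p - b * n" if "p div n = b" using that by (metis minus_div_mult_eq_mod)
  have "kron (e_col m (m - s)) C $$ (p, c) = (if p div n = b then C $$ (p mod n, c) else 0)"
    using pc d b assms by (auto simp: kron_def e_col_def mat_of_cols_def b)
  then show "kron (e_col m (m - s)) C $$ (p, c) = elem_col n m (int s) C $$ (p, c)"
    using pc assms iff md by (auto simp: elem_col_def plc_def b_def)
qed (use assms in \<open>auto simp: kron_def e_col_def elem_col_def plc_def\<close>)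

lemma kron_transpose_mat:
  fixes M N :: "complex mat"
  shows "kron (transpose_mat M) (transpose_mat N) = transpose_mat (kron M N)"
proof (rule eq_matI)
  fix i j assume "i < dim_row (transpose_mat (kron M N))" "j < dim_col (transpose_mat (kron M N))"
  then have ij: "i < dim_col M * dim_col N" "j < dim_row M * dim_row N" by (auto simp: kron_def)
  then have "0 < dim_col N" "0 < dim_row N" by (auto intro: gr0I)
  then show "kron (transpose_mat M) (transpose_mat N) $$ (i, j) = transpose_mat (kron M N) $$ (i, j)"
    using ij by (auto simp: kron_def less_mult_imp_div_less)
qed (auto simp: kron_def)

lemma dsum_four_block_dsum:
  fixes P :: "'a::comm_ring_1 mat"
  assumes "M \<in> carrier_mat a a" "M' \<in> carrier_mat a a" "P \<in> carrier_mat a a" "Q \<in> carrier_mat a r" "S \<in> carrier_mat r a" "D \<in> carrier_mat r r"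
  shows "dsum M (1\<^sub>m r) * four_block_mat P Q S D * dsum M' (1\<^sub>m r) = four_block_mat (M * P * M') (M * Q) (S * M') D"
proof -
  have c: "M * P \<in> carrier_mat a a" "M * Q \<in> carrier_mat a r" using assms by auto
  have "dsum M (1\<^sub>m r) * four_block_mat P Q S D = four_block_mat (M * P) (M * Q) S D"
    unfolding dsum_def using assms c
    by (subst mult_four_block_mat[of _ a a _ r _ r _ _ a _ r]) (auto intro!: cong_four_block_mat)
  also have "\<dots> * dsum M' (1\<^sub>m r) = four_block_mat (M * P * M') (M * Q) (S * M') D"
    unfolding dsum_def using assms c
    by (subst mult_four_block_mat[of _ a a _ r _ r _ _ a _ r]) (auto intro!: cong_four_block_mat)
  finally show ?thesis .
qed

lemma pencil_carrier: "A \<in> carrier_mat r r \<Longrightarrow> E \<in> carrier_mat r r \<Longrightarrow> pencil A E \<in> carrier_mat r r"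
  unfolding pencil_def by (intro minus_carrier_mat) simp

lemma const_pencil_blocks:
  assumes "V \<in> carrier_mat a a" "W \<in> carrier_mat a a" "u \<in> carrier_mat a r" "w \<in> carrier_mat r a"
    "A \<in> carrier_mat r r" "E \<in> carrier_mat r r"
  shows "[:0, 1:] \<cdot>\<^sub>m const_mat (dsum V (- E)) - const_mat (four_block_mat W (- u) (- w) (- A))
    = four_block_mat ([:0, 1:] \<cdot>\<^sub>m const_mat V - const_mat W) (const_mat u) (const_mat w) (pencil A E)"
proof -
  have d: "dim_row V = a" "dim_col V = a" "dim_row W = a" "dim_col W = a" "dim_row u = a" "dim_col u = r"
    "dim_row w = r" "dim_col w = a" "dim_row A = r" "dim_col A = r" "dim_row E = r" "dim_col E = r"
    using assms by auto
  show ?thesis by (intro eq_matI) (auto simp: const_mat_def pencil_def d)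
qed

lemma elem_prod_ext_dsum:
  assumes "set t \<subseteq> {- int m..<int m}" "set X \<subseteq> carrier_mat n n"
  shows "elem_prod_ext n m r t X = dsum (elem_prod n m t X) (1\<^sub>m r)"
proof -
  have "map2 (elem_mat_ext n m r) t X = map (\<lambda>M. dsum M (1\<^sub>m r)) (map2 (elem_mat n m) t X)"
    by (auto simp: elem_mat_ext_def diag_block_mat_two simp del: diag_block_mat.simps)
  then show ?thesis
    unfolding elem_prod_ext_def elem_prod_def by (simp only: mat_prod_dsum(2)[OF elem_prod_carrier(1)[OF assms]])
qed

context fiedler_data
begin

lemma fiedler_P_ext_dsum:
  assumes "valid t"
  shows "fiedler_P_ext_prod n m r Ac t = dsum (F t) (1\<^sub>m r)"
proof -
  have "map (fiedler_P_ext n m r Ac) t = map (\<lambda>M. dsum M (1\<^sub>m r)) (map (fiedler_P n m Ac) t)"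
    by (auto simp: fiedler_P_ext_def diag_block_mat_two simp del: diag_block_mat.simps)
  then show ?thesis
    unfolding fiedler_P_ext_prod_def fiedler_P_prod_def by (simp only: mat_prod_dsum(2)[OF fiedlers_carrier[OF assms]])
qed

lemma fiedler_S_inner:
  assumes "- int m < i" "i < int m" "i \<noteq> 0"
  shows "fiedler_S n m r Ac A E B C i = dsum (fiedler_P n m Ac i) (1\<^sub>m r)"
proof (cases "0 < i")
  case True
  then show ?thesis by (simp add: fiedler_S_def diag_block_mat_two del: diag_block_mat.simps)
next
  case False
  then have i: "0 < - i" "- i < int m" using assms by auto
  have c: "fiedler_P n m Ac i \<in> carrier_mat (m * n) (m * n)" "fiedler_P n m Ac (- i) \<in> carrier_mat (m * n) (m * n)"
    using i by (auto intro!: fiedler_carrier)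
  have "fiedler_P n m Ac (- i) * fiedler_P n m Ac i = 1\<^sub>m (m * n)" "fiedler_P n m Ac i * fiedler_P n m Ac (- i) = 1\<^sub>m (m * n)"
    using elem_mat_inverse[OF i, of "fiedler_coeff Ac (- i)" n] coeff_carrier[of "- i"] i
    unfolding fiedler_P_coeff by (auto simp: fiedler_coeff_def)
  then have "mat_inv (dsum (fiedler_P n m Ac (- i)) (1\<^sub>m r)) = dsum (fiedler_P n m Ac i) (1\<^sub>m r)"
    using c by (intro mat_inv_unique[of _ "m * n + r"])
      (auto intro!: dsum_carrier simp: dsum_mult[of _ "m * n" "m * n" _ "m * n" _ r r _ r] dsum_one)
  then show ?thesis using False assms by (simp add: fiedler_S_def diag_block_mat_two del: diag_block_mat.simps)
qed

lemma fiedler_S_prod_inner: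
  assumes "set t \<subseteq> {- int m<..<int m}" "0 \<notin> set t"
  shows "mat_prod (m * n + r) (map (fiedler_S n m r Ac A E B C) t) = dsum (F t) (1\<^sub>m r)"
    "set (map (fiedler_S n m r Ac A E B C) t) \<subseteq> carrier_mat (m * n + r) (m * n + r)"
proof -
  have v: "valid t" using assms by auto
  have e: "map (fiedler_S n m r Ac A E B C) t = map (\<lambda>M. dsum M (1\<^sub>m r)) (map (fiedler_P n m Ac) t)"
    using assms by (auto intro!: fiedler_S_inner)
  then show "mat_prod (m * n + r) (map (fiedler_S n m r Ac A E B C) t) = dsum (F t) (1\<^sub>m r)"
    unfolding fiedler_P_prod_def by (simp only: mat_prod_dsum(2)[OF fiedlers_carrier[OF v]])
  show "set (map (fiedler_S n m r Ac A E B C) t) \<subseteq> carrier_mat (m * n + r) (m * n + r)"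
    unfolding e using fiedlers_carrier[OF v] by (auto intro!: dsum_carrier)
qed

text \<open>
  All factors other than that of \<open>- m\<close> are bordered by \<open>I_r\<close>, so the border \<open>- E\<close> of that factor survives.
\<close>
lemma fiedler_S_prod_top:
  assumes t1: "set t1 \<subseteq> {- int m<..<int m}" "0 \<notin> set t1" and t2: "set t2 \<subseteq> {- int m<..<int m}" "0 \<notin> set t2"
    and E: "E \<in> carrier_mat r r"
  shows "fiedler_S_prod n m r Ac A E B C (t1 @ [- int m] @ t2) = dsum (F (t1 @ [- int m] @ t2)) (- E)"
proof -
  let ?S = "fiedler_S n m r Ac A E B C" and ?N = "m * n" and ?M = "m * n + r"
  have v: "valid t1" "valid t2" "valid [- int m]" "valid ([- int m] @ t2)" using t1 t2 m by auto
  have top: "?S (- int m) = dsum (F [- int m]) (- E)"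
    using m fiedler_carrier[of "- int m"] by (simp add: fiedler_S_def fiedler_P_prod_def diag_block_mat_two del: diag_block_mat.simps)
  have c: "F t1 \<in> carrier_mat ?N ?N" "F t2 \<in> carrier_mat ?N ?N" "F [- int m] \<in> carrier_mat ?N ?N"
    using v by (auto intro!: F_carrier)
  have tc: "dsum (F [- int m]) (- E) \<in> carrier_mat ?M ?M" using c E by (intro dsum_carrier) auto
  have "fiedler_S_prod n m r Ac A E B C (t1 @ [- int m] @ t2)
     = dsum (F t1) (1\<^sub>m r) * (dsum (F [- int m]) (- E) * dsum (F t2) (1\<^sub>m r))"
    unfolding fiedler_S_prod_def using fiedler_S_prod_inner[OF t1, of r A E B C] fiedler_S_prod_inner[OF t2, of r A E B C] tc
    by (simp add: mat_prod_append top)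
  also have "\<dots> = dsum (F t1 * (F [- int m] * F t2)) (- E)"
    using c E by (simp add: dsum_mult[of _ ?N ?N _ ?N _ r r _ r] mult_carrier_mat[of _ ?N ?N _ ?N])
  finally show ?thesis using F_append[OF v(1,4)] F_append[OF v(3,2)] by simp
qed

end

context gfpr
begin

abbreviation "col0 C \<equiv> elem_col n m 0 C"
abbreviation "colT C \<equiv> elem_col n m top_col C"

lemma elem_col_carrier: "C \<in> carrier_mat n r \<Longrightarrow> elem_col n m s C \<in> carrier_mat N r"
  by (simp add: elem_col_def)

lemma fiedler_S_v:
  assumes "E \<in> carrier_mat r r"
  shows "fiedler_S_prod n m r Ac A E B C (v_tuple m (2 * q)) = dsum (F (v_tuple m (2 * q))) (- E)"
proof -
  let ?p = "\<lambda>c. concat (map (\<lambda>j. [- (int (2 * q) + 2 + 2 * int j), - (int (2 * q) + 1 + 2 * int j)]) [0..<c])"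
  show ?thesis
  proof (cases "even k")
    case True
    have "v_tuple m (2 * q) = ?p ((k + 1) div 2) @ [- int m] @ []" unfolding v_tuple_eq using True by simp
    moreover have "set (?p ((k + 1) div 2)) \<subseteq> {- int m<..<int m}"
      using m_eq True by (auto elim!: evenE)
    moreover have "0 \<notin> set (?p ((k + 1) div 2))" by auto
    ultimately show ?thesis using fiedler_S_prod_top[OF _ _ _ _ assms, of "?p ((k + 1) div 2)" "[]" A B C] by simp
  next
    case False
    then obtain l where l: "k = 2 * l + 1" by (elim oddE)
    have "v_tuple m (2 * q) = ?p l @ [- int m] @ [- int m + 1]" unfolding v_tuple_eq using l m_eq by simp
    moreover have "set (?p l) \<subseteq> {- int m<..<int m}" "0 \<notin> set (?p l)" using m_eq l by auto
    moreover have "set [- int m + 1] \<subseteq> {- int m<..<int m}" "0 \<notin> set [- int m + 1]" using m_eq l by auto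
    ultimately show ?thesis using fiedler_S_prod_top[OF _ _ _ _ assms, of "?p l" "[- int m + 1]" A B C] by simp
  qed
qed

text \<open>
  Index 0 comes last in \<open>w_h\<close>, and it is the only factor with off-diagonal borders. So the remaining
  factors act on its border column from the left but do not touch its border row.
\<close>
lemma fiedler_S_w:
  assumes A: "A \<in> carrier_mat r r" and B: "B \<in> carrier_mat r n"
  shows "fiedler_S_prod n m r Ac A E B (transpose_mat B) (w_tuple (2 * q))
    = four_block_mat (F (w_tuple (2 * q))) (- (F (w_pairs q) * col0 (transpose_mat B))) (- transpose_mat (col0 (transpose_mat B))) (- A)"
proof -
  let ?C = "transpose_mat B"
  have C: "?C \<in> carrier_mat n r" using B by simp
  have p: "set (w_pairs q) \<subseteq> {- int m<..<int m}" "0 \<notin> set (w_pairs q)"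
  proof -
    have "2 * int q - 1 \<noteq> 2 * int j" for j by presburger
    then show "0 \<notin> set (w_pairs q)" by auto
  qed (use m_eq in auto)
  have v: "valid (w_pairs q)" "valid [0]" using p m by auto
  have pc: "F (w_pairs q) \<in> carrier_mat N N" "F [0] \<in> carrier_mat N N" using v by (auto intro!: F_carrier)
  have k0: "kron (e_col m m) ?C = col0 ?C" using kron_e_col[of 0 m ?C n r] C m by simp
  have z: "fiedler_S n m r Ac A E B ?C 0 = four_block_mat (F [0]) (- col0 ?C) (- transpose_mat (col0 ?C)) (- A)"
    using m fiedler_carrier[of 0] kron_transpose_mat[of "e_col m m" ?C] k0
    by (simp add: fiedler_S_def fiedler_P_prod_def)
  have zc: "fiedler_S n m r Ac A E B ?C 0 \<in> carrier_mat (N + r) (N + r)"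
    unfolding z using pc A by auto
  note e = elem_col_carrier[OF C, of 0]
  have "fiedler_S_prod n m r Ac A E B ?C (w_tuple (2 * q)) = dsum (F (w_pairs q)) (1\<^sub>m r) * fiedler_S n m r Ac A E B ?C 0"
    unfolding w_tuple_even fiedler_S_prod_def using fiedler_S_prod_inner[OF p, of r A E B ?C] zc
    by (simp add: mat_prod_append)
  also have "\<dots> = four_block_mat (F (w_pairs q) * F [0]) (F (w_pairs q) * - col0 ?C) (- transpose_mat (col0 ?C)) (- A)"
    unfolding z dsum_def using pc A e
    by (subst mult_four_block_mat[of _ N N _ r _ r _ _ N _ r]) (auto intro!: cong_four_block_mat)
  finally show ?thesis
    unfolding w_tuple_even F_append[OF v] using pc e by simp
qed

text \<open>
  The border column is \<open>e_m \<otimes> B\<^sup>T\<close>, moved up by the Fiedler factor of \<open>w_h\<close> and the left outer factor; the border row is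
  \<open>e_m\<^sup>T \<otimes> B\<close>, moved by the complement and the right outer factor. Both arrive at the same position.
\<close>
theorem L_S_blocks:
  assumes A: "A \<in> carrier_mat r r" and E: "E \<in> carrier_mat r r" and B: "B \<in> carrier_mat r n"
  defines "c \<equiv> colT (transpose_mat B)"
  shows "L_S n m r Ac A E B (transpose_mat B) (2 * q) tw tv X Y =
    four_block_mat (L_P n m Ac (2 * q) tw tv X Y) (const_mat c) (const_mat (transpose_mat c)) (pencil A E)"
proof -
  let ?x = "[:0, 1:] :: complex poly" and ?C = "transpose_mat B"
  let ?c0 = "col0 ?C" and ?V = "N1 * N2" and ?W = "Mo * Me" and ?Z = "Mo * N1"
  have C: "?C \<in> carrier_mat n r" using B by simp
  note e = elem_col_carrier[OF C]
  have vw: "?V \<in> carrier_mat N N" "?W \<in> carrier_mat N N" "?Z \<in> carrier_mat N N"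
    using carriers by (auto intro!: mult_carrier_mat[of _ _ N])
  have v: "valid (tv @ tw)" "valid (rev tw @ rev tv)" "valid (cw_tuple (2 * q) @ cv_tuple m (2 * q))"
    using tuple_ranges(3,4) valid_lists(1,8) unfolding cw_tuple_even cv_tuple_eq by simp_all
  have xs: "set (Y @ X) \<subseteq> carrier_mat n n" "set (rev X @ rev Y) \<subseteq> carrier_mat n n" using X Y by auto
  have ex: "elem_prod_ext n m r (tv @ tw) (Y @ X) = dsum Rl (1\<^sub>m r)"
    "elem_prod_ext n m r (rev tw @ rev tv) (rev X @ rev Y) = dsum Rr (1\<^sub>m r)"
    "fiedler_P_ext_prod n m r Ac (cw_tuple (2 * q) @ cv_tuple m (2 * q)) = dsum ?Z (1\<^sub>m r)"
    unfolding Rl_def Rr_def using elem_prod_ext_dsum[OF v(1) xs(1)] elem_prod_ext_dsum[OF v(2) xs(2)]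
      fiedler_P_ext_dsum[OF v(3)] c_factor by simp_all
  define u where "u = F (w_pairs q) * ?c0"
  have wp: "F (w_pairs q) \<in> carrier_mat N N" using m_eq by (intro F_carrier) auto
  have u: "u \<in> carrier_mat N r" unfolding u_def using wp e by auto
  define P where "P = ?x \<cdot>\<^sub>m const_mat ?V - const_mat ?W"
  have P: "P \<in> carrier_mat N N" unfolding P_def using vw by (intro minus_carrier_mat) simp
  have inner: "?x \<cdot>\<^sub>m const_mat (dsum ?V (- E)) - const_mat (four_block_mat ?W (- u) (- transpose_mat ?c0) (- A))
    = four_block_mat P (const_mat u) (const_mat (transpose_mat ?c0)) (pencil A E)"
    unfolding P_def using vw u e[of 0] A E by (intro const_pencil_blocks) auto
  have cd: "const_mat (dsum M (1\<^sub>m r)) = dsum (const_mat M) (1\<^sub>m r)" for M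
    unfolding const_mat_def by (subst dsum_map) (auto simp: const_hom.mat_hom_one)
  have ld: "L_S n m r Ac A E B ?C (2 * q) tw tv X Y =
     dsum (const_mat Rl) (1\<^sub>m r) * four_block_mat P (const_mat u) (const_mat (transpose_mat ?c0)) (pencil A E)
       * dsum (const_mat ?Z) (1\<^sub>m r) * dsum (const_mat Rr) (1\<^sub>m r)"
    unfolding L_S_def ex fiedler_S_v[OF E] fiedler_S_w[OF A B] v_factor w_factor u_def[symmetric] inner cd ..
  have pc: "pencil A E \<in> carrier_mat r r" using A E by (rule pencil_carrier)
  have cc: "const_mat Rl \<in> carrier_mat N N" "const_mat Rr \<in> carrier_mat N N" "const_mat ?Z \<in> carrier_mat N N"
    "const_mat u \<in> carrier_mat N r" "const_mat (transpose_mat ?c0) \<in> carrier_mat r N"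
    using R_carriers vw u e[of 0] by auto
  have c3: "dsum (const_mat Rl) (1\<^sub>m r) \<in> carrier_mat (N + r) (N + r)" "dsum (const_mat Rr) (1\<^sub>m r) \<in> carrier_mat (N + r) (N + r)"
    "dsum (const_mat ?Z) (1\<^sub>m r) \<in> carrier_mat (N + r) (N + r)" using cc by (auto intro!: dsum_carrier)
  have c4: "four_block_mat P (const_mat u) (const_mat (transpose_mat ?c0)) (pencil A E) \<in> carrier_mat (N + r) (N + r)"
    using P pc by auto
  have "L_S n m r Ac A E B ?C (2 * q) tw tv X Y =
     dsum (const_mat Rl) (1\<^sub>m r) * four_block_mat P (const_mat u) (const_mat (transpose_mat ?c0)) (pencil A E)
       * dsum (const_mat ?Z * const_mat Rr) (1\<^sub>m r)"
    unfolding ld assoc_mult_mat[OF mult_carrier_mat[OF c3(1) c4] c3(3) c3(2)]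
      dsum_mult[OF cc(3) cc(2) one_carrier_mat one_carrier_mat] by simp
  also have "\<dots> = four_block_mat (const_mat Rl * P * (const_mat ?Z * const_mat Rr)) (const_mat Rl * const_mat u)
      (const_mat (transpose_mat ?c0) * (const_mat ?Z * const_mat Rr)) (pencil A E)"
    using cc P pc by (intro dsum_four_block_dsum) auto
  also have "const_mat Rl * P * (const_mat ?Z * const_mat Rr) = L_P n m Ac (2 * q) tw tv X Y"
    unfolding L_P_def v_factor w_factor c_factor Rl_def[symmetric] Rr_def[symmetric] P_def[symmetric]
    using cc P by (simp add: assoc_mult_mat[of _ N N _ N _ N] mult_carrier_mat[of _ N N _ N])
  also have "const_mat Rl * const_mat u = const_mat c"
    using R1_col(2)[OF C] R_carriers u unfolding u_def c_def by (simp flip: const_mat_mult)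
  also have "const_mat (transpose_mat ?c0) * (const_mat ?Z * const_mat Rr) = const_mat (transpose_mat c)"
    using R2_row[OF C] R_carriers vw e[of 0] unfolding R2_def c_def
    by (simp flip: const_mat_mult[of _ N N _ N] add: const_mat_mult[of _ r N _ N, symmetric] mult_carrier_mat[of _ N N _ N])
  finally show ?thesis .
qed

end

section \<open>Unimodular equivalence with the system matrix\<close>

lemma (in comm_ring_hom) mat_hom_prod:
  "set Ms \<subseteq> carrier_mat N N \<Longrightarrow> map_mat hom (mat_prod N Ms) = mat_prod N (map (map_mat hom) Ms)"
  by (induction Ms) (auto simp: mat_hom_one mat_hom_mult[of _ N N _ N] mat_prod_carrier)

lemma (in comm_ring_hom) neg_prod_hom:
  assumes "\<And>j. j < m \<Longrightarrow> A j \<in> carrier_mat n n" "1 \<le> m"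
  shows "map_mat hom (neg_prod n s A m) = neg_prod n s (\<lambda>j. map_mat hom (A j)) m"
proof -
  have z: "map_mat hom (0\<^sub>m n n) = 0\<^sub>m n n" by (intro eq_matI) auto
  have "map (map_mat hom) (map (\<lambda>j. cross n m (m - j - 1) (0\<^sub>m n n) (A j)) (filter s (rev [1..<m])))
    = map (\<lambda>j. cross n m (m - j - 1) (0\<^sub>m n n) (map_mat hom (A j))) (filter s (rev [1..<m]))"
    using assms(1) by (auto simp: cross_map z)
  moreover have "map_mat hom (mat_prod (m * n) (map (\<lambda>j. cross n m (m - j - 1) (0\<^sub>m n n) (A j)) (filter s (rev [1..<m]))))
    = mat_prod (m * n) (map (map_mat hom) (map (\<lambda>j. cross n m (m - j - 1) (0\<^sub>m n n) (A j)) (filter s (rev [1..<m]))))"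
    by (rule mat_hom_prod[OF neg_factors_carrier]) (use assms in auto)
  ultimately show ?thesis unfolding neg_prod_def by (simp only:)
qed

lemma (in comm_ring_hom) pos_prod_hom:
  assumes "\<And>j. j < m \<Longrightarrow> A j \<in> carrier_mat n n" "1 \<le> m"
  shows "map_mat hom (pos_prod n s A m) = pos_prod n s (\<lambda>j. map_mat hom (A j)) m"
proof -
  have z: "map_mat hom (0\<^sub>m n n) = 0\<^sub>m n n" by (intro eq_matI) auto
  have u: "map_mat hom (- M) = - map_mat hom M" for M by (intro eq_matI) (auto simp: hom_uminus)
  have e: "map (map_mat hom) (map (\<lambda>j. cross n m (m - j - 1) (- A j) (0\<^sub>m n n)) (filter (\<lambda>j. \<not> s j) (rev [1..<m])))
    = map (\<lambda>j. cross n m (m - j - 1) (- map_mat hom (A j)) (0\<^sub>m n n)) (filter (\<lambda>j. \<not> s j) (rev [1..<m]))"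
    using assms(1) by (auto simp: cross_map z u)
  have sc: "spot n m (m - 1) (- A 0) \<in> carrier_mat (m * n) (m * n)"
    using assms(1)[of 0] assms(2) by (intro spot_carrier) auto
  have "map_mat hom (mat_prod (m * n) (map (\<lambda>j. cross n m (m - j - 1) (- A j) (0\<^sub>m n n)) (filter (\<lambda>j. \<not> s j) (rev [1..<m]))))
    = mat_prod (m * n) (map (map_mat hom) (map (\<lambda>j. cross n m (m - j - 1) (- A j) (0\<^sub>m n n)) (filter (\<lambda>j. \<not> s j) (rev [1..<m]))))"
    by (rule mat_hom_prod[OF pos_factors_carrier]) (use assms in auto)
  moreover have "mat_prod (m * n) (map (\<lambda>j. cross n m (m - j - 1) (- A j) (0\<^sub>m n n)) (filter (\<lambda>j. \<not> s j) (rev [1..<m]))) \<in> carrier_mat (m * n) (m * n)"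
    by (rule mat_prod_carrier[OF pos_factors_carrier]) (use assms in auto)
  moreover have "map_mat hom (spot n m (m - 1) (- A 0)) = spot n m (m - 1) (- map_mat hom (A 0))"
    by (subst spot_map) (auto simp: u)
  ultimately show ?thesis
    unfolding pos_prod_def using mat_hom_mult[OF _ sc] by (simp only: e)
qed

interpretation poly_ring: unital_subring "UNIV :: complex poly set"
  by standard auto

lemma unimodular_if_kunit:
  assumes "poly_ring.kunit k U" shows "unimodular k U"
proof -
  obtain U' where U: "U \<in> carrier_mat k k" "U' \<in> carrier_mat k k" "U * U' = 1\<^sub>m k"
    using assms by (auto simp: poly_ring.kunit_def)
  have "det U * det U' = 1" using det_mult[OF U(1,2)] U(3) by simp
  then have "det U dvd 1" by (metis dvd_triv_left)
  then obtain c where "det U = [:c:]" "c \<noteq> 0" using is_unit_poly_iff[of "det U"] by auto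
  then show ?thesis using U(1) by (auto simp: unimodular_def)
qed

lemma plc_mult_right:
  fixes C :: "'a::comm_ring_1 mat"
  assumes "C \<in> carrier_mat d r"
  shows "plc N a (1\<^sub>m d) * C = plc N a C"
proof (rule eq_matI)
  fix i j assume "i < dim_row (plc N a C)" "j < dim_col (plc N a C)"
  then have ij: "i < N" "j < r" using assms by (auto simp: plc_def)
  have "(plc N a (1\<^sub>m d) * C) $$ (i, j) = (\<Sum>t<d. plc N a (1\<^sub>m d) $$ (i, t) * C $$ (t, j))"
    using ij assms by (intro mat_mult_index_sum[of _ N d _ r] plc_carrier[of _ d]) auto
  also have "\<dots> = (\<Sum>t<d. if t = i - a then (if a \<le> i \<and> i < a + d then C $$ (t, j) else 0) else 0)"
    using ij by (intro sum.cong) (auto simp: plc_def)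
  also have "\<dots> = plc N a C $$ (i, j)" using ij assms by (auto simp: plc_def)
  finally show "(plc N a (1\<^sub>m d) * C) $$ (i, j) = plc N a C $$ (i, j)" .
qed (use assms in \<open>auto simp: plc_def\<close>)

lemma map_plc: "f 0 = 0 \<Longrightarrow> map_mat f (plc N a C) = plc N a (map_mat f C)"
  by (intro eq_matI) (auto simp: plc_def)

context gfpr
begin

lemma elem_col_last_block:
  fixes f :: "complex \<Rightarrow> 'a::comm_ring_1"
  assumes "f 0 = 0" "C \<in> carrier_mat n r"
  shows "map_mat f (col0 C) = last_block n m * map_mat f C"
  unfolding elem_col_def map_plc[where f = f, OF assms(1)] last_block_def
  using plc_mult_right[of "map_mat f C" n r "m * n" "(m - 1) * n"] assms(2) by simp

lemma col_kernel:
  assumes C: "C \<in> carrier_mat n r" and v: "v \<in> carrier_vec r" and z: "elem_col n m (int s) C *\<^sub>v v = 0\<^sub>v N" "s < m"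
  shows "C *\<^sub>v v = 0\<^sub>v n"
proof (rule eq_vecI)
  fix t assume "t < dim_vec (0\<^sub>v n)"
  then have t: "t < n" by simp
  define a where "a = (m - 1 - s) * n"
  have a: "a + t < N" using block_fits[OF z(2), of n] t unfolding a_def by linarith
  have "row (elem_col n m (int s) C) (a + t) = row C t"
    using a t C by (intro eq_vecI) (auto simp: elem_col_def plc_def a_def)
  moreover have "(elem_col n m (int s) C *\<^sub>v v) $ (a + t) = row (elem_col n m (int s) C) (a + t) \<bullet> v"
    using a C by (intro index_mult_mat_vec) (simp add: elem_col_def plc_def)
  ultimately show "(C *\<^sub>v v) $ t = 0\<^sub>v n $ t"
    using z(1) a t C by simp
qed (use C in simp)

text \<open>
  The blocks \<open>e \<otimes> B\<^sup>T\<close> and \<open>B\<^sup>T\<close> have the same kernel, and \<open>A - z E\<close> is symmetric, so a vector in the kernel of either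
  condition is an uncontrollable mode.
\<close>
lemma rank_conditions:
  assumes min: "minimal_realization n r G P A E B (transpose_mat B)"
    and sym: "symmetric_mat A" "symmetric_mat E"
  defines "c \<equiv> colT (transpose_mat B)"
  shows "vec_space.rank r (mat_of_cols r (cols (transpose_mat c) @ cols (A - z \<cdot>\<^sub>m E))) = r"
    "vec_space.rank (N + r) (c @\<^sub>r (A - z \<cdot>\<^sub>m E)) = r"
proof -
  have cr: "A \<in> carrier_mat r r" "E \<in> carrier_mat r r" "B \<in> carrier_mat r n"
    using min by (auto simp: minimal_realization_def realization_def)
  define D where "D = A - z \<cdot>\<^sub>m E"
  have D: "D \<in> carrier_mat r r" "transpose_mat D = D"
  proof -
    show "D \<in> carrier_mat r r" unfolding D_def using cr by (intro minus_carrier_mat) simp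
    have "transpose_mat (z \<cdot>\<^sub>m E) = z \<cdot>\<^sub>m transpose_mat E" by (intro eq_matI) auto
    then show "transpose_mat D = D" unfolding D_def using cr sym by (simp add: symmetric_mat_def transpose_minus[of _ r r])
  qed
  obtain s where s: "top_col = int s" "s < m" using tw_climb by (metis nonneg_int_cases of_nat_less_iff)
  have c: "c \<in> carrier_mat N r" unfolding c_def using cr by (intro elem_col_carrier) auto
  have ker: "v = 0\<^sub>v r" if v: "v \<in> carrier_vec r" and z: "c *\<^sub>v v = 0\<^sub>v N" "D *\<^sub>v v = 0\<^sub>v r" for v
  proof (rule minimal_realization_controllable[OF min v])
    show "transpose_mat B *\<^sub>v v = 0\<^sub>v n"
      using col_kernel[OF _ v, of "transpose_mat B" s] z(1) cr s unfolding c_def by auto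
    show "transpose_mat (A - z \<cdot>\<^sub>m E) *\<^sub>v v = 0\<^sub>v r" unfolding D_def[symmetric] D(2) by (rule z(2))
  qed
  have "vec_space.rank (N + r) (c @\<^sub>r D) = r"
  proof (rule rank_eq_dim_col_if_kernel_trivial)
    show "c @\<^sub>r D \<in> carrier_mat (N + r) r" using c D by auto
    fix v :: "complex vec" assume v: "v \<in> carrier_vec r" "(c @\<^sub>r D) *\<^sub>v v = 0\<^sub>v (N + r)"
    have "(c *\<^sub>v v) @\<^sub>v (D *\<^sub>v v) = 0\<^sub>v N @\<^sub>v 0\<^sub>v r"
    proof -
      have "0\<^sub>v N @\<^sub>v 0\<^sub>v r = (0\<^sub>v (N + r) :: complex vec)" by (intro eq_vecI) auto
      then show ?thesis using mat_mult_append[OF c D(1) v(1)] v(2) by simp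
    qed
    then have "c *\<^sub>v v = 0\<^sub>v N" "D *\<^sub>v v = 0\<^sub>v r"
      using append_vec_eq[of "c *\<^sub>v v" N "0\<^sub>v N" "D *\<^sub>v v" "0\<^sub>v r"] mult_mat_vec_carrier[OF c v(1)] by simp_all
    then show "v = 0\<^sub>v r" using ker v(1) by blast
  qed
  then show "vec_space.rank (N + r) (c @\<^sub>r (A - z \<cdot>\<^sub>m E)) = r" unfolding D_def .
  have "vec_space.rank r (mat_of_cols r (cols (transpose_mat c) @ cols D)) = r" (is "vec_space.rank r ?M = r")
  proof (rule rank_eq_dim_row_if_left_kernel_trivial)
    let ?l = "cols (transpose_mat c) @ cols D"
    have l: "length ?l = N + r" using c D by simp
    show M: "?M \<in> carrier_mat r (N + r)" using l by (metis mat_of_cols_carrier(1))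
    fix v :: "complex vec" assume v: "v \<in> carrier_vec r" "transpose_mat ?M *\<^sub>v v = 0\<^sub>v (N + r)"
    have e: "?l ! j \<bullet> v = 0" if "j < N + r" for j
    proof -
      have "?l ! j \<in> carrier_vec r"
        using that c D by (auto simp: nth_append)
      then have "col ?M j = ?l ! j" using that l by (intro col_mat_of_cols) auto
      then have "(transpose_mat ?M *\<^sub>v v) $ j = ?l ! j \<bullet> v" using that M c D(1) by simp
      then show ?thesis using v(2) that by simp
    qed
    have "c *\<^sub>v v = 0\<^sub>v N"
    proof (rule eq_vecI)
      fix j assume "j < dim_vec (0\<^sub>v N)"
      then show "(c *\<^sub>v v) $ j = 0\<^sub>v N $ j" using e[of j] c by (simp add: nth_append)
    qed (use c in simp)
    moreover have "D *\<^sub>v v = 0\<^sub>v r"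
    proof (rule eq_vecI)
      fix j assume "j < dim_vec (0\<^sub>v r)"
      then have j: "j < r" by simp
      have "col D j \<bullet> v = 0" using e[of "N + j"] j c D by (simp add: nth_append)
      moreover have "row D j = col D j" using D j by (metis carrier_matD(2) row_transpose)
      ultimately show "(D *\<^sub>v v) $ j = 0\<^sub>v r $ j" using D j by simp
    qed (use D in simp)
    ultimately show "v = 0\<^sub>v r" using ker v(1) by blast
  qed
  then show "vec_space.rank r (mat_of_cols r (cols (transpose_mat c) @ cols (A - z \<cdot>\<^sub>m E))) = r" unfolding D_def .
qed

abbreviation "lam \<equiv> [:0, 1:] :: complex poly"
definition "L \<equiv> lam \<cdot>\<^sub>m const_mat lead - const_mat trail"

lemma L_carrier: "L \<in> carrier_mat N N"
  unfolding L_def using lead_trail_carrier by (intro minus_carrier_mat) simp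

lemma L_pencil: "L = pencil (- trail) (- lead)"
  unfolding L_def pencil_def using lead_trail_carrier
  by (intro eq_matI) (auto simp: const_mat_def)

lemma Tp_spot: "spot n m 0 (Ac m) = Tp"
  unfolding Tp_def by (rule top_F)

lemma const_gf_pencil:
  "gf_pencil n odd lam (\<lambda>j. const_mat (Ac j)) m (const_mat (Ac m)) = lam \<cdot>\<^sub>m const_mat (Tp * Dn) - const_mat Ep"
proof -
  have sp: "spot n m 0 (const_mat (Ac m)) = const_mat Tp"
    unfolding Tp_spot[symmetric] const_mat_def by (rule spot_map[OF const_hom.hom_zero const_hom.hom_one, symmetric])
  have d: "const_mat Dn = neg_prod n odd (\<lambda>j. const_mat (Ac j)) m"
    unfolding Dn_def const_mat_def by (rule const_hom.neg_prod_hom) (use Ac m in auto)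
  have e: "const_mat Ep = pos_prod n odd (\<lambda>j. const_mat (Ac j)) m"
    unfolding Ep_def const_mat_def by (rule const_hom.pos_prod_hom) (use Ac m in auto)
  show ?thesis unfolding gf_pencil_def sp d[symmetric] e[symmetric] const_mat_mult[OF carriers(6,7)] ..
qed

lemma const_horner: "horner lam (\<lambda>j. const_mat (Ac j)) m (const_mat (Ac m)) = matpoly n m Ac"
proof (rule eq_matI)
  have h: "horner lam (\<lambda>j. const_mat (Ac j)) m (const_mat (Ac m)) \<in> carrier_mat n n"
    using Ac by (intro horner_sum) auto
  then show "dim_row (horner lam (\<lambda>j. const_mat (Ac j)) m (const_mat (Ac m))) = dim_row (matpoly n m Ac)"
    "dim_col (horner lam (\<lambda>j. const_mat (Ac j)) m (const_mat (Ac m))) = dim_col (matpoly n m Ac)"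
    by (auto simp: matpoly_def)
  fix i j assume "i < dim_row (matpoly n m Ac)" "j < dim_col (matpoly n m Ac)"
  then have ij: "i < n" "j < n" by (auto simp: matpoly_def)
  have mon: "lam ^ k * const_mat (Ac k) $$ (i, j) = monom (Ac k $$ (i, j)) k" if "k \<le> m" for k
    using Ac[OF that] ij by (simp add: const_mat_def monom_altdef)
  have "horner lam (\<lambda>j. const_mat (Ac j)) m (const_mat (Ac m)) $$ (i, j)
     = lam ^ m * const_mat (Ac m) $$ (i, j) + (\<Sum>k<m. lam ^ k * const_mat (Ac k) $$ (i, j))"
    using Ac ij by (intro horner_sum) auto
  also have "\<dots> = (\<Sum>k\<le>m. lam ^ k * const_mat (Ac k) $$ (i, j))"
    by (simp add: lessThan_Suc_atMost[symmetric])
  also have "\<dots> = (\<Sum>k\<le>m. monom (Ac k $$ (i, j)) k)" using mon by (intro sum.cong) auto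
  finally show "horner lam (\<lambda>j. const_mat (Ac j)) m (const_mat (Ac m)) $$ (i, j) = matpoly n m Ac $$ (i, j)"
    using ij by (simp add: matpoly_def)
qed

text \<open>
  The unimodular factors are \<open>U R1\<inverse>\<close> and \<open>R2\<inverse> V\<close>, with \<open>U\<close> and \<open>V\<close> from the reduction of the middle pencil. The
  inverses bring the border to the last block, where \<open>U\<close> and \<open>V\<close> fix it.
\<close>
lemma unimodular_equivalence:
  assumes A: "A \<in> carrier_mat r r" and E: "E \<in> carrier_mat r r" and B: "B \<in> carrier_mat r n"
    and inv: "odd k \<Longrightarrow> invertible_mat (Ac m)"
  defines "c \<equiv> colT (transpose_mat B)"
  shows "\<exists>U V. unimodular N U \<and> unimodular N V \<and>
    dsum U (1\<^sub>m r) * four_block_mat L (const_mat c) (const_mat (transpose_mat c)) (pencil A E) * dsum V (1\<^sub>m r)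
      = dsum (1\<^sub>m ((m - 1) * n)) (system_matrix (matpoly n m Ac) A E B (transpose_mat B))"
proof -
  let ?C = "transpose_mat B" and ?P = "matpoly n m Ac" and ?k = "(m - 1) * n"
  have C: "?C \<in> carrier_mat n r" using B by simp
  let ?cz = "col0 ?C"
  note e = elem_col_carrier[OF C]
  define T where "T = lam \<cdot>\<^sub>m const_mat (Tp * Dn) - const_mat Ep"
  have TD: "Tp * Dn \<in> carrier_mat N N" using carriers by (auto intro!: mult_carrier_mat[of _ _ N])
  have T: "T \<in> carrier_mat N N" unfolding T_def using carriers by (intro minus_carrier_mat) simp
  obtain U V where UV: "poly_ring.kunit N U" "poly_ring.kunit N V" "U * T * V = dsum (1\<^sub>m ?k) ?P"
    and lb: "U * last_block n m = last_block n m" "transpose_mat V * last_block n m = last_block n m"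
    using poly_ring.gf_pencil_horner[of m "\<lambda>j. const_mat (Ac j)" n "const_mat (Ac m)" lam odd] m Ac
    unfolding const_gf_pencil const_horner T_def[symmetric] by (auto simp: poly_ring.over_def)
  obtain I1 where I1: "I1 \<in> carrier_mat N N" "R1 * I1 = 1\<^sub>m N" "I1 * R1 = 1\<^sub>m N"
    using invertible_mat_obtain_inverse[OF R_invertible(1)[OF inv] R_carriers(3)] by blast
  obtain I2 where I2: "I2 \<in> carrier_mat N N" "R2 * I2 = 1\<^sub>m N" "I2 * R2 = 1\<^sub>m N"
    using invertible_mat_obtain_inverse[OF R_invertible(2)[OF inv] R_carriers(4)] by blast
  let ?c = const_mat
  have cinv: "?c I1 * ?c R1 = 1\<^sub>m N" "?c R1 * ?c I1 = 1\<^sub>m N" "?c R2 * ?c I2 = 1\<^sub>m N" "?c I2 * ?c R2 = 1\<^sub>m N"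
    using I1 I2 R_carriers by (simp_all flip: const_mat_mult[of _ N N])
  have ku: "poly_ring.kunit N (?c I1)" "poly_ring.kunit N (?c I2)"
    using cinv I1 I2 R_carriers by (auto intro!: poly_ring.kunitI[of "?c I1" _ "?c R1"] poly_ring.kunitI[of "?c I2" _ "?c R2"] simp: poly_ring.over_def)
  define U1 where "U1 = U * ?c I1"
  define V1 where "V1 = ?c I2 * V"
  have kUV: "poly_ring.kunit N U1" "poly_ring.kunit N V1"
    unfolding U1_def V1_def by (intro poly_ring.kunit_mult UV ku)+
  note cc = UV(1,2)[THEN poly_ring.kunit_carrier] kUV[THEN poly_ring.kunit_carrier]
  note am = assoc_mult_mat[of _ N N _ N _ N]
  have Lf: "L = ?c R1 * T * ?c R2"
  proof -
    have "?c R1 * T * ?c R2 = lam \<cdot>\<^sub>m (?c R1 * ?c (Tp * Dn) * ?c R2) - ?c R1 * ?c Ep * ?c R2"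
      unfolding T_def using TD carriers R_carriers
      by (simp add: mult_minus_distrib_mat[of _ N N _ N] minus_mult_distrib_mat[of _ N N _ _ N] mult_smult_distrib[of _ N N _ N]
        mult_smult_assoc_mat[of _ N N _ N] mult_carrier_mat[of _ N N _ N])
    also have "\<dots> = L" unfolding L_def lead_trail_factor using TD carriers R_carriers
      by (simp add: const_mat_mult[of _ N N _ N] mult_carrier_mat[of _ N N _ N])
    finally show ?thesis by simp
  qed
  have main: "U1 * L * V1 = dsum (1\<^sub>m ?k) ?P"
  proof -
    have cR: "?c R1 \<in> carrier_mat N N" "?c R2 \<in> carrier_mat N N" "?c I1 \<in> carrier_mat N N" "?c I2 \<in> carrier_mat N N"
      using R_carriers I1 I2 by auto
    have "U1 * L * V1 = U * (?c I1 * ?c R1) * T * (?c R2 * ?c I2) * V"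
      unfolding U1_def V1_def Lf using cc(1,2) T cR by (simp add: am mult_carrier_mat[of _ N N _ N])
    also have "\<dots> = U * T * V" unfolding cinv using cc T by simp
    finally show ?thesis unfolding UV(3) .
  qed
  have c0: "?c ?cz = last_block n m * ?c ?C"
    unfolding const_mat_def using C by (intro elem_col_last_block) auto
  have Uc0: "U * ?c ?cz = ?c ?cz" "transpose_mat V * ?c ?cz = ?c ?cz"
  proof -
    have "W * ?c ?cz = ?c ?cz" if "W \<in> carrier_mat N N" "W * last_block n m = last_block n m" for W
      unfolding c0 using that C by (simp add: assoc_mult_mat[of _ N N _ n _ r, symmetric])
    then show "U * ?c ?cz = ?c ?cz" "transpose_mat V * ?c ?cz = ?c ?cz" using cc lb by auto
  qed
  have Ucol: "U1 * ?c c = ?c ?cz"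
  proof -
    have "I1 * c = ?cz"
      unfolding c_def R1_col(1)[OF C, symmetric] using I1 R_carriers e[of 0]
      by (simp add: assoc_mult_mat[of _ N N _ N _ r, symmetric])
    then have "?c I1 * ?c c = ?c ?cz" using I1 e[of top_col] by (simp flip: const_mat_mult[of _ N N _ r] add: c_def)
    then show ?thesis unfolding U1_def using cc I1 e[of top_col] Uc0
      by (simp add: assoc_mult_mat[of _ N N _ N _ r] c_def)
  qed
  have Vrow: "?c (transpose_mat c) * V1 = ?c (transpose_mat ?cz)"
  proof -
    have "transpose_mat c * I2 = transpose_mat ?cz"
      unfolding c_def R2_row[OF C, symmetric] using I2 R_carriers e[of 0]
      by (simp add: assoc_mult_mat[of _ r N _ N _ N])
    then have "?c (transpose_mat c) * ?c I2 = ?c (transpose_mat ?cz)"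
      using I2 e[of top_col] by (simp flip: const_mat_mult[of _ r N _ N] add: c_def)
    then have "?c (transpose_mat c) * V1 = ?c (transpose_mat ?cz) * V"
      unfolding V1_def using cc I2 e[of top_col]
      by (simp add: assoc_mult_mat[of _ r N _ N _ N, symmetric] c_def)
    also have "\<dots> = transpose_mat (transpose_mat V * ?c ?cz)"
      using cc e[of 0] by (simp add: transpose_mult[of _ N N _ r] const_mat_transpose)
    also have "\<dots> = ?c (transpose_mat ?cz)" unfolding Uc0 const_mat_transpose ..
    finally show ?thesis .
  qed
  have pc: "pencil A E \<in> carrier_mat r r" using A E by (rule pencil_carrier)
  have Pc: "?P \<in> carrier_mat n n" by (simp add: matpoly_def)
  have N: "?k + n = N" using m by (cases m) auto
  have "dsum U1 (1\<^sub>m r) * four_block_mat L (?c c) (?c (transpose_mat c)) (pencil A E) * dsum V1 (1\<^sub>m r)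
    = four_block_mat (dsum (1\<^sub>m ?k) ?P) (?c ?cz) (?c (transpose_mat ?cz)) (pencil A E)"
    using L_carrier cc pc e[of top_col] unfolding main[symmetric] Ucol[symmetric] Vrow[symmetric]
    by (intro dsum_four_block_dsum) (auto simp: c_def)
  also have "\<dots> = dsum (1\<^sub>m ?k) (four_block_mat ?P (?c ?C) (?c B) (pencil A E))"
  proof (rule eq_matI)
    fix i j assume "i < dim_row (dsum (1\<^sub>m ?k) (four_block_mat ?P (?c ?C) (?c B) (pencil A E)))"
      "j < dim_col (dsum (1\<^sub>m ?k) (four_block_mat ?P (?c ?C) (?c B) (pencil A E)))"
    then have ij: "i < ?k + (n + r)" "j < ?k + (n + r)" using Pc pc by auto
    have d: "dim_row ?P = n" "dim_col ?P = n" "dim_row (pencil A E) = r" "dim_col (pencil A E) = r" "dim_row ?C = n" "dim_col ?C = r"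
      "dim_row B = r" "dim_col B = n" "dim_row ?cz = ?k + n" "dim_col ?cz = r"
      using Pc pc B e[of 0] N by auto
    have c0e: "?cz $$ (a, b) = (if a < ?k then 0 else B $$ (b, a - ?k))" if "a < ?k + n" "b < r" for a b
      using that d N by (auto simp: elem_col_def plc_def)
    have c1: "?c ?cz $$ (a, b) = (if a < ?k then 0 else [:B $$ (b, a - ?k):])"
      "?c (transpose_mat ?cz) $$ (b, a) = (if a < ?k then 0 else [:B $$ (b, a - ?k):])" if "a < ?k + n" "b < r" for a b
      using that d c0e[OF that] by (auto simp: const_mat_def)
    have c2: "?c ?C $$ (a, b) = [:B $$ (b, a):]" "?c B $$ (b, a) = [:B $$ (b, a):]" if "a < n" "b < r" for a b
      using that d by (auto simp: const_mat_def)
    consider "i < ?k" | "?k \<le> i" "i < ?k + n" | "?k + n \<le> i" by linarith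
    then show "four_block_mat (dsum (1\<^sub>m ?k) ?P) (?c ?cz) (?c (transpose_mat ?cz)) (pencil A E) $$ (i, j)
      = dsum (1\<^sub>m ?k) (four_block_mat ?P (?c ?C) (?c B) (pencil A E)) $$ (i, j)"
    proof cases
      case 1
      then show ?thesis using ij by (cases "j < ?k + n") (auto simp: d c1)
    next
      case 2
      then obtain i' where i': "i = ?k + i'" "i' < n" by (metis add_less_cancel_left le_Suc_ex)
      show ?thesis
      proof (cases "j < ?k + n")
        case True
        then show ?thesis using i' by (auto simp: d)
      next
        case False
        then obtain j' where "j = ?k + n + j'" "j' < r" using ij by (metis add_less_cancel_left le_Suc_ex not_less group_cancel.add1)
        then show ?thesis using i' by (simp add: d c1 c2)
      qed
    next
      case 3
      then obtain i' where i': "i = ?k + n + i'" "i' < r" using ij by (metis add_less_cancel_left le_Suc_ex group_cancel.add1)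
      show ?thesis
      proof (cases "j < ?k + n")
        case True
        then show ?thesis
        proof (cases "j < ?k")
          case False
          then obtain j' where "j = ?k + j'" "j' < n" using True by (metis add_less_cancel_left le_Suc_ex not_less)
          then show ?thesis using i' by (simp add: d c1 c2)
        qed (use i' in \<open>simp add: d c1\<close>)
      next
        case False
        then obtain j' where "j = ?k + n + j'" "j' < r" using ij by (metis add_less_cancel_left le_Suc_ex not_less group_cancel.add1)
        then show ?thesis using i' by (simp add: d)
      qed
    qed
  qed (use Pc pc N e[of 0] in auto)
  finally have "dsum U1 (1\<^sub>m r) * four_block_mat L (?c c) (?c (transpose_mat c)) (pencil A E) * dsum V1 (1\<^sub>m r)
    = dsum (1\<^sub>m ?k) (system_matrix ?P A E B ?C)" unfolding system_matrix_def .
  then show ?thesis using unimodular_if_kunit[OF kUV(1)] unimodular_if_kunit[OF kUV(2)] by blast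
qed

end

section \<open>Equivalence at infinity\<close>

lemma transpose_smult_mat: "transpose_mat (x \<cdot>\<^sub>m M) = x \<cdot>\<^sub>m transpose_mat M"
  by (intro eq_matI) auto

lemma const_rat_inverse:
  assumes "M \<in> carrier_mat k k" "M' \<in> carrier_mat k k" "M * M' = 1\<^sub>m k" "M' * M = 1\<^sub>m k"
  shows "const_rat M * const_rat M' = 1\<^sub>m k" "const_rat M' * const_rat M = 1\<^sub>m k" "proper.kunit k (const_rat M)"
proof -
  show 1: "const_rat M * const_rat M' = 1\<^sub>m k" "const_rat M' * const_rat M = 1\<^sub>m k"
    using assms by (simp_all flip: const_rat_mult[of _ k k])
  show "proper.kunit k (const_rat M)" using assms 1 by (intro proper.kunitI[of _ _ "const_rat M'"]) auto
qed

lemma to_fract_monom: "to_fract (monom c k) = rat_var ^ k * to_fract [:c:]"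
proof -
  have "monom c k = [:0, 1:] ^ k * [:c:]" by (simp add: monom_altdef)
  then show ?thesis unfolding rat_var_def by (simp only: fract_hom.hom_mult fract_hom.hom_power)
qed

lemma rat_mat_matpoly_index:
  "i < n \<Longrightarrow> j < n \<Longrightarrow> rat_mat (matpoly n m Ac) $$ (i, j) = (\<Sum>k\<le>m. rat_var ^ k * to_fract [:Ac k $$ (i, j):])"
  by (simp add: rat_mat_def matpoly_def fract_hom.hom_sum to_fract_monom)

lemma matpoly_symmetric_coeffs:
  assumes "symmetric_mat (matpoly n m Ac)" "\<And>i. i \<le> m \<Longrightarrow> Ac i \<in> carrier_mat n n" "l \<le> m"
  shows "symmetric_mat (Ac l)"
proof -
  have co: "coeff (matpoly n m Ac $$ (i, j)) l = Ac l $$ (i, j)" if "i < n" "j < n" for i j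
    using that assms(3) by (simp add: matpoly_def coeff_sum)
  have "Ac l $$ (j, i) = Ac l $$ (i, j)" if ij: "i < n" "j < n" for i j
  proof -
    have "transpose_mat (matpoly n m Ac) $$ (i, j) = matpoly n m Ac $$ (i, j)"
      using assms(1) by (simp add: symmetric_mat_def)
    then have "matpoly n m Ac $$ (j, i) = matpoly n m Ac $$ (i, j)" using ij by (simp add: matpoly_def)
    then show ?thesis using co[OF ij] co[OF ij(2,1)] by simp
  qed
  then show ?thesis using assms(2)[OF assms(3)] unfolding symmetric_mat_def by (intro eq_matI) auto
qed

context gfpr
begin

lemma last_block_sandwich:
  fixes Z :: "'a::comm_ring_1 mat"
  assumes "Z \<in> carrier_mat n n"
  shows "last_block n m * (Z * transpose_mat (last_block n m)) = dsum (0\<^sub>m ((m - 1) * n) ((m - 1) * n)) Z"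
proof -
  let ?a = "(m - 1) * n"
  have N: "?a + n = N" using m by (cases m) auto
  have "Z * transpose_mat (last_block n m) = transpose_mat (last_block n m * transpose_mat Z)"
    using assms by (simp add: transpose_mult[of _ N n _ n])
  also have "last_block n m * transpose_mat Z = plc N ?a (transpose_mat Z)"
    unfolding last_block_def using assms by (intro plc_mult_right[of _ n n]) auto
  finally have e: "Z * transpose_mat (last_block n m) = transpose_mat (plc N ?a (transpose_mat Z))" .
  have c: "transpose_mat (plc N ?a (transpose_mat Z)) \<in> carrier_mat n N" using assms by (simp add: plc_def)
  have "last_block n m * (Z * transpose_mat (last_block n m)) = plc N ?a (transpose_mat (plc N ?a (transpose_mat Z)))"
    unfolding e unfolding last_block_def by (rule plc_mult_right[OF c])
  also have "\<dots> = dsum (0\<^sub>m ?a ?a) Z"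
  proof (rule eq_matI)
    fix i j assume "i < dim_row (dsum (0\<^sub>m ?a ?a) Z)" "j < dim_col (dsum (0\<^sub>m ?a ?a) Z)"
    then have ij: "i < ?a + n" "j < ?a + n" using assms by auto
    have d: "dim_row Z = n" "dim_col Z = n" using assms by auto
    show "plc N ?a (transpose_mat (plc N ?a (transpose_mat Z))) $$ (i, j) = dsum (0\<^sub>m ?a ?a) Z $$ (i, j)"
      using ij N by (cases "i < ?a"; cases "j < ?a") (auto simp: plc_def d)
  qed (use assms N in \<open>auto simp: plc_def\<close>)
  finally show ?thesis .
qed

text \<open>
  With \<open>Z = B\<^sup>T (\<lambda> E - A)\<inverse> B\<close>, the border contributes \<open>R1 diag(0, Z) R2\<close> to the transfer function. Hence
  the transfer function is \<open>R1 X R2\<close>, where \<open>X\<close> is the middle pencil with \<open>A_0 + Z\<close> in place of \<open>A_0\<close>. This is where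
  the separate treatment of the coefficients as elements of a subring pays off: \<open>A_0 + Z\<close> is not constant, but it is proper.
\<close>
lemma biproper_equivalence:
  assumes A: "A \<in> carrier_mat r r" and E: "E \<in> carrier_mat r r" "invertible_mat E" and B: "B \<in> carrier_mat r n"
    and inv: "odd k \<Longrightarrow> invertible_mat (Ac m)"
  defines "c \<equiv> colT (transpose_mat B)"
  defines "G \<equiv> transfer_function (matpoly n m Ac) (transpose_mat B) B A E"
  shows "\<exists>Ol Or. biproper N Ol \<and> biproper N Or \<and>
    Ol * (inverse rat_var \<cdot>\<^sub>m transfer_function L c (transpose_mat c) A E) * Or
      = dsum (1\<^sub>m ((m - 1) * n)) (inverse rat_var ^ m \<cdot>\<^sub>m G)"
proof -
  let ?\<mu> = "inverse rat_var" and ?K = const_rat and ?C = "transpose_mat B" and ?a = "(m - 1) * n"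
  let ?l = "last_block n m :: complex poly fract mat"
  have C: "?C \<in> carrier_mat n r" using B by simp
  note ec = elem_col_carrier[OF C]
  have N: "?a + n = N" using m by (cases m) auto
  obtain R where R: "R \<in> carrier_mat r r" "proper.over R"
    "(rat_var \<cdot>\<^sub>m ?K E - ?K A) * R = 1\<^sub>m r" "R * (rat_var \<cdot>\<^sub>m ?K E - ?K A) = 1\<^sub>m r"
    using rat_pencil_inverse[OF A E] by metis
  define Z where "Z = ?K ?C * R * ?K B"
  have CR: "?K ?C * R \<in> carrier_mat n r" using C R(1) by simp
  have Z: "Z \<in> carrier_mat n n" "proper.over Z"
    unfolding Z_def using CR B proper.over_mult[of "?K ?C * R" n r "?K B" n] proper.over_mult[of "?K ?C" n r R r] C R(1,2)
    by simp_all
  define Ah where "Ah = (\<lambda>j. if j = 0 then ?K (Ac 0) + Z else ?K (Ac j))"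
  have Ah: "Ah j \<in> carrier_mat n n \<and> proper.over (Ah j)" if "j \<le> m" for j
    using Ac[of j] Ac[of 0] that Z by (auto simp: Ah_def intro!: proper.over_add[of _ n n])
  have Am: "Ah m = ?K (Ac m)" using m by (simp add: Ah_def)
  define X where "X = gf_pencil n odd rat_var Ah m (Ah m)"
  define D where "D = dsum (0\<^sub>m ?a ?a) Z"
  have D: "D \<in> carrier_mat N N" unfolding D_def N[symmetric] using Z by (intro dsum_carrier) auto
  \<comment> \<open>The last factor of \<open>Ep\<close> is \<open>diag(I, - A_0)\<close>. The others have even indices \<open>j \<ge> 2\<close> and fix
    the last block column, so that \<open>diag(0, Z)\<close> can be split off from the whole product.\<close>
  have X: "X = rat_var \<cdot>\<^sub>m ?K (Tp * Dn) - (?K Ep - D)"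
  proof -
    let ?lst = "filter (\<lambda>j. \<not> odd j) (rev [1..<m])"
    have sp: "spot n m 0 (Ah m) = ?K Tp"
      unfolding Tp_spot[symmetric] Am const_rat_def
      by (rule spot_map[OF const_rat_hom.hom_zero const_rat_hom.hom_one, symmetric])
    have d: "neg_prod n odd Ah m = ?K Dn"
    proof -
      have "neg_prod n odd Ah m = neg_prod n odd (\<lambda>j. ?K (Ac j)) m"
        unfolding neg_prod_def by (intro arg_cong[of _ _ "mat_prod N"] map_cong refl) (auto simp: Ah_def)
      also have "\<dots> = ?K Dn"
        unfolding Dn_def const_rat_def by (rule const_rat_hom.neg_prod_hom[symmetric]) (use Ac m in auto)
      finally show ?thesis .
    qed
    define Qh where "Qh = mat_prod N (map (\<lambda>j. cross n m (m - j - 1) (- ?K (Ac j)) (0\<^sub>m n n)) ?lst)"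
    have Qh: "Qh \<in> carrier_mat N N" unfolding Qh_def
      by (rule mat_prod_carrier[OF pos_factors_carrier]) (use Ac m in auto)
    have p1: "pos_prod n odd Ah m = Qh * spot n m (m - 1) (- (?K (Ac 0) + Z))"
    proof -
      have "mat_prod N (map (\<lambda>j. cross n m (m - j - 1) (- Ah j) (0\<^sub>m n n)) ?lst) = Qh"
        unfolding Qh_def by (intro arg_cong[of _ _ "mat_prod N"] map_cong refl) (auto simp: Ah_def)
      then show ?thesis unfolding pos_prod_def by (simp add: Ah_def)
    qed
    have p2: "?K Ep = Qh * spot n m (m - 1) (- ?K (Ac 0))"
    proof -
      have "?K Ep = pos_prod n odd (\<lambda>j. ?K (Ac j)) m"
        unfolding Ep_def const_rat_def by (rule const_rat_hom.pos_prod_hom) (use Ac m in auto)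
      then show ?thesis unfolding pos_prod_def Qh_def .
    qed
    have QF: "Qh = ?K (F (map int ?lst))"
    proof -
      have z: "?K (0\<^sub>m n n) = 0\<^sub>m n n" by (intro eq_matI) (auto simp: const_rat_def)
      have v: "valid (map int ?lst)" by auto
      have fc: "?K (fiedler_P n m Ac (int j)) = cross n m (m - j - 1) (- ?K (Ac j)) (0\<^sub>m n n)" if "0 < j" "j < m" for j
      proof -
        have "fiedler_P n m Ac (int j) = cross n m (m - j - 1) (- Ac j) (0\<^sub>m n n)"
          using that by (simp add: fiedler_P_coeff fiedler_coeff_def elem_mat_pos)
        then have "?K (fiedler_P n m Ac (int j)) = cross n m (m - j - 1) (?K (- Ac j)) (?K (0\<^sub>m n n))"
          unfolding const_rat_def using Ac[of j] that
          by (simp add: cross_map[where n = n, OF _ _ const_rat_hom.hom_zero const_rat_hom.hom_one])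
        then show ?thesis unfolding z const_rat_uminus .
      qed
      have "?K (F (map int ?lst)) = mat_prod N (map ?K (map (fiedler_P n m Ac) (map int ?lst)))"
        unfolding fiedler_P_prod_def const_rat_def by (rule const_rat_hom.mat_hom_prod[OF fiedlers_carrier[OF v]])
      also have "map ?K (map (fiedler_P n m Ac) (map int ?lst)) = map (\<lambda>j. cross n m (m - j - 1) (- ?K (Ac j)) (0\<^sub>m n n)) ?lst"
        unfolding map_map
        by (rule map_cong[OF refl], unfold comp_def, rule fc) auto
      finally show ?thesis unfolding Qh_def ..
    qed
    have lc: "?l = ?K (col0 (1\<^sub>m n))"
      unfolding const_rat_def using elem_col_last_block[of "\<lambda>c. to_fract [:c:]" "1\<^sub>m n" n]
      by (simp add: const_rat_hom.mat_hom_one right_mult_one_mat[OF last_block_carrier])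
    have Ql: "Qh * ?l = ?l"
    proof -
      have v: "valid (map int ?lst)" by auto
      have "F (map int ?lst) * col0 (1\<^sub>m n) = col0 (1\<^sub>m n)"
        using m by (intro F_fixes_col[OF _ v]) auto
      then show ?thesis unfolding QF lc
        using F_carrier[OF v] elem_col_carrier[of "1\<^sub>m n" n 0] by (simp flip: const_rat_mult[of _ N N _ n])
    qed
    have QD: "Qh * D = D"
    proof -
      have lT: "Z * transpose_mat ?l \<in> carrier_mat n N" using Z by (intro mult_carrier_mat[of _ _ n]) auto
      have "Qh * D = Qh * ?l * (Z * transpose_mat ?l)"
        unfolding D_def last_block_sandwich[OF Z(1), symmetric] using Qh lT
        by (intro assoc_mult_mat[of _ N N _ n _ N, symmetric]) auto
      then show ?thesis unfolding Ql D_def last_block_sandwich[OF Z(1)] .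
    qed
    have sd: "spot n m (m - 1) (- (?K (Ac 0) + Z)) = spot n m (m - 1) (- ?K (Ac 0)) - D"
      unfolding spot_def D_def using m Ac[of 0] Z by (intro eq_matI) (auto simp: const_rat_def)
    have sc: "spot n m (m - 1) (- ?K (Ac 0)) \<in> carrier_mat N N" using m Ac[of 0] by (intro spot_carrier) auto
    have "pos_prod n odd Ah m = ?K Ep - D"
      unfolding p1 p2 sd mult_minus_distrib_mat[OF Qh sc D] QD ..
    then show ?thesis unfolding X_def gf_pencil_def sp d using const_rat_mult[OF carriers(6,7)] by simp
  qed
  have Xc: "X \<in> carrier_mat N N" unfolding X using carriers D by (intro minus_carrier_mat) auto
  have hG: "horner rat_var Ah m (Ah m) = G"
  proof -
    have G: "G = rat_mat (matpoly n m Ac) + Z"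
      unfolding G_def Z_def using transfer_function_eq[OF A E(1) R(1,3,4)] .
    show ?thesis unfolding G
    proof (rule eq_matI)
      have h: "horner rat_var Ah m (Ah m) \<in> carrier_mat n n" using Ah by (intro horner_sum) auto
      then show "dim_row (horner rat_var Ah m (Ah m)) = dim_row (rat_mat (matpoly n m Ac) + Z)"
        "dim_col (horner rat_var Ah m (Ah m)) = dim_col (rat_mat (matpoly n m Ac) + Z)" using Z by auto
      fix i j assume "i < dim_row (rat_mat (matpoly n m Ac) + Z)" "j < dim_col (rat_mat (matpoly n m Ac) + Z)"
      then have ij: "i < n" "j < n" using Z by auto
      have a: "Ah l $$ (i, j) = to_fract [:Ac l $$ (i, j):] + (if l = 0 then Z $$ (i, j) else 0)" if "l \<le> m" for l
        using Ac[OF that] Ac[of 0] Z ij by (auto simp: Ah_def const_rat_def)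
      have "horner rat_var Ah m (Ah m) $$ (i, j) = rat_var ^ m * Ah m $$ (i, j) + (\<Sum>l<m. rat_var ^ l * Ah l $$ (i, j))"
        using Ah ij by (intro horner_sum) auto
      also have "\<dots> = (\<Sum>l\<le>m. rat_var ^ l * Ah l $$ (i, j))" by (simp add: lessThan_Suc_atMost[symmetric])
      also have "\<dots> = (\<Sum>l\<le>m. rat_var ^ l * to_fract [:Ac l $$ (i, j):] + (if l = 0 then Z $$ (i, j) else 0))"
        by (intro sum.cong) (auto simp: a distrib_left)
      also have "\<dots> = rat_mat (matpoly n m Ac) $$ (i, j) + Z $$ (i, j)"
        using ij by (simp add: sum.distrib rat_mat_matpoly_index)
      finally show "horner rat_var Ah m (Ah m) $$ (i, j) = (rat_mat (matpoly n m Ac) + Z) $$ (i, j)"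
        using ij Z by (simp add: matpoly_def)
    qed
  qed
  obtain U V where UV: "proper.kunit N U" "proper.kunit N V" "U * (?\<mu> \<cdot>\<^sub>m X) * V = dsum (1\<^sub>m ?a) (?\<mu> ^ m \<cdot>\<^sub>m G)"
  proof -
    have i: "rat_var * ?\<mu> = 1" using rat_var_nonzero by simp
    show ?thesis
      using proper.gf_pencil_reversed_horner[where A = Ah and n = n and s = odd, OF m Ah i inverse_rat_var_proper(1)] that
      unfolding hG X_def by blast
  qed
  obtain I1 where I1: "I1 \<in> carrier_mat N N" "R1 * I1 = 1\<^sub>m N" "I1 * R1 = 1\<^sub>m N"
    using invertible_mat_obtain_inverse[OF R_invertible(1)[OF inv] R_carriers(3)] by blast
  obtain I2 where I2: "I2 \<in> carrier_mat N N" "R2 * I2 = 1\<^sub>m N" "I2 * R2 = 1\<^sub>m N"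
    using invertible_mat_obtain_inverse[OF R_invertible(2)[OF inv] R_carriers(4)] by blast
  note i1 = const_rat_inverse[OF I1(1) R_carriers(3) I1(3,2)]
  note i2 = const_rat_inverse[OF I2(1) R_carriers(4) I2(3,2)]
  have cR: "?K R1 \<in> carrier_mat N N" "?K R2 \<in> carrier_mat N N" "?K I1 \<in> carrier_mat N N" "?K I2 \<in> carrier_mat N N"
    using R_carriers I1 I2 by auto
  have GG: "transfer_function L c (transpose_mat c) A E = ?K R1 * X * ?K R2"
  proof -
    have L: "rat_mat L = rat_var \<cdot>\<^sub>m ?K lead - ?K trail"
      unfolding L_def by (rule rat_pencil[OF lead_trail_carrier(2,1)])
    have lT: "?K lead = ?K R1 * ?K (Tp * Dn) * ?K R2" "?K trail = ?K R1 * ?K Ep * ?K R2"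
      unfolding lead_trail_factor using carriers R_carriers
      by (simp_all add: const_rat_mult[of _ N N _ N] mult_carrier_mat[of _ N N _ N])
    have colc: "?K (col0 ?C) = ?l * ?K ?C"
      unfolding const_rat_def using C by (intro elem_col_last_block) auto
    have lKc: "?l * ?K ?C \<in> carrier_mat N r" using C by (intro mult_carrier_mat[of _ _ n]) auto
    have cc: "?K c = ?K R1 * (?l * ?K ?C)"
      unfolding colc[symmetric] c_def R1_col(1)[OF C, symmetric] using R_carriers ec[of 0] by (simp add: const_rat_mult[of _ N N _ r])
    have rr: "?K (transpose_mat c) = ?K B * transpose_mat ?l * ?K R2"
    proof -
      have "?K (transpose_mat c) = ?K (transpose_mat (col0 ?C)) * ?K R2"
        unfolding c_def R2_row[OF C, symmetric] using R_carriers ec[of 0] by (simp add: const_rat_mult[of _ r N _ N])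
      also have "?K (transpose_mat (col0 ?C)) = transpose_mat (?l * ?K ?C)"
        unfolding const_rat_transpose[symmetric] colc ..
      also have "\<dots> = ?K B * transpose_mat ?l"
        using B by (simp add: transpose_mult[of _ N n _ r] const_rat_transpose)
      finally show ?thesis .
    qed
    have "?K c * R * ?K (transpose_mat c) = ?K R1 * (?l * (Z * transpose_mat ?l)) * ?K R2"
      unfolding cc rr Z_def using cR R B
      by (simp add: assoc_mult_mat[of _ N N _ n _ r] assoc_mult_mat[of _ N N _ r _ r] assoc_mult_mat[of _ N N _ r _ N]
          assoc_mult_mat[of _ N n _ r _ r] assoc_mult_mat[of _ N n _ r _ N] assoc_mult_mat[of _ n r _ r _ N] assoc_mult_mat[of _ n r _ r _ n]
          assoc_mult_mat[of _ n r _ n _ N] assoc_mult_mat[of _ r n _ N _ N] assoc_mult_mat[of _ N N _ n _ N] assoc_mult_mat[of _ N N _ N _ N]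
          assoc_mult_mat[of _ N n _ N _ N] assoc_mult_mat[of _ n r _ N _ N] assoc_mult_mat[of _ r r _ N _ N] assoc_mult_mat[of _ r r _ n _ N]
          mult_carrier_mat[of _ N n] mult_carrier_mat[of _ r n] mult_carrier_mat[of _ n r] mult_carrier_mat[of _ r r] mult_carrier_mat[of _ N r] mult_carrier_mat[of _ N N] mult_carrier_mat[of _ n N] mult_carrier_mat[of _ r N])
    also have "?l * (Z * transpose_mat ?l) = D" unfolding D_def by (rule last_block_sandwich[OF Z(1)])
    finally have "?K c * R * ?K (transpose_mat c) = ?K R1 * D * ?K R2" .
    then have "transfer_function L c (transpose_mat c) A E
      = rat_var \<cdot>\<^sub>m (?K R1 * ?K (Tp * Dn) * ?K R2) - ?K R1 * ?K Ep * ?K R2 + ?K R1 * D * ?K R2"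
      unfolding transfer_function_eq[OF A E(1) R(1,3,4)] L lT by simp
    also have "\<dots> = ?K R1 * X * ?K R2"
    proof -
      have t: "?K (Tp * Dn) \<in> carrier_mat N N" "?K Ep \<in> carrier_mat N N"
        using carriers by (auto intro!: mult_carrier_mat[of _ _ N])
      have p: "?K R1 * M * ?K R2 \<in> carrier_mat N N" if "M \<in> carrier_mat N N" for M
        using that cR by (auto intro!: mult_carrier_mat[of _ _ N])
      have "?K R1 * X * ?K R2 = rat_var \<cdot>\<^sub>m (?K R1 * ?K (Tp * Dn) * ?K R2) - (?K R1 * ?K Ep * ?K R2 - ?K R1 * D * ?K R2)"
        unfolding X using t cR D
        by (simp add: mult_minus_distrib_mat[of _ N N _ N] minus_mult_distrib_mat[of _ N N _ _ N] mult_smult_distrib[of _ N N _ N]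
          mult_smult_assoc_mat[of _ N N _ N] mult_carrier_mat[of _ N N _ N] minus_carrier_mat)
      also have "\<dots> = rat_var \<cdot>\<^sub>m (?K R1 * ?K (Tp * Dn) * ?K R2) - ?K R1 * ?K Ep * ?K R2 + ?K R1 * D * ?K R2"
        using p[OF t(1)] p[OF t(2)] p[OF D] by (intro eq_matI) (auto simp del: index_mult_mat(1))
      finally show ?thesis by simp
    qed
    finally show ?thesis .
  qed
  note cU = UV(1,2)[THEN proper.kunit_carrier]
  have "U * ?K I1 * (?\<mu> \<cdot>\<^sub>m transfer_function L c (transpose_mat c) A E) * (?K I2 * V)
    = U * (?\<mu> \<cdot>\<^sub>m ((?K I1 * ?K R1) * X * (?K R2 * ?K I2))) * V"
    unfolding GG using cU cR Xc
    by (simp add: mult_smult_distrib[of _ N N _ N] mult_smult_assoc_mat[of _ N N _ N] assoc_mult_mat[of _ N N _ N _ N] mult_carrier_mat[of _ N N _ N])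
  also have "\<dots> = dsum (1\<^sub>m ?a) (?\<mu> ^ m \<cdot>\<^sub>m G)"
    unfolding i1(1) i2(2) using Xc UV(3) by simp
  finally show ?thesis
    using kunit_biproper[OF proper.kunit_mult[OF UV(1) i1(3)]] kunit_biproper[OF proper.kunit_mult[OF i2(3) UV(2)]] by blast
qed

lemma linearization:
  assumes min: "minimal_realization n r G (matpoly n m Ac) A E B (transpose_mat B)"
    and sym: "symmetric_mat A" "symmetric_mat E" and inv: "odd k \<Longrightarrow> invertible_mat (Ac m)"
  defines "c \<equiv> colT (transpose_mat B)"
  shows "rosenbrock_strong_linearization n m r (system_matrix (matpoly n m Ac) A E B (transpose_mat B)) G
    (four_block_mat L (const_mat c) (const_mat (transpose_mat c)) (pencil A E))"
proof -
  have cr: "A \<in> carrier_mat r r" "E \<in> carrier_mat r r" "invertible_mat E" "B \<in> carrier_mat r n"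
    "G = transfer_function (matpoly n m Ac) (transpose_mat B) B A E"
    using min by (auto simp: minimal_realization_def realization_def)
  have c: "c \<in> carrier_mat N r" unfolding c_def using cr by (intro elem_col_carrier) auto
  obtain U V where UV: "unimodular N U" "unimodular N V"
    "dsum U (1\<^sub>m r) * four_block_mat L (const_mat c) (const_mat (transpose_mat c)) (pencil A E) * dsum V (1\<^sub>m r)
      = dsum (1\<^sub>m ((m - 1) * n)) (system_matrix (matpoly n m Ac) A E B (transpose_mat B))"
    using unimodular_equivalence[OF cr(1,2,4) inv] unfolding c_def by blast
  obtain Ol Or where O: "biproper N Ol" "biproper N Or"
    "Ol * (inverse rat_var \<cdot>\<^sub>m transfer_function L c (transpose_mat c) A E) * Or
      = dsum (1\<^sub>m ((m - 1) * n)) (inverse rat_var ^ m \<cdot>\<^sub>m G)"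
    using biproper_equivalence[OF cr(1-4) inv] unfolding c_def cr(5) by blast
  have one: "invertible_mat (1\<^sub>m r :: complex mat)" by (auto intro!: invertible_matI[of _ r "1\<^sub>m r"])
  show ?thesis
    unfolding rosenbrock_strong_linearization_def diag_block_mat_two
    apply (rule exI[of _ "- trail"], rule exI[of _ "- lead"], rule exI[of _ c], rule exI[of _ "transpose_mat c"],
        rule exI[of _ A], rule exI[of _ E], intro conjI)
    subgoal using lead_trail_carrier by simp
    subgoal using lead_trail_carrier by simp
    subgoal using c .
    subgoal using c by simp
    subgoal using cr by simp
    subgoal using cr by simp
    subgoal using cr by simp
    subgoal unfolding L_pencil ..
    subgoal using rank_conditions(1)[OF min sym] unfolding c_def by blast
    subgoal using rank_conditions(2)[OF min sym] unfolding c_def by blast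
    subgoal
      apply (rule exI[of _ U], rule exI[of _ V], rule exI[of _ "1\<^sub>m r"], rule exI[of _ "1\<^sub>m r"])
      using UV one by simp
    subgoal using O unfolding L_pencil[symmetric] rat_var_def by blast
    done
qed

text \<open>
  The border row is the transposed border column, and \<open>(\<lambda> E - A)\<inverse>\<close> is symmetric along with \<open>\<lambda> E - A\<close>.
\<close>
lemma blocks_symmetric:
  assumes Asym: "\<And>i. i \<le> m \<Longrightarrow> symmetric_mat (Ac i)" "\<forall>M\<in>set X \<union> set Y. symmetric_mat M"
    and cr: "A \<in> carrier_mat r r" "E \<in> carrier_mat r r" "invertible_mat E" "c \<in> carrier_mat N r"
    and sym: "symmetric_mat A" "symmetric_mat E"
  shows "symmetric_mat (four_block_mat L (const_mat c) (const_mat (transpose_mat c)) (pencil A E))"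
    "symmetric_mat (transfer_function L c (transpose_mat c) A E)"
proof -
  have L: "transpose_mat L = L"
    unfolding L_def using lead_trail_symmetric[OF Asym] lead_trail_carrier
    by (subst transpose_minus[of _ N N]) (auto simp: const_mat_transpose transpose_smult_mat)
  have p: "transpose_mat (pencil A E) = pencil A E"
    unfolding pencil_def using cr sym
    by (subst transpose_minus[of _ r r]) (auto simp: const_mat_transpose symmetric_mat_def transpose_smult_mat)
  show "symmetric_mat (four_block_mat L (const_mat c) (const_mat (transpose_mat c)) (pencil A E))"
    unfolding symmetric_mat_def using L_carrier cr pencil_carrier[OF cr(1,2)]
    by (subst transpose_four_block_mat[of _ N N _ r _ r]) (auto simp: L p const_mat_transpose)
  let ?D = "rat_var \<cdot>\<^sub>m const_rat E - const_rat A"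
  obtain R where R: "R \<in> carrier_mat r r" "?D * R = 1\<^sub>m r" "R * ?D = 1\<^sub>m r"
    using rat_pencil_inverse[OF cr(1-3)] by metis
  have Dc: "?D \<in> carrier_mat r r" using cr by (intro minus_carrier_mat) simp
  have Dt: "transpose_mat ?D = ?D"
    using cr sym by (subst transpose_minus[of _ r r]) (auto simp: const_rat_transpose symmetric_mat_def transpose_smult_mat)
  have Rt: "transpose_mat R = R"
  proof -
    have "transpose_mat R * ?D = transpose_mat (?D * R)" using Dc R(1) Dt by (simp add: transpose_mult[of _ r r _ r])
    then have "transpose_mat R * ?D = 1\<^sub>m r" unfolding R(2) by simp
    then have "transpose_mat R * ?D * R = R" using R(1) by simp
    moreover have "transpose_mat R * ?D * R = transpose_mat R * (?D * R)"
      using Dc R(1) by (intro assoc_mult_mat[of _ r r _ r]) auto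
    ultimately show ?thesis unfolding R(2) using R(1) by simp
  qed
  have t: "transpose_mat (rat_mat L) = rat_mat L" using L by (metis map_mat_transpose rat_mat_def)
  have "transpose_mat (const_rat c * R * const_rat (transpose_mat c)) = const_rat c * R * const_rat (transpose_mat c)"
  proof -
    have k: "const_rat c \<in> carrier_mat N r" "const_rat (transpose_mat c) \<in> carrier_mat r N" using cr(4) by auto
    have "transpose_mat (const_rat c * R * const_rat (transpose_mat c))
      = transpose_mat (const_rat (transpose_mat c)) * transpose_mat (const_rat c * R)"
      by (rule transpose_mult[of _ N r _ N]) (use k R(1) in auto)
    also have "transpose_mat (const_rat c * R) = transpose_mat R * transpose_mat (const_rat c)"
      by (rule transpose_mult[OF k(1) R(1)])
    also have "transpose_mat (const_rat (transpose_mat c)) * (transpose_mat R * transpose_mat (const_rat c))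
      = const_rat c * R * const_rat (transpose_mat c)"
      unfolding Rt const_rat_transpose transpose_transpose by (rule assoc_mult_mat[OF k(1) R(1) k(2), symmetric])
    finally show ?thesis .
  qed
  then show "symmetric_mat (transfer_function L c (transpose_mat c) A E)"
    unfolding symmetric_mat_def transfer_function_eq[OF cr(1,2) R] using L_carrier cr(4) R(1) t
    by (subst transpose_add[of _ N N]) (auto intro!: mult_carrier_mat[of _ _ r])
qed

end

section \<open>Symmetric Rosenbrock strong linearizations\<close>

theorem corollary4p9:
  fixes n m r h \<alpha> :: nat
    and G \<GG> :: "complex poly fract mat"
    and Ac :: "nat \<Rightarrow> complex mat"
    and P S L \<LL> :: "complex poly mat"
    and A E B :: "complex mat"
    and tw tv :: "int list"
    and X Y :: "complex mat list"
  assumes "1 \<le> m"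
    and "\<And>i. i \<le> m \<Longrightarrow> Ac i \<in> carrier_mat n n"
    and "Ac m \<noteq> 0\<^sub>m n n"
    and P: "P = matpoly n m Ac"
    and "symmetric_mat P"
    and "symmetric_mat G"
    and "minimal_realization n r G P A E B (transpose_mat B)"
    and "symmetric_mat A" and "symmetric_mat E"
    and S: "S = system_matrix P A E B (transpose_mat B)"
    and "h \<le> m - 1" and "even h"
    and "canonical_form h tw"
    and "canonical_form (m - h - 1) (shift (int m) tv)"
    and "matrix_assignment n tw X" and "nonsingular_assignment m tw X"
    and "matrix_assignment n tv Y" and "nonsingular_assignment m tv Y"
    and "\<forall>M \<in> set X \<union> set Y. symmetric_mat M"
    and alpha: "\<alpha> = i0 (tw @ w_tuple h)"
    and L: "L = L_P n m Ac h tw tv X Y"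
    and LL: "\<LL> = L_S n m r Ac A E B (transpose_mat B) h tw tv X Y"
    and GG: "\<GG> = transfer_function L (kron (e_col m (m - \<alpha>)) (transpose_mat B))
                   (kron (transpose_mat (e_col m (m - \<alpha>))) B) A E"
  shows "\<LL> = four_block_mat L (const_mat (kron (e_col m (m - \<alpha>)) (transpose_mat B)))
               (const_mat (kron (transpose_mat (e_col m (m - \<alpha>))) B)) (pencil A E) \<and>
         (odd m \<longrightarrow>
            symmetric_mat \<LL> \<and> rosenbrock_strong_linearization n m r S G \<LL>) \<and>
         (even m \<longrightarrow> invertible_mat (Ac m) \<longrightarrow>
            symmetric_mat \<LL> \<and> rosenbrock_strong_linearization n m r S G \<LL>) \<and>
         symmetric_mat \<GG>"
proof -
  note a = assms
  obtain q where h: "h = 2 * q" using a(12) by blast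
  define k where "k = m - 2 * q - 1"
  have mk: "m = 2 * q + 1 + k" using a(1,11) unfolding k_def h by simp
  have par: "odd k \<longleftrightarrow> even m" unfolding mk by simp
  interpret gfpr n m Ac q k tw tv X Y
  proof
    show "1 \<le> m" "m = 2 * q + 1 + k" "canonical_form (2 * q) tw" "canonical_form k (shift (int m) tv)"
      using a(1,13,14) mk unfolding h k_def by auto
    show "\<And>i. i \<le> m \<Longrightarrow> Ac i \<in> carrier_mat n n" by (rule a(2))
    show "length X = length tw" "set X \<subseteq> carrier_mat n n" "length Y = length tv" "set Y \<subseteq> carrier_mat n n"
      using a(15,17) by (auto simp: matrix_assignment_def)
    show "nonsingular_assignment m tw X" "nonsingular_assignment m tv Y" by (rule a(16), rule a(18))
  qed
  note min = a(7)[unfolded P]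
  have cr: "A \<in> carrier_mat r r" "E \<in> carrier_mat r r" "invertible_mat E" "B \<in> carrier_mat r n"
    using min by (auto simp: minimal_realization_def realization_def)
  let ?c = "colT (transpose_mat B)"
  have c: "?c \<in> carrier_mat N r" using cr by (intro elem_col_carrier) auto
  have al: "int \<alpha> = top_col" unfolding alpha h by (rule i0_top_col)
  then have "\<alpha> < m" using tw_climb(4) by simp
  then have k1: "kron (e_col m (m - \<alpha>)) (transpose_mat B) = ?c"
    using kron_e_col[of \<alpha> m "transpose_mat B" n r] cr(4) al by simp
  then have k2: "kron (transpose_mat (e_col m (m - \<alpha>))) B = transpose_mat ?c"
    using kron_transpose_mat[of "e_col m (m - \<alpha>)" "transpose_mat B"] by simp
  have Leq: "L = gfpr.L n m Ac q k tw tv X Y"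
    unfolding assms(21) h L_P_eq L_def ..
  have LLeq: "\<LL> = four_block_mat L (const_mat ?c) (const_mat (transpose_mat ?c)) (pencil A E)"
    unfolding LL h L_S_blocks[OF cr(1,2,4)] assms(21) ..
  have Ac_sym: "symmetric_mat (Ac i)" if "i \<le> m" for i
    using matpoly_symmetric_coeffs[of n m Ac i] a(2,5) that unfolding P by blast
  note sym = blocks_symmetric[OF Ac_sym a(19) cr(1-3) c a(8,9)]
  have lin: "rosenbrock_strong_linearization n m r S G \<LL>" if "odd k \<Longrightarrow> invertible_mat (Ac m)"
    unfolding LLeq Leq S P by (rule linearization[OF min a(8,9) that])
  show ?thesis
    unfolding k1 k2 using LLeq sym lin par unfolding GG k1 k2 Leq by auto
qed

end
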